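(* For all $i\in\{1,\dots,n\}$, $t\in\mathbb{T}_n$ and arbitrary $l_0\in\{1,\dots,r_i\}$, the following equalities hold: $$F_{i;t}^{\mathrm{g}}({\bf y},{\bf z})=\left.\prod_{l=1}^{r_i}F_{il;t}^{\mathrm{c}}({\bf s}{\bf y})\right|_{{\bf e} = {\bf z}}=\left.\prod_{m=1}^{r_i}F_{il_0;t}^{\mathrm{c}}\left(({\bf s}{\bf y})^{\tau_{il_0,im}}\right)\right|_{{\bf e} = {\bf z}}.$$
   Context: Notation: $[a]_+=\max(a,0)$; $\delta$ is the Kronecker delta. Fix $n\ge1$, ${\bf r}=(r_1,\dots,r_n)\in\mathbb{Z}_{\ge1}^n$. $\mathbb{T}_n$ is the $n$-regular tree with edges labeled $1,\dots,n$ (the $n$ edges at each vertex having distinct labels); vertices joined by an edge labeled $k$ are $k$-adjacent; $t_0$ is a fixed vertex. Let $\mathcal{D}=\{(i,l)\mid 1\le i\le n,\ 1\le l\le r_i\}$, $\mathcal{D}'=\{(i,l)\mid 1\le i\le n,\ 1\le l\le r_i-1\}$, and let ${\bf y}=(y_i)_{i=1}^n$, ${\bf z}=(z_{il})_{(i,l)\in\mathcal{D}'}$, ${\bf s}=(s_{il})_{(i,l)\in\mathcal{D}}$, $\tilde{\bf y}=(\tilde y_{il})_{(i,l)\in\mathcal{D}}$ be formal variables. Generalized side. Let $B_{t_0}$ be a skew-symmetrizable integer $n\times n$ matrix (the initial exchange matrix of a generalized cluster pattern with mutation degree ${\bf r}$). The exchange matrices $B_t=(b_{ij;t})$ are determined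 by: for $k$-adjacent $t,t'$, $b_{ij;t'}=-b_{ij;t}$ if $i=k$ or $j=k$, else $b_{ij;t'}=b_{ij;t}+r_k(b_{ik;t}[b_{kj;t}]_++[-b_{ik;t}]_+b_{kj;t})$. The $C$-matrices $(c^{\mathrm{g}}_{ij;t})$ are determined by $c^{\mathrm{g}}_{ij;t_0}=\delta_{ij}$ and, for $k$-adjacent $t,t'$, $c^{\mathrm{g}}_{ik;t'}=-c^{\mathrm{g}}_{ik;t}$, $c^{\mathrm{g}}_{ij;t'}=c^{\mathrm{g}}_{ij;t}+r_k(c^{\mathrm{g}}_{ik;t}[b_{kj;t}]_++[-c^{\mathrm{g}}_{ik;t}]_+b_{kj;t})$ for $j\ne k$. Put $\mathcal{Z}_{i;t_0}(u)=1+z_{i1}u+\cdots+z_{i,r_i-1}u^{r_i-1}+u^{r_i}$ and, for $k$-adjacent $t,t'$, $\mathcal{Z}_{k;t'}(u)=u^{r_k}\mathcal{Z}_{k;t}(u^{-1})$, $\mathcal{Z}_{i;t'}=\mathcal{Z}_{i;t}$ ($i\neq k$). The $F$-polynomials $F^{\mathrm{g}}_{i;t}({\bf y},{\bf z})$ (polynomials in ${\bf y},{\bf z}$ with integer coefficients) are determined by $F^{\mathrm{g}}_{i;t_0}=1$ and, for $k$-adjacent $t,t'$, $F^{\mathrm{g}}_{i;t'}=F^{\mathrm{g}}_{i;t}$ ($i\ne k$) and $$F^{\mathrm{g}}_{k;t'}=(F^{\mathrm{g}}_{k;t})^{-1}\Bigl(\prod_{j=1}^{n}y_j^{[-c_{jk;t}^{\mathrm{g}}]_{+}}(F_{j;t}^{\mathrm{g}})^{[-b_{jk;t}]_{+}}\Bigr)^{r_k}\mathcal{Z}_{k;t}\Bigl(\prod_{j=1}^{n}y_j^{c_{jk;t}^{\mathrm{g}}}(F_{j;t}^{\mathrm{g}})^{b_{jk;t}}\Bigr).$$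 Composite side. Let $\mathcal{B}_{t_0}$ be the $\mathcal{D}\times\mathcal{D}$ matrix with $((i,l),(j,m))$ entry $b_{ij;t_0}$. For triples $(\mathcal{B},C,F)$ with $\mathcal{B}=(b_{\iota\lambda})$, $C=(c_{\iota\lambda})$ matrices indexed by $\mathcal{D}$ and $F=(F_\lambda(\tilde{\bf y}))_{\lambda\in\mathcal{D}}$, the ordinary mutation $\mu_\kappa$ in direction $\kappa\in\mathcal{D}$ is: $b'_{\iota\lambda}=-b_{\iota\lambda}$ if $\iota=\kappa$ or $\lambda=\kappa$, else $b_{\iota\lambda}+b_{\iota\kappa}[b_{\kappa\lambda}]_++[-b_{\iota\kappa}]_+b_{\kappa\lambda}$; $c'_{\iota\kappa}=-c_{\iota\kappa}$, $c'_{\iota\lambda}=c_{\iota\lambda}+c_{\iota\kappa}[b_{\kappa\lambda}]_++[-c_{\iota\kappa}]_+b_{\kappa\lambda}$ ($\lambda\ne\kappa$); $F'_\lambda=F_\lambda$ ($\lambda\neq\kappa$), $F'_\kappa=F_\kappa^{-1}\prod_{\lambda}\tilde y_\lambda^{[-c_{\lambda\kappa}]_+}F_\lambda^{[-b_{\lambda\kappa}]_+}\bigl(1+\prod_\lambda\tilde y_\lambda^{c_{\lambda\kappa}}F_\lambda^{b_{\lambda\kappa}}\bigr)$. The polynomials $F^{\mathrm{c}}_{il;t}(\tilde{\bf y})$ ($(i,l)\in\mathcal{D}$, $t\in\mathbb{T}_n$) of the composite cluster pattern are determined by $C^{\mathrm{c}}_{t_0}=$ identity, $F^{\mathrm{c}}_{il;t_0}=1$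 and, for $k$-adjacent $t,t'$, $(\mathcal{B}_{t'},C^{\mathrm{c}}_{t'},F^{\mathrm{c}}_{t'})=\mu_{kr_k}\circ\cdots\circ\mu_{k2}\circ\mu_{k1}(\mathcal{B}_t,C^{\mathrm{c}}_t,F^{\mathrm{c}}_t)$, where $\mu_{kl}$ is the mutation in direction $(k,l)$. Substitutions. ${\bf s}{\bf y}=(s_{jm}y_j)_{(j,m)\in\mathcal{D}}$ is substituted for $\tilde{\bf y}$. For a permutation $\sigma$ of $\mathcal{D}$ and a tuple ${\bf w}=(w_{jm})_{(j,m)\in\mathcal{D}}$, ${\bf w}^\sigma=(w_{\sigma(j,m)})_{(j,m)\in\mathcal{D}}$. $\tau_{il,im}$ is the transposition of $(i,l)$ and $(i,m)$ if $l\ne m$, and the identity if $l=m$. The products $\prod_{l=1}^{r_i}F_{il;t}^{\mathrm{c}}({\bf s}{\bf y})$ and $\prod_{m=1}^{r_i}F_{il_0;t}^{\mathrm{c}}\left(({\bf s}{\bf y})^{\tau_{il_0,im}}\right)$ (for $1\le i\le n$, $1\le l_0\le r_i$, $t\in\mathbb{T}_n$) are symmetric in $s_{j1},\dots,s_{jr_j}$ for each $j$, hence are polynomials in ${\bf y}$ and ${\bf e}=(e_{jm})_{(j,m)\in\mathcal{D}}$, where $e_{jm}$ is the degree-$m$ elementary symmetric polynomial in $s_{j1},\dots,s_{jr_j}$; $|_{{\bf e}={\bf z}}$ means substituting in this expression $e_{jm}=z_{jm}$ for $(j,m)\in\mathcal{D}'$ and $e_{jr_j}=1$ for $j=1,\dots,n$.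 *)

theory Defs
  imports
    "HOL-Library.Poly_Mapping"
    "HOL-Library.Countable"
    "HOL-Computational_Algebra.Computational_Algebra"
    "HOL-Combinatorics.Transposition"
begin

section \<open>Index sets and the labelled regular tree\<close>

definition pos_part :: "int \<Rightarrow> int" (\<open>[_]\<^sub>+\<close>) where
  "[a]\<^sub>+ = max a 0"

definition idx :: "nat \<Rightarrow> (nat \<Rightarrow> nat) \<Rightarrow> (nat \<times> nat) set" where
  "idx n r = {(i, l). i \<in> {1..n} \<and> l \<in> {1..r i}}"

text \<open>\<open>adj k t t'\<close> says that \<open>t\<close> and \<open>t'\<close> are joined by an edge labelled \<open>k\<close>.  Being a tree is
  expressed by the existence of exactly one simple path between any two vertices.\<close>

definition simple_path :: "(nat \<Rightarrow> 'v \<Rightarrow> 'v \<Rightarrow> bool) \<Rightarrow> 'v \<Rightarrow> 'v \<Rightarrow> 'v list \<Rightarrow> bool" where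
  "simple_path adj t t' ts \<longleftrightarrow> ts \<noteq> [] \<and> hd ts = t \<and> last ts = t' \<and> distinct ts
     \<and> successively (\<lambda>u v. \<exists>k. adj k u v) ts"

definition labelled_regular_tree :: "nat \<Rightarrow> 'v set \<Rightarrow> (nat \<Rightarrow> 'v \<Rightarrow> 'v \<Rightarrow> bool) \<Rightarrow> bool" where
  "labelled_regular_tree n V adj \<longleftrightarrow>
     (\<forall>k t t'. adj k t t' \<longrightarrow> k \<in> {1..n} \<and> t \<in> V \<and> t' \<in> V \<and> t \<noteq> t' \<and> adj k t' t)
   \<and> (\<forall>k l t t'. adj k t t' \<and> adj l t t' \<longrightarrow> k = l)
   \<and> (\<forall>t\<in>V. \<forall>k\<in>{1..n}. \<exists>!t'. adj k t t')
   \<and> (\<forall>t\<in>V. \<forall>t'\<in>V. \<exists>!ts. simple_path adj t t' ts)"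

section \<open>Polynomials in the formal variables\<close>

datatype fvar =
    Y nat
  | Z "nat \<times> nat"
  | S "nat \<times> nat"
  | Yt "nat \<times> nat"
  | E "nat \<times> nat"

instance fvar :: countable
  by countable_datatype

text \<open>An arbitrary linear order on the variables; it is used only because the library proves
  that the polynomial ring is an integral domain under this assumption.\<close>

instantiation fvar :: linorder
begin
definition less_eq_fvar :: "fvar \<Rightarrow> fvar \<Rightarrow> bool" where "less_eq_fvar x y \<longleftrightarrow> to_nat x \<le> to_nat y"
definition less_fvar :: "fvar \<Rightarrow> fvar \<Rightarrow> bool" where "less_fvar x y \<longleftrightarrow> to_nat x < to_nat y"
instance
  by standard (auto simp: less_eq_fvar_def less_fvar_def)
end

type_synonym pol = "(fvar \<Rightarrow>\<^sub>0 nat) \<Rightarrow>\<^sub>0 int"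

definition Var :: "fvar \<Rightarrow> pol" where
  "Var x = Poly_Mapping.single (Poly_Mapping.single x 1) 1"

definition indets :: "pol \<Rightarrow> fvar set" where
  "indets p = (\<Union>m\<in>Poly_Mapping.keys p. Poly_Mapping.keys m)"

definition subst :: "(fvar \<Rightarrow> pol) \<Rightarrow> pol \<Rightarrow> pol" where
  "subst f p = (\<Sum>m\<in>Poly_Mapping.keys p.
     of_int (Poly_Mapping.lookup p m) * (\<Prod>x\<in>Poly_Mapping.keys m. f x ^ Poly_Mapping.lookup m x))"

abbreviation rvar :: "fvar \<Rightarrow> pol fract" where
  "rvar x \<equiv> to_fract (Var x)"

section \<open>The generalized side\<close>

definition skew_symmetrizable :: "nat \<Rightarrow> (nat \<Rightarrow> nat \<Rightarrow> int) \<Rightarrow> bool" where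
  "skew_symmetrizable n B \<longleftrightarrow> (\<exists>d :: nat \<Rightarrow> int. (\<forall>i\<in>{1..n}. d i > 0)
     \<and> (\<forall>i\<in>{1..n}. \<forall>j\<in>{1..n}. d i * B i j = - (d j * B j i)))"

definition gen_B_pattern ::
  "nat \<Rightarrow> (nat \<Rightarrow> nat) \<Rightarrow> (nat \<Rightarrow> 'v \<Rightarrow> 'v \<Rightarrow> bool) \<Rightarrow> 'v \<Rightarrow> (nat \<Rightarrow> nat \<Rightarrow> int)
     \<Rightarrow> ('v \<Rightarrow> nat \<Rightarrow> nat \<Rightarrow> int) \<Rightarrow> bool" where
  "gen_B_pattern n r adj t0 B0 B \<longleftrightarrow>
     (\<forall>i\<in>{1..n}. \<forall>j\<in>{1..n}. B t0 i j = B0 i j)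
   \<and> (\<forall>k t t'. adj k t t' \<longrightarrow> (\<forall>i\<in>{1..n}. \<forall>j\<in>{1..n}. B t' i j =
        (if i = k \<or> j = k then - B t i j
         else B t i j + int (r k) * (B t i k * [B t k j]\<^sub>+ + [- B t i k]\<^sub>+ * B t k j))))"

definition gen_C_pattern ::
  "nat \<Rightarrow> (nat \<Rightarrow> nat) \<Rightarrow> (nat \<Rightarrow> 'v \<Rightarrow> 'v \<Rightarrow> bool) \<Rightarrow> 'v \<Rightarrow> ('v \<Rightarrow> nat \<Rightarrow> nat \<Rightarrow> int)
     \<Rightarrow> ('v \<Rightarrow> nat \<Rightarrow> nat \<Rightarrow> int) \<Rightarrow> bool" where
  "gen_C_pattern n r adj t0 B C \<longleftrightarrow>
     (\<forall>i\<in>{1..n}. \<forall>j\<in>{1..n}. C t0 i j = (if i = j then 1 else 0))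
   \<and> (\<forall>k t t'. adj k t t' \<longrightarrow> (\<forall>i\<in>{1..n}. \<forall>j\<in>{1..n}. C t' i j =
        (if j = k then - C t i j
         else C t i j + int (r k) * (C t i k * [B t k j]\<^sub>+ + [- C t i k]\<^sub>+ * B t k j))))"

text \<open>The coefficient field is infinite, so a polynomial identity in \<open>u\<close> may be stated pointwise.\<close>

definition gen_Z_pattern ::
  "nat \<Rightarrow> (nat \<Rightarrow> nat) \<Rightarrow> (nat \<Rightarrow> 'v \<Rightarrow> 'v \<Rightarrow> bool) \<Rightarrow> 'v
     \<Rightarrow> ('v \<Rightarrow> nat \<Rightarrow> pol fract poly) \<Rightarrow> bool" where
  "gen_Z_pattern n r adj t0 Zp \<longleftrightarrow>
     (\<forall>i\<in>{1..n}. Zp t0 i = 1 + (\<Sum>l=1..r i - 1. monom (rvar (Z (i, l))) l) + monom 1 (r i))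
   \<and> (\<forall>k t t'. adj k t t' \<longrightarrow>
        (\<forall>u. u \<noteq> 0 \<longrightarrow> poly (Zp t' k) u = u ^ r k * poly (Zp t k) (inverse u))
      \<and> (\<forall>i\<in>{1..n}. i \<noteq> k \<longrightarrow> Zp t' i = Zp t i))"

text \<open>The \<open>F\<close>-polynomials are polynomials in \<open>\<^bold>y\<close> and \<open>\<^bold>z\<close>; their recursion is an identity of
  rational functions.\<close>

definition gen_F_pattern ::
  "nat \<Rightarrow> (nat \<Rightarrow> nat) \<Rightarrow> 'v set \<Rightarrow> (nat \<Rightarrow> 'v \<Rightarrow> 'v \<Rightarrow> bool) \<Rightarrow> 'v
     \<Rightarrow> ('v \<Rightarrow> nat \<Rightarrow> nat \<Rightarrow> int) \<Rightarrow> ('v \<Rightarrow> nat \<Rightarrow> nat \<Rightarrow> int)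
     \<Rightarrow> ('v \<Rightarrow> nat \<Rightarrow> pol fract poly) \<Rightarrow> ('v \<Rightarrow> nat \<Rightarrow> pol) \<Rightarrow> bool" where
  "gen_F_pattern n r V adj t0 B C Zp F \<longleftrightarrow>
     (\<forall>t\<in>V. \<forall>i\<in>{1..n}.
        indets (F t i) \<subseteq> Y ` {1..n} \<union> Z ` {(j, l). j \<in> {1..n} \<and> l \<in> {1..r j - 1}})
   \<and> (\<forall>i\<in>{1..n}. F t0 i = 1)
   \<and> (\<forall>k t t'. adj k t t' \<longrightarrow>
        (\<forall>i\<in>{1..n}. i \<noteq> k \<longrightarrow> F t' i = F t i)
      \<and> to_fract (F t' k) =
          inverse (to_fract (F t k))
          * (\<Prod>j=1..n. rvar (Y j) powi [- C t j k]\<^sub>+ * to_fract (F t j) powi [- B t j k]\<^sub>+) ^ r k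
          * poly (Zp t k) (\<Prod>j=1..n. rvar (Y j) powi C t j k * to_fract (F t j) powi B t j k))"

section \<open>The composite side\<close>

type_synonym triple =
  "(nat \<times> nat \<Rightarrow> nat \<times> nat \<Rightarrow> int) \<times> (nat \<times> nat \<Rightarrow> nat \<times> nat \<Rightarrow> int) \<times> (nat \<times> nat \<Rightarrow> pol fract)"

definition mu :: "(nat \<times> nat) set \<Rightarrow> nat \<times> nat \<Rightarrow> triple \<Rightarrow> triple" where
  "mu D \<kappa> = (\<lambda>(B, C, F).
     (\<lambda>\<iota> \<nu>. if \<iota> = \<kappa> \<or> \<nu> = \<kappa> then - B \<iota> \<nu>
             else B \<iota> \<nu> + B \<iota> \<kappa> * [B \<kappa> \<nu>]\<^sub>+ + [- B \<iota> \<kappa>]\<^sub>+ * B \<kappa> \<nu>,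
      \<lambda>\<iota> \<nu>. if \<nu> = \<kappa> then - C \<iota> \<nu>
             else C \<iota> \<nu> + C \<iota> \<kappa> * [B \<kappa> \<nu>]\<^sub>+ + [- C \<iota> \<kappa>]\<^sub>+ * B \<kappa> \<nu>,
      \<lambda>\<nu>. if \<nu> \<noteq> \<kappa> then F \<nu>
           else inverse (F \<kappa>)
             * (\<Prod>\<iota>\<in>D. rvar (Yt \<iota>) powi [- C \<iota> \<kappa>]\<^sub>+ * F \<iota> powi [- B \<iota> \<kappa>]\<^sub>+)
             * (1 + (\<Prod>\<iota>\<in>D. rvar (Yt \<iota>) powi C \<iota> \<kappa> * F \<iota> powi B \<iota> \<kappa>))))"

text \<open>\<open>fold\<close> applies the mutation in direction \<open>(k, 1)\<close> first.\<close>

definition mu_block :: "(nat \<times> nat) set \<Rightarrow> (nat \<Rightarrow> nat) \<Rightarrow> nat \<Rightarrow> triple \<Rightarrow> triple" where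
  "mu_block D r k = fold (\<lambda>l. mu D (k, l)) [1..<Suc (r k)]"

definition agree_on :: "(nat \<times> nat) set \<Rightarrow> triple \<Rightarrow> triple \<Rightarrow> bool" where
  "agree_on D = (\<lambda>(B, C, F) (B', C', F').
     \<forall>\<iota>\<in>D. F \<iota> = F' \<iota> \<and> (\<forall>\<nu>\<in>D. B \<iota> \<nu> = B' \<iota> \<nu> \<and> C \<iota> \<nu> = C' \<iota> \<nu>))"

definition composite_pattern ::
  "nat \<Rightarrow> (nat \<Rightarrow> nat) \<Rightarrow> 'v set \<Rightarrow> (nat \<Rightarrow> 'v \<Rightarrow> 'v \<Rightarrow> bool) \<Rightarrow> 'v \<Rightarrow> (nat \<Rightarrow> nat \<Rightarrow> int)
     \<Rightarrow> ('v \<Rightarrow> nat \<times> nat \<Rightarrow> nat \<times> nat \<Rightarrow> int) \<Rightarrow> ('v \<Rightarrow> nat \<times> nat \<Rightarrow> nat \<times> nat \<Rightarrow> int)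
     \<Rightarrow> ('v \<Rightarrow> nat \<times> nat \<Rightarrow> pol) \<Rightarrow> bool" where
  "composite_pattern n r V adj t0 B0 B C F \<longleftrightarrow>
     (\<forall>t\<in>V. \<forall>\<iota>\<in>idx n r. indets (F t \<iota>) \<subseteq> Yt ` idx n r)
   \<and> agree_on (idx n r) (B t0, C t0, \<lambda>\<iota>. to_fract (F t0 \<iota>))
       (\<lambda>\<iota> \<nu>. B0 (fst \<iota>) (fst \<nu>), \<lambda>\<iota> \<nu>. if \<iota> = \<nu> then 1 else 0, \<lambda>\<iota>. 1)
   \<and> (\<forall>k t t'. adj k t t' \<longrightarrow>
        agree_on (idx n r) (B t', C t', \<lambda>\<iota>. to_fract (F t' \<iota>))
          (mu_block (idx n r) r k (B t, C t, \<lambda>\<iota>. to_fract (F t \<iota>))))"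

section \<open>Substitutions\<close>

definition sy :: "nat \<times> nat \<Rightarrow> pol" where
  "sy = (\<lambda>(j, m). Var (S (j, m)) * Var (Y j))"

definition permute_tuple ::
  "(nat \<times> nat \<Rightarrow> pol) \<Rightarrow> (nat \<times> nat \<Rightarrow> nat \<times> nat) \<Rightarrow> nat \<times> nat \<Rightarrow> pol" where
  "permute_tuple w \<sigma> = (\<lambda>\<iota>. w (\<sigma> \<iota>))"

definition eval_Yt :: "pol \<Rightarrow> (nat \<times> nat \<Rightarrow> pol) \<Rightarrow> pol" where
  "eval_Yt p w = subst (\<lambda>x. case x of Yt \<iota> \<Rightarrow> w \<iota> | _ \<Rightarrow> Var x) p"

definition elem_sym :: "(nat \<Rightarrow> nat) \<Rightarrow> nat \<times> nat \<Rightarrow> pol" where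
  "elem_sym r = (\<lambda>(j, m). \<Sum>A | A \<subseteq> {1..r j} \<and> card A = m. \<Prod>l\<in>A. Var (S (j, l)))"

definition expand_e :: "(nat \<Rightarrow> nat) \<Rightarrow> pol \<Rightarrow> pol" where
  "expand_e r = subst (\<lambda>x. case x of E \<iota> \<Rightarrow> elem_sym r \<iota> | _ \<Rightarrow> Var x)"

text \<open>The unique polynomial in \<open>\<^bold>y\<close> and \<open>\<^bold>e\<close> representing a polynomial in \<open>\<^bold>y\<close> and \<open>\<^bold>s\<close>
  that is symmetric in each block of the variables \<open>\<^bold>s\<close>.\<close>

definition in_e :: "nat \<Rightarrow> (nat \<Rightarrow> nat) \<Rightarrow> pol \<Rightarrow> pol" where
  "in_e n r P = (THE Q. indets Q \<subseteq> Y ` {1..n} \<union> E ` idx n r \<and> expand_e r Q = P)"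

definition at_e_eq_z :: "nat \<Rightarrow> (nat \<Rightarrow> nat) \<Rightarrow> pol \<Rightarrow> pol" where
  "at_e_eq_z n r P = subst (\<lambda>x. case x of
       E (j, m) \<Rightarrow> if m = r j then 1 else Var (Z (j, m))
     | _ \<Rightarrow> Var x) (in_e n r P)"

end

theory Submission
  imports Defs
begin

text \<open>Mutating the composite pattern in all directions of one block multiplies up to a generalized
  mutation: the \<open>r\<close> binomial factors combine to \<open>\<Prod>\<^sub>q (1 + s\<^sub>q u) = \<Sum>\<^sub>m e\<^sub>m u\<^sup>m\<close>.  The composite
  \<open>C\<close>-matrix is invariant under permutations within blocks, so it consists of constant blocks
  \<open>\<alpha>\<^sub>i\<^sub>j\<close> plus \<open>e\<^sub>i = \<plusminus>1\<close> times the identity, which makes the exchange monomials symmetric up to one factor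
  \<open>s\<^sub>q\<close>.  Hence the block products of the \<open>F\<close>-polynomials satisfy, up to powers of \<open>e\<^sub>r\<close>, a
  recursion with coefficients in the ring of symmetric polynomials.  Elementary symmetric polynomials
  are algebraically independent generators of that ring, so the recursion can be specialized at
  \<open>e = z\<close>, \<open>e\<^sub>r = 1\<close>, where it becomes the recursion of the generalized \<open>F\<close>-polynomials.  Division by
  specialized polynomials is legitimate because they are positive when all \<open>y\<close> and \<open>s\<close> are \<open>1\<close>.\<close>

section \<open>Substitution homomorphisms\<close>

text \<open>The sign e_i is the parity of the mutations made in direction i since the initial
  vertex. It also records whether the polynomial of i on the generalized side is currently the
  initial one or its reciprocal, so the same sign decides which exchange monomial receives s_q and
  in which order the coefficients are read. Summing a composite column over a block of rows gives
  r_i \<alpha>_ij + e_j \<delta>_ij, which is the generalized \<open>C\<close>-entry. The powers of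
  e_r come from truncation in positive parts: sometimes both exchange monomials must first be
  multiplied by the same s_q. Since \<open>in_e\<close> is a definite description, a specialized
  value is accessible only once an expression in y and e is known to exist and to be unique.
  Existence needs symmetry in s. It is carried along the pattern as equivariance: permuting the
  indices of a block permutes the variables. Equivariance also yields the second equality factor by
  factor, before any specialization. Positivity survives specialization because s = 1 gives e_r = 1,
  so that the test point is compatible with e = z.\<close>

definition subst_monom :: "(fvar \<Rightarrow> pol) \<Rightarrow> (fvar \<Rightarrow>\<^sub>0 nat) \<Rightarrow> pol" where
  "subst_monom f m = (\<Prod>x\<in>Poly_Mapping.keys m. f x ^ Poly_Mapping.lookup m x)"

lemma subst_monom_superset:
  assumes "finite A" "Poly_Mapping.keys m \<subseteq> A"
  shows "subst_monom f m = (\<Prod>x\<in>A. f x ^ Poly_Mapping.lookup m x)"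
  unfolding subst_monom_def using assms
  by (intro prod.mono_neutral_left) (auto simp: in_keys_iff)

lemma subst_monom_0 [simp]: "subst_monom f 0 = 1"
  by (simp add: subst_monom_def)

lemma subst_monom_add: "subst_monom f (m + m') = subst_monom f m * subst_monom f m'"
proof -
  let ?A = "Poly_Mapping.keys m \<union> Poly_Mapping.keys m'"
  have "subst_monom f (m + m') = (\<Prod>x\<in>?A. f x ^ Poly_Mapping.lookup (m + m') x)"
    using keys_add[of m m'] by (intro subst_monom_superset) auto
  also have "\<dots> = subst_monom f m * subst_monom f m'"
    by (simp add: subst_monom_superset[of ?A] lookup_add power_add prod.distrib)
  finally show ?thesis .
qed

lemma subst_alt: "subst f p = (\<Sum>m\<in>Poly_Mapping.keys p. of_int (Poly_Mapping.lookup p m) * subst_monom f m)"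
  by (simp add: subst_def subst_monom_def)

lemma subst_superset:
  assumes "finite A" "Poly_Mapping.keys p \<subseteq> A"
  shows "subst f p = (\<Sum>m\<in>A. of_int (Poly_Mapping.lookup p m) * subst_monom f m)"
  unfolding subst_alt using assms
  by (intro sum.mono_neutral_left) (auto simp: in_keys_iff)

lemma subst_0 [simp]: "subst f 0 = 0"
  by (simp add: subst_def)

lemma subst_1 [simp]: "subst f 1 = 1"
  by (simp add: subst_def)

lemma subst_add [simp]: "subst f (p + q) = subst f p + subst f q"
proof -
  let ?A = "Poly_Mapping.keys p \<union> Poly_Mapping.keys q"
  have "subst f (p + q) = (\<Sum>m\<in>?A. of_int (Poly_Mapping.lookup (p + q) m) * subst_monom f m)"
    using keys_add[of p q] by (intro subst_superset) auto
  also have "\<dots> = subst f p + subst f q"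
    by (simp add: subst_superset[of ?A] lookup_add distrib_right sum.distrib)
  finally show ?thesis .
qed

lemma subst_uminus [simp]: "subst f (- p) = - subst f p"
  using subst_add[of f p "- p"] by (simp add: eq_neg_iff_add_eq_0 add.commute)

lemma subst_diff [simp]: "subst f (p - q) = subst f p - subst f q"
  using subst_add[of f p "- q"] by simp

lemma subst_single [simp]: "subst f (Poly_Mapping.single m c) = of_int c * subst_monom f m"
  by (simp add: subst_alt)

lemma subst_monom_single: "subst_monom f (Poly_Mapping.single x k) = f x ^ k"
  by (simp add: subst_monom_def)

lemma subst_Var [simp]: "subst f (Var x) = f x"
  by (simp add: Var_def subst_monom_single)

lemma pol_decompose: "(p :: pol) = (\<Sum>m\<in>Poly_Mapping.keys p. Poly_Mapping.single m (Poly_Mapping.lookup p m))"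
  by (rule poly_mapping_eqI) (auto simp: lookup_sum lookup_single when_def in_keys_iff)

lemma subst_sum [simp]: "subst f (\<Sum>x\<in>A. g x) = (\<Sum>x\<in>A. subst f (g x))"
  by (induction A rule: infinite_finite_induct) auto

lemma subst_mult [simp]: "subst f (p * q) = subst f p * subst f q"
proof -
  have "subst f (p * q) = subst f ((\<Sum>m\<in>Poly_Mapping.keys p. Poly_Mapping.single m (Poly_Mapping.lookup p m))
      * (\<Sum>m\<in>Poly_Mapping.keys q. Poly_Mapping.single m (Poly_Mapping.lookup q m)))"
    using pol_decompose[of p] pol_decompose[of q] by simp
  also have "\<dots> = subst f p * subst f q"
    by (simp add: sum_product mult_single subst_monom_add subst_alt[of f p] subst_alt[of f q] mult_ac)
  finally show ?thesis .
qed

lemma subst_prod [simp]: "subst f (\<Prod>x\<in>A. g x) = (\<Prod>x\<in>A. subst f (g x))"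
  by (induction A rule: infinite_finite_induct) auto

lemma subst_power [simp]: "subst f (p ^ k) = subst f p ^ k"
  by (induction k) auto

lemma subst_of_nat [simp]: "subst f (of_nat k) = of_nat k"
  by (induction k) auto

lemma subst_of_int [simp]: "subst f (of_int k) = of_int k"
  by (cases k rule: int_cases2) auto

lemma subst_subst: "subst g (subst f p) = subst (\<lambda>x. subst g (f x)) p"
  unfolding subst_alt[of f] subst_alt[of "\<lambda>x. subst g (f x)"]
  by (simp add: subst_monom_def)

lemma subst_cong: "(\<And>x. x \<in> indets p \<Longrightarrow> f x = g x) \<Longrightarrow> subst f p = subst g p"
  unfolding subst_def indets_def by (intro sum.cong refl arg_cong2[where f = times] arg_cong2[where f = power] prod.cong) blast

lemma subst_monom_Var:
  "subst_monom (\<lambda>x. Var (g x)) m =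
     Poly_Mapping.single (\<Sum>x\<in>Poly_Mapping.keys m. Poly_Mapping.single (g x) (Poly_Mapping.lookup m x)) 1"
proof -
  have *: "Var x ^ k = Poly_Mapping.single (Poly_Mapping.single x k) 1" for x k
    by (induction k) (simp_all add: Var_def mult_single flip: single_add)
  have "(\<Prod>x\<in>A. Var (g x) ^ Poly_Mapping.lookup m x) =
      Poly_Mapping.single (\<Sum>x\<in>A. Poly_Mapping.single (g x) (Poly_Mapping.lookup m x)) 1"
    if "finite A" for A
    using that by (induction A rule: finite_induct) (simp_all add: * mult_single)
  thus ?thesis by (simp add: subst_monom_def)
qed

text \<open>The value at the all-ones point is formally an element of \<open>pol\<close>; being an
  integer constant, it has the sign that \<open>pos_at_1\<close> speaks of.\<close>

lemma subst_one_eq_of_int: "\<exists>k. subst (\<lambda>_. 1) p = of_int k"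
proof -
  have "subst (\<lambda>_. 1) p = of_int (\<Sum>m\<in>Poly_Mapping.keys p. Poly_Mapping.lookup p m)"
    by (simp add: subst_def)
  thus ?thesis by blast
qed

section \<open>Indeterminates\<close>

lemma indets_Var [simp]: "indets (Var x) = {x}"
  by (simp add: indets_def Var_def)

lemma indets_0 [simp]: "indets 0 = {}"
  by (simp add: indets_def)

lemma indets_1 [simp]: "indets 1 = {}"
  by (simp add: indets_def)

lemma indets_of_int [simp]: "indets (of_int k) = {}"
  by (auto simp: indets_def simp flip: single_of_int)

lemma indets_add: "indets p \<subseteq> A \<Longrightarrow> indets q \<subseteq> A \<Longrightarrow> indets (p + q) \<subseteq> A"
  using keys_add[of p q] unfolding indets_def by blast

lemma indets_mult:
  assumes "indets p \<subseteq> A" "indets q \<subseteq> A"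
  shows "indets (p * q) \<subseteq> A"
proof
  fix x assume "x \<in> indets (p * q)"
  then obtain m where m: "m \<in> Poly_Mapping.keys (p * q)" "x \<in> Poly_Mapping.keys m"
    by (auto simp: indets_def)
  then obtain a b where "m = a + b" "a \<in> Poly_Mapping.keys p" "b \<in> Poly_Mapping.keys q"
    using keys_mult[of p q] by auto
  with m(2) keys_add[of a b] assms show "x \<in> A" unfolding indets_def by blast
qed

lemma indets_sum: "(\<And>x. x \<in> I \<Longrightarrow> indets (f x) \<subseteq> A) \<Longrightarrow> indets (sum f I) \<subseteq> A"
  by (induction I rule: infinite_finite_induct) (simp_all add: indets_add)

lemma indets_prod: "(\<And>x. x \<in> I \<Longrightarrow> indets (f x) \<subseteq> A) \<Longrightarrow> indets (prod f I) \<subseteq> A"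
  by (induction I rule: infinite_finite_induct) (simp_all add: indets_mult)

lemma indets_power: "indets p \<subseteq> A \<Longrightarrow> indets (p ^ k) \<subseteq> A"
  by (induction k) (simp_all add: indets_mult)

lemma indets_subst: "(\<And>x. x \<in> indets p \<Longrightarrow> indets (f x) \<subseteq> A) \<Longrightarrow> indets (subst f p) \<subseteq> A"
  unfolding subst_def
  by (intro indets_sum indets_mult indets_prod indets_power) (auto simp: indets_def[of p])

section \<open>Leading monomials\<close>

text \<open>The degree bound confines the elimination of symmetric polynomials to finitely many
  monomials, which makes it terminate.\<close>

definition tdeg :: "(fvar \<Rightarrow>\<^sub>0 nat) \<Rightarrow> nat" where
  "tdeg m = (\<Sum>x\<in>Poly_Mapping.keys m. Poly_Mapping.lookup m x)"

lemma tdeg_superset: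
  assumes "finite A" "Poly_Mapping.keys m \<subseteq> A"
  shows "tdeg m = (\<Sum>x\<in>A. Poly_Mapping.lookup m x)"
  unfolding tdeg_def using assms
  by (intro sum.mono_neutral_left) (auto simp: in_keys_iff)

lemma tdeg_add: "tdeg (m + m') = tdeg m + tdeg m'"
proof -
  let ?A = "Poly_Mapping.keys m \<union> Poly_Mapping.keys m'"
  show ?thesis
    using keys_add[of m m'] by (simp add: tdeg_superset[of ?A] lookup_add sum.distrib)
qed

lemma lookup_le_tdeg: "Poly_Mapping.lookup m x \<le> tdeg m"
proof (cases "x \<in> Poly_Mapping.keys m")
  case True
  thus ?thesis unfolding tdeg_def by (intro member_le_sum) auto
qed (simp add: in_keys_iff)

text \<open>The order is lexicographic with the smallest variable weighing most. The leading
  monomial of e_m is therefore the product of the m smallest variables of the block.\<close>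

lemma less_monom_iff:
  fixes m m' :: "fvar \<Rightarrow>\<^sub>0 nat"
  shows "m < m' \<longleftrightarrow> (\<exists>x. Poly_Mapping.lookup m x < Poly_Mapping.lookup m' x \<and>
           (\<forall>y<x. Poly_Mapping.lookup m y = Poly_Mapping.lookup m' y))"
  by transfer (simp add: less_fun_def)

lemma finite_monoms_bounded:
  assumes "finite A"
  shows "finite {m. Poly_Mapping.keys m \<subseteq> A \<and> tdeg m \<le> d}"
proof (rule inj_on_finite)
  show "inj_on (\<lambda>m. restrict (Poly_Mapping.lookup m) A) {m. Poly_Mapping.keys m \<subseteq> A \<and> tdeg m \<le> d}"
  proof (rule inj_onI, rule poly_mapping_eqI)
    fix m m' x
    assume *: "m \<in> {m. Poly_Mapping.keys m \<subseteq> A \<and> tdeg m \<le> d}" "m' \<in> {m. Poly_Mapping.keys m \<subseteq> A \<and> tdeg m \<le> d}"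
      "restrict (Poly_Mapping.lookup m) A = restrict (Poly_Mapping.lookup m') A"
    show "Poly_Mapping.lookup m x = Poly_Mapping.lookup m' x"
    proof (cases "x \<in> A")
      case True
      with fun_cong[OF *(3), of x] show ?thesis by simp
    next
      case False
      with *(1,2) have "x \<notin> Poly_Mapping.keys m" "x \<notin> Poly_Mapping.keys m'" by auto
      thus ?thesis by (simp add: in_keys_iff)
    qed
  qed
  show "(\<lambda>m. restrict (Poly_Mapping.lookup m) A) ` {m. Poly_Mapping.keys m \<subseteq> A \<and> tdeg m \<le> d} \<subseteq> PiE A (\<lambda>_. {..d})"
  proof (intro image_subsetI restrict_PiE_iff[THEN iffD2] ballI)
    fix m x assume "m \<in> {m. Poly_Mapping.keys m \<subseteq> A \<and> tdeg m \<le> d}"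
    thus "Poly_Mapping.lookup m x \<in> {..d}" using lookup_le_tdeg[of m x] by simp
  qed
  show "finite (PiE A (\<lambda>_. {..d}))"
    using assms by (intro finite_PiE) auto
qed

text \<open>Coefficient 1 permits elimination over the integers. Homogeneity ensures that
  subtracting a multiple never raises the degree.\<close>

definition monic_at :: "pol \<Rightarrow> (fvar \<Rightarrow>\<^sub>0 nat) \<Rightarrow> bool" where
  "monic_at p \<mu> \<longleftrightarrow> Poly_Mapping.lookup p \<mu> = 1 \<and> (\<forall>m\<in>Poly_Mapping.keys p. m \<le> \<mu> \<and> tdeg m = tdeg \<mu>)"

lemma lookup_mult_keys:
  "Poly_Mapping.lookup (p * q) k = (\<Sum>i\<in>Poly_Mapping.keys p. \<Sum>j\<in>Poly_Mapping.keys q.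
     if i + j = k then Poly_Mapping.lookup p i * Poly_Mapping.lookup (q::pol) j else 0)"
proof -
  have "p * q = (\<Sum>m\<in>Poly_Mapping.keys p. Poly_Mapping.single m (Poly_Mapping.lookup p m))
      * (\<Sum>m\<in>Poly_Mapping.keys q. Poly_Mapping.single m (Poly_Mapping.lookup q m))"
    using pol_decompose[of p] pol_decompose[of q] by simp
  thus ?thesis
    by (simp add: sum_product mult_single lookup_sum lookup_single when_def)
qed

lemma monic_at_1 [simp]: "monic_at 1 0"
  by (simp add: monic_at_def lookup_one)

text \<open>Addition of monomials is strictly monotone, so i + j reaches \<mu> + \<nu> under i \<le>
  \<mu> and j \<le> \<nu> only at the top of both factors: the product of the leading terms cannot
  cancel.\<close>

lemma monic_at_mult:
  assumes "monic_at p \<mu>" "monic_at q \<nu>"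
  shows "monic_at (p * q) (\<mu> + \<nu>)"
proof -
  have "(if i + j = \<mu> + \<nu> then Poly_Mapping.lookup p i * Poly_Mapping.lookup q j else 0) =
      (if i = \<mu> then if j = \<nu> then 1 else 0 else 0)"
    if "i \<in> Poly_Mapping.keys p" "j \<in> Poly_Mapping.keys q" for i j
  proof -
    have "i \<le> \<mu>" "j \<le> \<nu>" using that assms by (auto simp: monic_at_def)
    hence "i + j = \<mu> + \<nu> \<longleftrightarrow> i = \<mu> \<and> j = \<nu>"
      by (metis add_less_le_mono add_le_less_mono order.not_eq_order_implies_strict less_irrefl)
    thus ?thesis using assms by (simp add: monic_at_def)
  qed
  hence "Poly_Mapping.lookup (p * q) (\<mu> + \<nu>) =
      (\<Sum>i\<in>Poly_Mapping.keys p. \<Sum>j\<in>Poly_Mapping.keys q. if i = \<mu> then if j = \<nu> then 1 else 0 else 0)"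
    unfolding lookup_mult_keys by (intro sum.cong refl) auto
  also have "\<dots> = (\<Sum>i\<in>Poly_Mapping.keys p. if i = \<mu> then \<Sum>j\<in>Poly_Mapping.keys q. if j = \<nu> then 1 else 0 else 0)"
    by (intro sum.cong refl) auto
  also have "\<dots> = 1"
    using assms by (simp add: monic_at_def in_keys_iff)
  finally have "Poly_Mapping.lookup (p * q) (\<mu> + \<nu>) = 1" .
  moreover have "m \<le> \<mu> + \<nu> \<and> tdeg m = tdeg (\<mu> + \<nu>)" if m: "m \<in> Poly_Mapping.keys (p * q)" for m
  proof -
    obtain a b where "m = a + b" "a \<in> Poly_Mapping.keys p" "b \<in> Poly_Mapping.keys q"
      using subsetD[OF keys_mult[of p q] m] by blast
    thus ?thesis using assms by (auto simp: monic_at_def tdeg_add intro: add_mono)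
  qed
  ultimately show ?thesis by (simp add: monic_at_def)
qed

lemma monic_at_power: "monic_at p \<mu> \<Longrightarrow> monic_at (p ^ k) (\<Sum>i<k. \<mu>)"
  by (induction k) (simp_all add: monic_at_mult add.commute lessThan_Suc del: sum_constant)

lemma monic_at_prod:
  "finite A \<Longrightarrow> (\<And>x. x \<in> A \<Longrightarrow> monic_at (f x) (\<mu> x)) \<Longrightarrow> monic_at (\<Prod>x\<in>A. f x) (\<Sum>x\<in>A. \<mu> x)"
  by (induction A rule: finite_induct) (auto intro: monic_at_mult)

section \<open>Elementary symmetric polynomials\<close>

definition svars :: "(nat \<Rightarrow> nat) \<Rightarrow> nat \<Rightarrow> fvar set" where
  "svars r j = S ` ({j} \<times> {1..r j})"

text \<open>The order on variables is arbitrary, so the variables of a block have to be sorted before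
  the leading monomials of symmetric polynomials can be described.\<close>

definition svar :: "(nat \<Rightarrow> nat) \<Rightarrow> nat \<Rightarrow> nat \<Rightarrow> fvar" where
  "svar r j p = sorted_list_of_set (svars r j) ! (p - 1)"

lemma finite_svars [simp]: "finite (svars r j)"
  by (simp add: svars_def)

lemma card_svars [simp]: "card (svars r j) = r j"
  by (simp add: svars_def card_image inj_on_def card_cartesian_product)

lemma svar_less:
  assumes "1 \<le> p" "p < q" "q \<le> r j"
  shows "svar r j p < svar r j q"
  unfolding svar_def using assms
  by (intro sorted_wrt_nth_less[OF strict_sorted_list_of_set]) auto

lemma svar_less_iff:
  assumes "p \<in> {1..r j}" "q \<in> {1..r j}"
  shows "svar r j p < svar r j q \<longleftrightarrow> p < q"
  using svar_less[of p q r j] svar_less[of q p r j] assms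
  by (cases p q rule: linorder_cases) (auto dest: less_asym)

lemma svar_eq_iff:
  assumes "p \<in> {1..r j}" "q \<in> {1..r j}"
  shows "svar r j p = svar r j q \<longleftrightarrow> p = q"
  using svar_less_iff[of p r j q] svar_less_iff[of q r j p] assms
  by (cases p q rule: linorder_cases) auto

lemma svar_image: "svar r j ` {1..r j} = svars r j"
proof (rule card_subset_eq)
  show "svar r j ` {1..r j} \<subseteq> svars r j"
  proof
    fix x assume "x \<in> svar r j ` {1..r j}"
    then obtain p where "p \<in> {1..r j}" "x = sorted_list_of_set (svars r j) ! (p - 1)"
      by (auto simp: svar_def)
    moreover have "p - 1 < length (sorted_list_of_set (svars r j))" using \<open>p \<in> {1..r j}\<close> by auto
    ultimately have "x \<in> set (sorted_list_of_set (svars r j))" by (metis nth_mem)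
    thus "x \<in> svars r j" by simp
  qed
  have "inj_on (svar r j) {1..r j}" by (auto intro!: inj_onI simp: svar_eq_iff)
  thus "card (svar r j ` {1..r j}) = card (svars r j)" by (simp add: card_image)
qed auto

lemma svars_cases:
  assumes "x \<in> svars r j"
  obtains p where "p \<in> {1..r j}" "x = svar r j p"
  using assms unfolding svar_image[symmetric] by blast

lemma svar_in_svars: "p \<in> {1..r j} \<Longrightarrow> svar r j p \<in> svars r j"
  unfolding svar_image[symmetric] by blast

definition ind_monom :: "fvar set \<Rightarrow> fvar \<Rightarrow>\<^sub>0 nat" where
  "ind_monom X = (\<Sum>x\<in>X. Poly_Mapping.single x 1)"

lemma lookup_ind_monom: "finite X \<Longrightarrow> Poly_Mapping.lookup (ind_monom X) x = (if x \<in> X then 1 else 0)"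
  by (simp add: ind_monom_def lookup_sum lookup_single when_def)

lemma keys_ind_monom: "finite X \<Longrightarrow> Poly_Mapping.keys (ind_monom X) = X"
  by (auto simp: in_keys_iff lookup_ind_monom split: if_splits)

lemma tdeg_ind_monom: "finite X \<Longrightarrow> tdeg (ind_monom X) = card X"
  by (simp add: tdeg_def keys_ind_monom lookup_ind_monom)

lemma prod_Var: "finite X \<Longrightarrow> (\<Prod>x\<in>X. Var x) = Poly_Mapping.single (ind_monom X) 1"
  by (induction X rule: finite_induct) (simp_all add: ind_monom_def Var_def mult_single)

lemma elem_sym_alt: "elem_sym r (j, m) = (\<Sum>X | X \<subseteq> svars r j \<and> card X = m. \<Prod>x\<in>X. Var x)"
proof -
  let ?f = "\<lambda>A. (\<lambda>l. S (j, l)) ` A"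
  have inj: "inj_on (\<lambda>l. S (j, l)) A" for A by (auto intro: inj_onI)
  have svars: "svars r j = ?f {1..r j}" by (auto simp: svars_def)
  have "(\<Sum>X | X \<subseteq> svars r j \<and> card X = m. \<Prod>x\<in>X. Var x) =
      (\<Sum>A | A \<subseteq> {1..r j} \<and> card A = m. \<Prod>x\<in>?f A. Var x)"
  proof (rule sum.reindex_cong[where l = ?f])
    show "inj_on ?f {A. A \<subseteq> {1..r j} \<and> card A = m}"
      by (rule inj_onI) (simp add: inj_image_eq_iff inj_def)
    show "{X. X \<subseteq> svars r j \<and> card X = m} = ?f ` {A. A \<subseteq> {1..r j} \<and> card A = m}"
      unfolding svars by (auto simp: subset_image_iff card_image[OF inj])
  qed auto
  also have "\<dots> = elem_sym r (j, m)"
    by (simp add: elem_sym_def prod.reindex[OF inj] o_def)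
  finally show ?thesis ..
qed

lemma monic_at_elem_sym:
  assumes "m \<le> r j"
  shows "monic_at (elem_sym r (j, m)) (ind_monom (svar r j ` {1..m}))"
proof -
  define X0 where "X0 = svar r j ` {1..m}"
  let ?F = "{X. X \<subseteq> svars r j \<and> card X = m}"
  have fin: "finite ?F" by (rule finite_subset[of _ "Pow (svars r j)"]) auto
  have finX: "finite X" if "X \<in> ?F" for X using that finite_subset[OF _ finite_svars] by blast
  have X0: "X0 \<in> ?F"
  proof -
    have "inj_on (svar r j) {1..m}" using assms by (auto intro!: inj_onI simp: svar_eq_iff)
    thus ?thesis using assms by (auto simp: X0_def card_image intro!: svar_in_svars)
  qed
  have es: "elem_sym r (j, m) = (\<Sum>X\<in>?F. Poly_Mapping.single (ind_monom X) 1)"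
    unfolding elem_sym_alt by (intro sum.cong refl prod_Var finX)
  have inj: "ind_monom X = ind_monom X0 \<longleftrightarrow> X = X0" if "X \<in> ?F" for X
    using keys_ind_monom[OF finX[OF that]] keys_ind_monom[OF finX[OF X0]] by metis
  have single: "Poly_Mapping.lookup (Poly_Mapping.single (ind_monom X) (1::int)) (ind_monom X0) = (if X = X0 then 1 else 0)"
    if "X \<in> ?F" for X
    using inj[OF that] by (cases "X = X0") (simp_all add: lookup_single_not_eq)
  have "Poly_Mapping.lookup (elem_sym r (j, m)) (ind_monom X0) = (\<Sum>X\<in>?F. if X = X0 then 1 else 0)"
    unfolding es lookup_sum by (intro sum.cong refl single)
  also have "\<dots> = 1" using X0 fin by simp
  finally have "Poly_Mapping.lookup (elem_sym r (j, m)) (ind_monom X0) = 1" .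
  moreover have "u \<le> ind_monom X0 \<and> tdeg u = tdeg (ind_monom X0)"
    if "u \<in> Poly_Mapping.keys (elem_sym r (j, m))" for u
  proof -
    have "Poly_Mapping.lookup (elem_sym r (j, m)) u \<noteq> 0" using that by (simp add: in_keys_iff)
    hence "\<exists>X\<in>?F. Poly_Mapping.lookup (Poly_Mapping.single (ind_monom X) (1::int)) u \<noteq> 0"
      unfolding es lookup_sum by (rule sum.not_neutral_contains_not_neutral) blast
    then obtain X where X: "X \<in> ?F" "u = ind_monom X"
      by (auto simp: lookup_single when_def split: if_splits)
    have "ind_monom X < ind_monom X0" if "X \<noteq> X0"
    proof -
      have "X0 - X \<noteq> {}"
      proof
        assume "X0 - X = {}"
        hence "X0 \<subseteq> X" by auto
        with X(1) X0 finX[OF X(1)] have "X0 = X" by (intro card_subset_eq) simp_all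
        with that show False by simp
      qed
      moreover have finD: "finite (X0 - X)" using finX[OF X0] by simp
      ultimately have Min: "Min (X0 - X) \<in> X0 - X" by (rule Min_in[rotated])
      \<comment> \<open>The first place where the two monomials differ: \<open>X0\<close> is an
        initial segment of the block, so every element of X below x lies in \<open>X0\<close>, and
        by minimality every element of \<open>X0\<close> below x lies in X.\<close>
      define x where "x = Min (X0 - X)"
      have x: "x \<in> X0" "x \<notin> X" using Min by (auto simp: x_def)
      have "y \<in> X \<longleftrightarrow> y \<in> X0" if "y < x" for y
      proof
        assume "y \<in> X"
        hence "y \<in> svars r j" using X(1) by auto
        then obtain p where p: "p \<in> {1..r j}" "y = svar r j p" by (rule svars_cases)
        obtain q where q: "q \<in> {1..m}" "x = svar r j q" using x by (auto simp: X0_def)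
        have "p < q" using svar_less_iff[of p r j q] p q(1) assms \<open>y < x\<close>[unfolded p q] by simp
        thus "y \<in> X0" using p q(1) by (simp add: X0_def)
      next
        assume "y \<in> X0"
        show "y \<in> X"
        proof (rule ccontr)
          assume "y \<notin> X"
          hence "x \<le> y" unfolding x_def using \<open>y \<in> X0\<close> finD by (intro Min_le) auto
          with \<open>y < x\<close> show False by simp
        qed
      qed
      thus ?thesis unfolding less_monom_iff using x finX[OF X0] finX[OF X(1)]
        by (intro exI[of _ x]) (simp add: lookup_ind_monom)
    qed
    moreover have "tdeg u = tdeg (ind_monom X0)"
      using X(1) X0 by (simp add: X(2) tdeg_ind_monom finX[OF X(1)] finX[OF X0])
    ultimately show ?thesis unfolding X(2) by (cases "X = X0") (simp_all add: less_imp_le)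
  qed
  ultimately show ?thesis by (simp add: monic_at_def X0_def)
qed

section \<open>The fundamental theorem of symmetric polynomials\<close>


definition evars :: "nat \<Rightarrow> (nat \<Rightarrow> nat) \<Rightarrow> fvar set" where
  "evars n r = Y ` {1..n} \<union> E ` idx n r"

lemma idx_Sigma: "idx n r = Sigma {1..n} (\<lambda>i. {1..r i})"
  by (auto simp: idx_def)

lemma finite_idx [simp]: "finite (idx n r)"
  by (simp add: idx_Sigma)

lemma finite_evars [simp]: "finite (evars n r)"
  by (simp add: evars_def)

lemma sum_evars: "(\<Sum>x\<in>evars n r. f x) = (\<Sum>i=1..n. f (Y i)) + (\<Sum>j=1..n. \<Sum>q=1..r j. f (E (j, q)))"
proof -
  have "(\<Sum>x\<in>evars n r. f x) = (\<Sum>x\<in>Y ` {1..n}. f x) + (\<Sum>x\<in>E ` idx n r. f x)"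
    unfolding evars_def by (intro sum.union_disjoint) auto
  thus ?thesis by (simp add: sum.reindex inj_on_def idx_Sigma sum.Sigma split_def)
qed

text \<open>The leading monomial of \<open>e_map r x\<close>; \<open>lead_monom\<close> is its
  multiplicative extension to monomials in y and e.\<close>

definition lead :: "(nat \<Rightarrow> nat) \<Rightarrow> fvar \<Rightarrow> fvar \<Rightarrow>\<^sub>0 nat" where
  "lead r x = (case x of E (j, m) \<Rightarrow> ind_monom (svar r j ` {1..m}) | _ \<Rightarrow> Poly_Mapping.single x 1)"

definition lead_monom :: "(nat \<Rightarrow> nat) \<Rightarrow> (fvar \<Rightarrow>\<^sub>0 nat) \<Rightarrow> fvar \<Rightarrow>\<^sub>0 nat" where
  "lead_monom r m = (\<Sum>x\<in>Poly_Mapping.keys m. \<Sum>i<Poly_Mapping.lookup m x. lead r x)"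

definition e_map :: "(nat \<Rightarrow> nat) \<Rightarrow> fvar \<Rightarrow> pol" where
  "e_map r = (\<lambda>x. case x of E \<iota> \<Rightarrow> elem_sym r \<iota> | _ \<Rightarrow> Var x)"

lemma expand_e_alt: "expand_e r = subst (e_map r)"
  by (simp add: expand_e_def e_map_def)

lemma monic_at_Var: "monic_at (Var x) (Poly_Mapping.single x 1)"
  by (simp add: monic_at_def Var_def)

lemma monic_at_subst_monom:
  assumes "Poly_Mapping.keys m \<subseteq> evars n r"
  shows "monic_at (subst_monom (e_map r) m) (lead_monom r m)"
  unfolding subst_monom_def lead_monom_def
proof (intro monic_at_prod monic_at_power finite_keys)
  fix x assume "x \<in> Poly_Mapping.keys m"
  with assms have "x \<in> evars n r" by auto
  thus "monic_at (e_map r x) (lead r x)"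
    by (auto simp: evars_def e_map_def lead_def idx_def monic_at_Var[unfolded One_nat_def]
        monic_at_elem_sym[unfolded One_nat_def])
qed

lemma svar_neq_Y: "p \<in> {1..r j} \<Longrightarrow> svar r j p \<noteq> Y i"
  using svar_in_svars[of p r j] by (auto simp: svars_def)

lemma svar_block: "p \<in> {1..r j} \<Longrightarrow> q \<in> {1..r k} \<Longrightarrow> svar r j p = svar r k q \<Longrightarrow> j = k"
  using svar_in_svars[of p r j] svar_in_svars[of q r k] by (auto simp: svars_def)

lemma lookup_lead_monom:
  assumes "Poly_Mapping.keys m \<subseteq> evars n r"
  shows "Poly_Mapping.lookup (lead_monom r m) z =
    (\<Sum>i=1..n. if z = Y i then Poly_Mapping.lookup m (Y i) else 0) +
    (\<Sum>j=1..n. \<Sum>q=1..r j. if z \<in> svar r j ` {1..q} then Poly_Mapping.lookup m (E (j, q)) else 0)"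
proof -
  have "Poly_Mapping.lookup (lead_monom r m) z =
      (\<Sum>x\<in>Poly_Mapping.keys m. Poly_Mapping.lookup m x * Poly_Mapping.lookup (lead r x) z)"
    by (simp add: lead_monom_def lookup_sum del: sum_constant) simp
  also have "\<dots> = (\<Sum>x\<in>evars n r. Poly_Mapping.lookup m x * Poly_Mapping.lookup (lead r x) z)"
    using assms by (intro sum.mono_neutral_left) (auto simp: in_keys_iff)
  also have "\<dots> = (\<Sum>i=1..n. if z = Y i then Poly_Mapping.lookup m (Y i) else 0) +
    (\<Sum>j=1..n. \<Sum>q=1..r j. if z \<in> svar r j ` {1..q} then Poly_Mapping.lookup m (E (j, q)) else 0)"
    unfolding sum_evars
    by (intro arg_cong2[where f = plus] sum.cong refl)
       (auto simp: lead_def lookup_single when_def lookup_ind_monom)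
  finally show ?thesis .
qed

lemma lookup_lead_monom_Y:
  assumes "Poly_Mapping.keys m \<subseteq> evars n r" "i \<in> {1..n}"
  shows "Poly_Mapping.lookup (lead_monom r m) (Y i) = Poly_Mapping.lookup m (Y i)"
proof -
  have "Y i \<notin> svar r j ` {1..q}" if "q \<in> {1..r j}" for j q
  proof
    assume "Y i \<in> svar r j ` {1..q}"
    then obtain p where "p \<in> {1..q}" "Y i = svar r j p" by blast
    with that svar_neq_Y[of p r j i] show False by simp
  qed
  hence "(\<Sum>j=1..n. \<Sum>q=1..r j. if Y i \<in> svar r j ` {1..q} then Poly_Mapping.lookup m (E (j, q)) else 0) = 0"
    by (intro sum.neutral ballI if_not_P)
  thus ?thesis using assms by (simp add: lookup_lead_monom)
qed

text \<open>The p-th smallest variable occurs in the leading monomial of e_q exactly when q \<ge> p.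
  The exponents within a block are thus tail sums: weakly decreasing, and with the multiplicity of
  each e_q as a successive difference.\<close>

lemma lookup_lead_monom_svar:
  assumes m: "Poly_Mapping.keys m \<subseteq> evars n r" and j: "j \<in> {1..n}" and p: "p \<in> {1..r j}"
  shows "Poly_Mapping.lookup (lead_monom r m) (svar r j p) = (\<Sum>q=p..r j. Poly_Mapping.lookup m (E (j, q)))"
proof -
  have "(\<Sum>q=1..r j'. if svar r j p \<in> svar r j' ` {1..q} then Poly_Mapping.lookup m (E (j', q)) else 0) =
      (if j' = j then \<Sum>q=p..r j. Poly_Mapping.lookup m (E (j, q)) else 0)" for j'
  proof (cases "j' = j")
    case True
    have "(\<Sum>q=1..r j. if svar r j p \<in> svar r j ` {1..q} then Poly_Mapping.lookup m (E (j, q)) else 0) =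
       (\<Sum>q=1..r j. if p \<le> q then Poly_Mapping.lookup m (E (j, q)) else 0)"
    proof (intro sum.cong refl if_cong)
      fix q assume "q \<in> {1..r j}"
      thus "svar r j p \<in> svar r j ` {1..q} \<longleftrightarrow> p \<le> q"
        using p by (auto simp: svar_eq_iff)
    qed
    also have "\<dots> = (\<Sum>q=p..r j. Poly_Mapping.lookup m (E (j, q)))"
      using p by (intro sum.mono_neutral_cong_right) auto
    finally show ?thesis unfolding True by simp
  next
    case False
    have "(\<Sum>q=1..r j'. if svar r j p \<in> svar r j' ` {1..q} then Poly_Mapping.lookup m (E (j', q)) else 0) = 0"
    proof (intro sum.neutral ballI)
      fix q assume "q \<in> {1..r j'}"
      have "svar r j p \<noteq> svar r j' q'" if "q' \<in> {1..q}" for q'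
      proof
        assume "svar r j p = svar r j' q'"
        moreover have "q' \<in> {1..r j'}" using that \<open>q \<in> {1..r j'}\<close> by simp
        ultimately have "j = j'" using p by (intro svar_block)
        with False show False by simp
      qed
      hence "svar r j p \<notin> svar r j' ` {1..q}" by blast
      thus "(if svar r j p \<in> svar r j' ` {1..q} then Poly_Mapping.lookup m (E (j', q)) else 0) = 0" by simp
    qed
    with False show ?thesis by simp
  qed
  moreover have "(\<Sum>i=1..n. if svar r j p = Y i then Poly_Mapping.lookup m (Y i) else 0) = 0"
    using svar_neq_Y p by (intro sum.neutral ballI if_not_P)
  ultimately show ?thesis using j by (simp add: lookup_lead_monom[OF m])
qed

lemma lead_monom_inj:
  assumes m: "Poly_Mapping.keys m \<subseteq> evars n r" and m': "Poly_Mapping.keys m' \<subseteq> evars n r"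
    and eq: "lead_monom r m = lead_monom r m'"
  shows "m = m'"
proof (rule poly_mapping_eqI)
  fix x
  show "Poly_Mapping.lookup m x = Poly_Mapping.lookup m' x"
  proof (cases "x \<in> evars n r")
    case False
    with m m' have "x \<notin> Poly_Mapping.keys m" "x \<notin> Poly_Mapping.keys m'" by auto
    thus ?thesis by (simp add: in_keys_iff)
  next
    case True
    then consider i where "i \<in> {1..n}" "x = Y i" | j p where "j \<in> {1..n}" "p \<in> {1..r j}" "x = E (j, p)"
      by (auto simp: evars_def idx_def)
    thus ?thesis
    proof cases
      case 1
      thus ?thesis using lookup_lead_monom_Y[OF m] lookup_lead_monom_Y[OF m'] eq by metis
    next
      case 2
      \<comment> \<open>Beyond \<open>r j\<close> both tail sums are empty, so the difference of
        consecutive tail sums is available at the last index too.\<close>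
      have T: "(\<Sum>q=p..r j. Poly_Mapping.lookup m (E (j, q))) = (\<Sum>q=p..r j. Poly_Mapping.lookup m' (E (j, q)))"
        if "p \<ge> 1" for p
      proof (cases "p \<le> r j")
        case True
        with that show ?thesis
          using lookup_lead_monom_svar[OF m 2(1), of p] lookup_lead_monom_svar[OF m' 2(1), of p] eq by simp
      qed simp
      have "{p..r j} = insert p {Suc p..r j}" using 2 by auto
      with T[of p] T[of "Suc p"] 2 show ?thesis by simp
    qed
  qed
qed

lemma lookup_of_int_mult: "Poly_Mapping.lookup (of_int c * p) u = c * Poly_Mapping.lookup (p :: pol) u"
proof -
  have 1: "of_int c = Poly_Mapping.single (0::fvar \<Rightarrow>\<^sub>0 nat) c"
    using single_of_int[where k = c and 'a = "fvar \<Rightarrow>\<^sub>0 nat" and 'b = int] unfolding of_int_eq_id id_apply by (rule sym)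
  have "of_int c * p = Poly_Mapping.map ((*) c) p"
    unfolding mult_map_scale_conv_mult 1 by (rule refl)
  moreover have "Poly_Mapping.lookup (Poly_Mapping.map ((*) c) p) u = c * Poly_Mapping.lookup p u"
    by transfer (simp add: when_def)
  ultimately show ?thesis by (simp only:)
qed

text \<open>Distinct monomials in y and e have images with distinct leading monomials, so the
  largest of these survives in the sum.\<close>

lemma expand_e_eq_0:
  assumes Q: "indets Q \<subseteq> evars n r" and eq: "expand_e r Q = 0"
  shows "Q = 0"
proof (rule ccontr)
  assume "Q \<noteq> 0"
  hence ne: "lead_monom r ` Poly_Mapping.keys Q \<noteq> {}" by auto
  have keys: "Poly_Mapping.keys m \<subseteq> evars n r" if "m \<in> Poly_Mapping.keys Q" for m
    using that Q by (auto simp: indets_def)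
  define \<mu> where "\<mu> = Max (lead_monom r ` Poly_Mapping.keys Q)"
  have "\<mu> \<in> lead_monom r ` Poly_Mapping.keys Q" unfolding \<mu>_def using ne by (intro Max_in) auto
  then obtain m0 where m0: "m0 \<in> Poly_Mapping.keys Q" "\<mu> = lead_monom r m0" by auto
  have "Poly_Mapping.lookup (expand_e r Q) \<mu> =
      (\<Sum>m\<in>Poly_Mapping.keys Q. Poly_Mapping.lookup Q m * Poly_Mapping.lookup (subst_monom (e_map r) m) \<mu>)"
    by (simp add: expand_e_alt subst_alt lookup_sum lookup_of_int_mult)
  also have "\<dots> = (\<Sum>m\<in>Poly_Mapping.keys Q. if m = m0 then Poly_Mapping.lookup Q m0 else 0)"
  proof (intro sum.cong refl)
    fix m assume m: "m \<in> Poly_Mapping.keys Q"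
    note monic = monic_at_subst_monom[OF keys[OF m]]
    show "Poly_Mapping.lookup Q m * Poly_Mapping.lookup (subst_monom (e_map r) m) \<mu> =
        (if m = m0 then Poly_Mapping.lookup Q m0 else 0)"
    proof (cases "m = m0")
      case True
      thus ?thesis using monic m0 by (simp add: monic_at_def)
    next
      case False
      have "lead_monom r m \<le> \<mu>" unfolding \<mu>_def using m by (intro Max_ge) auto
      moreover have "lead_monom r m \<noteq> \<mu>"
        using False lead_monom_inj[OF keys[OF m] keys[OF m0(1)]] m0(2) by auto
      ultimately have "\<mu> \<notin> Poly_Mapping.keys (subst_monom (e_map r) m)"
        using monic by (auto simp: monic_at_def)
      with False show ?thesis by (simp add: in_keys_iff)
    qed
  qed
  also have "\<dots> = Poly_Mapping.lookup Q m0" using m0 by simp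
  finally have "Poly_Mapping.lookup (expand_e r Q) \<mu> = Poly_Mapping.lookup Q m0" .
  with eq m0 show False by (simp add: in_keys_iff)
qed

lemma expand_e_inj:
  assumes "indets Q \<subseteq> evars n r" "indets Q' \<subseteq> evars n r" "expand_e r Q = expand_e r Q'"
  shows "Q = Q'"
proof -
  have "indets (- Q') \<subseteq> evars n r"
    using assms(2) by (auto simp: indets_def in_keys_iff)
  hence "indets (Q + - Q') \<subseteq> evars n r"
    using assms(1) by (intro indets_add)
  with expand_e_eq_0[of "Q + - Q'" n r] assms(3) show ?thesis
    by (simp add: expand_e_alt)
qed

text \<open>Injectivity of \<open>expand_e\<close> discharges the definite description: any preimage
  that can be exhibited is the value.\<close>

lemma in_e_eqI:
  assumes "indets Q \<subseteq> evars n r" "expand_e r Q = P"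
  shows "in_e n r P = Q"
  unfolding in_e_def
proof (rule the_equality)
  show "indets Q \<subseteq> Y ` {1..n} \<union> E ` idx n r \<and> expand_e r Q = P"
    using assms by (simp add: evars_def)
  fix Q' assume "indets Q' \<subseteq> Y ` {1..n} \<union> E ` idx n r \<and> expand_e r Q' = P"
  thus "Q' = Q"
    using assms by (intro expand_e_inj[of Q' n r Q]) (simp_all add: evars_def)
qed

section \<open>Symmetric polynomials and their reduction by leading monomials\<close>

definition rename_S :: "(nat \<times> nat \<Rightarrow> nat \<times> nat) \<Rightarrow> fvar \<Rightarrow> fvar" where
  "rename_S \<sigma> x = (case x of S \<iota> \<Rightarrow> S (\<sigma> \<iota>) | _ \<Rightarrow> x)"

abbreviation (input) swap :: "nat \<Rightarrow> nat \<Rightarrow> nat \<Rightarrow> nat \<times> nat \<Rightarrow> nat \<times> nat" where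
  "swap j l m \<equiv> Transposition.transpose (j, l) (j, m)"

text \<open>Transpositions generate the permutations of a block, so testing them captures full
  symmetry.\<close>

definition block_symmetric :: "nat \<Rightarrow> (nat \<Rightarrow> nat) \<Rightarrow> pol \<Rightarrow> bool" where
  "block_symmetric n r P \<longleftrightarrow> (\<forall>j\<in>{1..n}. \<forall>l\<in>{1..r j}. \<forall>m\<in>{1..r j}.
     subst (\<lambda>x. Var (rename_S (swap j l m) x)) P = P)"

lemma rename_S_swap_swap [simp]: "rename_S (swap j l m) (rename_S (swap j l m) x) = x"
  by (cases x) (simp_all add: rename_S_def)

lemma inj_rename_S_swap: "inj (rename_S (swap j l m))"
  by (rule inj_on_inverseI[where g = "rename_S (swap j l m)"]) simp

lemma rename_S_swap_svars:
  assumes "l \<in> {1..r j}" "m \<in> {1..r j}"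
  shows "rename_S (swap j l m) ` svars r k = svars r k"
proof
  show sub: "rename_S (swap j l m) ` svars r k \<subseteq> svars r k"
    using assms by (auto simp: rename_S_def svars_def Transposition.transpose_def)
  show "svars r k \<subseteq> rename_S (swap j l m) ` svars r k"
  proof
    fix x assume "x \<in> svars r k"
    with sub have "rename_S (swap j l m) x \<in> svars r k" by auto
    thus "x \<in> rename_S (swap j l m) ` svars r k"
      by (intro image_eqI[of _ _ "rename_S (swap j l m) x"]) simp_all
  qed
qed

lemma subst_rename_elem_sym:
  assumes "l \<in> {1..r j}" "m \<in> {1..r j}"
  shows "subst (\<lambda>x. Var (rename_S (swap j l m) x)) (elem_sym r \<iota>) = elem_sym r \<iota>"
proof -
  obtain k q where \<iota>: "\<iota> = (k, q)" by (cases \<iota>)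
  define g where "g = rename_S (swap j l m)"
  have inj: "inj_on g X" for X unfolding g_def by (rule inj_on_subset[OF inj_rename_S_swap]) simp
  have img: "g ` svars r k = svars r k" unfolding g_def using assms by (rule rename_S_swap_svars[of l r j m k])
  have "elem_sym r \<iota> = (\<Sum>X | X \<subseteq> svars r k \<and> card X = q. \<Prod>x\<in>g ` X. Var x)"
    unfolding \<iota> elem_sym_alt
  proof (rule sum.reindex_cong[where l = "image g"])
    show "inj_on (image g) {X. X \<subseteq> svars r k \<and> card X = q}"
      using inj_rename_S_swap[of j l m] by (intro inj_onI) (simp add: g_def inj_image_eq_iff)
    have "{X. X \<subseteq> g ` svars r k \<and> card X = q} = image g ` {X. X \<subseteq> svars r k \<and> card X = q}"
      by (auto simp: subset_image_iff card_image[OF inj])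
    thus "{X. X \<subseteq> svars r k \<and> card X = q} = image g ` {X. X \<subseteq> svars r k \<and> card X = q}"
      by (simp add: img)
  qed auto
  also have "\<dots> = (\<Sum>X | X \<subseteq> svars r k \<and> card X = q. \<Prod>x\<in>X. Var (g x))"
    by (simp add: prod.reindex[OF inj])
  also have "\<dots> = subst (\<lambda>x. Var (g x)) (elem_sym r \<iota>)"
    unfolding \<iota> elem_sym_alt by simp
  finally show ?thesis unfolding g_def ..
qed

lemma block_symmetric_expand_e:
  assumes "indets Q \<subseteq> evars n r"
  shows "block_symmetric n r (expand_e r Q)"
  unfolding block_symmetric_def
proof (intro ballI)
  fix j l m assume "l \<in> {1..r j}" "m \<in> {1..r j}"
  hence sym: "subst (\<lambda>x. Var (rename_S (swap j l m) x)) (elem_sym r \<iota>) = elem_sym r \<iota>" for \<iota>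
    by (rule subst_rename_elem_sym[of l r j m])
  show "subst (\<lambda>x. Var (rename_S (swap j l m) x)) (expand_e r Q) = expand_e r Q"
    unfolding expand_e_alt subst_subst
  proof (rule subst_cong)
    fix x assume "x \<in> indets Q"
    hence "x \<in> evars n r" using assms by auto
    thus "subst (\<lambda>x. Var (rename_S (swap j l m) x)) (e_map r x) = e_map r x"
      by (auto simp: evars_def e_map_def sym) (simp add: rename_S_def)
  qed
qed

lemma block_symmetric_diff:
  "block_symmetric n r P \<Longrightarrow> block_symmetric n r Q \<Longrightarrow> block_symmetric n r (P - Q)"
  by (simp add: block_symmetric_def)

lemma indets_elem_sym: "j \<in> {1..n} \<Longrightarrow> indets (elem_sym r (j, m)) \<subseteq> S ` idx n r"
  unfolding elem_sym_alt by (intro indets_sum indets_prod) (auto simp: svars_def idx_def)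

lemma indets_e_map: "x \<in> evars n r \<Longrightarrow> indets (e_map r x) \<subseteq> Y ` {1..n} \<union> S ` idx n r"
proof -
  assume "x \<in> evars n r"
  then consider i where "i \<in> {1..n}" "x = Y i" | j m where "j \<in> {1..n}" "x = E (j, m)"
    by (auto simp: evars_def idx_def)
  thus ?thesis
  proof cases
    case 2
    thus ?thesis using indets_elem_sym[of j n r m] by (auto simp: e_map_def)
  qed (simp add: e_map_def)
qed

lemma keys_sum_single: "Poly_Mapping.keys (\<Sum>x\<in>A. Poly_Mapping.single (f x) (g x :: nat)) \<subseteq> f ` A"
proof (induction A rule: infinite_finite_induct)
  case (insert x A)
  thus ?case using keys_add[of "Poly_Mapping.single (f x) (g x)" "\<Sum>x\<in>A. Poly_Mapping.single (f x) (g x)"]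
    by (auto split: if_splits)
qed auto

text \<open>An involutive renaming acts on exponent functions by precomposition with
  \<open>g\<close>. This is injective, so no two terms merge and coefficients are merely
  relocated.\<close>

lemma lookup_subst_rename:
  assumes "\<And>x. g (g x) = x"
  shows "\<exists>\<mu>'. (\<forall>x. Poly_Mapping.lookup \<mu>' x = Poly_Mapping.lookup \<mu> (g x)) \<and>
    Poly_Mapping.lookup (subst (\<lambda>x. Var (g x)) P) \<mu>' = Poly_Mapping.lookup P \<mu>"
proof -
  define G where "G m = (\<Sum>x\<in>Poly_Mapping.keys m. Poly_Mapping.single (g x) (Poly_Mapping.lookup m x))"
    for m :: "fvar \<Rightarrow>\<^sub>0 nat"
  have G: "Poly_Mapping.lookup (G m) z = Poly_Mapping.lookup m (g z)" for m z
  proof -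
    have "g x = z \<longleftrightarrow> x = g z" for x using assms by metis
    hence "Poly_Mapping.lookup (G m) z = (\<Sum>x\<in>Poly_Mapping.keys m. if x = g z then Poly_Mapping.lookup m x else 0)"
      unfolding G_def lookup_sum by (intro sum.cong refl) (simp add: lookup_single when_def)
    thus ?thesis by (simp add: in_keys_iff)
  qed
  have inj: "G m = G \<mu> \<longleftrightarrow> m = \<mu>" for m
  proof
    assume eq: "G m = G \<mu>"
    show "m = \<mu>"
      by (rule poly_mapping_eqI) (metis G eq assms)
  qed simp
  hence inj': "G \<mu> = G m \<longleftrightarrow> m = \<mu>" for m by metis
  have "Poly_Mapping.lookup (subst (\<lambda>x. Var (g x)) P) (G \<mu>) =
      (\<Sum>m\<in>Poly_Mapping.keys P. if m = \<mu> then Poly_Mapping.lookup P m else 0)"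
    unfolding subst_alt subst_monom_Var lookup_sum G_def[symmetric]
    by (intro sum.cong refl) (simp add: lookup_of_int_mult lookup_single when_def inj inj')
  also have "\<dots> = Poly_Mapping.lookup P \<mu>"
    by (simp add: in_keys_iff)
  finally show ?thesis using G by blast
qed

text \<open>Otherwise swapping two variables would produce a larger monomial.\<close>

lemma lead_antimono:
  assumes sym: "block_symmetric n r P" and \<mu>: "\<mu> \<in> Poly_Mapping.keys P" "\<And>m. m \<in> Poly_Mapping.keys P \<Longrightarrow> m \<le> \<mu>"
    and j: "j \<in> {1..n}" and p: "1 \<le> p" "p < q" "q \<le> r j"
  shows "Poly_Mapping.lookup \<mu> (svar r j q) \<le> Poly_Mapping.lookup \<mu> (svar r j p)"
proof (rule ccontr)
  assume less: "\<not> ?thesis"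
  have "svar r j p \<in> svars r j" "svar r j q \<in> svars r j"
    using p by (auto intro!: svar_in_svars)
  then obtain l m where lm: "svar r j p = S (j, l)" "svar r j q = S (j, m)" "l \<in> {1..r j}" "m \<in> {1..r j}"
    by (auto simp: svars_def)
  define g where "g = rename_S (swap j l m)"
  obtain \<mu>' where \<mu>': "\<And>x. Poly_Mapping.lookup \<mu>' x = Poly_Mapping.lookup \<mu> (g x)"
    "Poly_Mapping.lookup (subst (\<lambda>x. Var (g x)) P) \<mu>' = Poly_Mapping.lookup P \<mu>"
    using lookup_subst_rename[of g \<mu> P] by (auto simp: g_def)
  have "subst (\<lambda>x. Var (g x)) P = P"
    using sym j lm by (simp add: block_symmetric_def g_def)
  with \<mu>'(2) \<mu>(1) have "\<mu>' \<in> Poly_Mapping.keys P" by (simp add: in_keys_iff)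
  hence "\<mu>' \<le> \<mu>" by (rule \<mu>(2))
  moreover have "\<mu> < \<mu>'"
    unfolding less_monom_iff
  proof (intro exI[of _ "svar r j p"] conjI allI impI)
    show "Poly_Mapping.lookup \<mu> (svar r j p) < Poly_Mapping.lookup \<mu>' (svar r j p)"
      using less by (simp add: \<mu>' lm g_def rename_S_def)
    fix y assume y: "y < svar r j p"
    hence "y \<noteq> S (j, l)" "y \<noteq> S (j, m)"
      using svar_less[of p q r j] p by (auto simp: lm)
    hence "g y = y" by (cases y) (auto simp: g_def rename_S_def Transposition.transpose_def)
    thus "Poly_Mapping.lookup \<mu> y = Poly_Mapping.lookup \<mu>' y" by (simp add: \<mu>')
  qed
  ultimately show False by simp
qed

text \<open>Monotonicity keeps the subtractions of natural numbers from being truncated.\<close>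

lemma sum_diff_telescope_nat:
  fixes a :: "nat \<Rightarrow> nat"
  assumes "p \<le> Suc R" "\<And>q. p \<le> q \<Longrightarrow> q \<le> R \<Longrightarrow> a (Suc q) \<le> a q"
  shows "(\<Sum>q=p..R. a q - a (Suc q)) + a (Suc R) = a p"
  using assms
proof (induction rule: inc_induct)
  case (step p)
  have "(\<Sum>q=p..R. a q - a (Suc q)) = a p - a (Suc p) + (\<Sum>q=Suc p..R. a q - a (Suc q))"
    using step.hyps by (intro sum.atLeast_Suc_atMost) simp
  moreover have "a (Suc p) \<le> a p" using step.hyps by (intro step.prems) simp_all
  moreover have "(\<Sum>q=Suc p..R. a q - a (Suc q)) + a (Suc R) = a (Suc p)"
    by (intro step.IH step.prems) simp_all
  ultimately show ?case by linarith
qed simp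

text \<open>Inverts the passage to tail sums: the multiplicity of e_q is the drop from the q-th to
  the next exponent, a natural number because the exponents decrease.\<close>

lemma ex_lead_monom:
  assumes \<mu>: "Poly_Mapping.keys \<mu> \<subseteq> Y ` {1..n} \<union> S ` idx n r"
    and anti: "\<And>j p q. j \<in> {1..n} \<Longrightarrow> 1 \<le> p \<Longrightarrow> p < q \<Longrightarrow> q \<le> r j \<Longrightarrow>
      Poly_Mapping.lookup \<mu> (svar r j q) \<le> Poly_Mapping.lookup \<mu> (svar r j p)"
  obtains \<rho> where "Poly_Mapping.keys \<rho> \<subseteq> evars n r" "lead_monom r \<rho> = \<mu>"
proof
  \<comment> \<open>Extending the exponents by 0 past the last variable gives e_q with q =
    \<open>r j\<close> the whole last exponent.\<close>
  define a where "a j p = (if p \<le> r j then Poly_Mapping.lookup \<mu> (svar r j p) else 0)" for j p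
  define \<rho> where "\<rho> = (\<Sum>i\<in>{1..n}. Poly_Mapping.single (Y i) (Poly_Mapping.lookup \<mu> (Y i))) +
    (\<Sum>\<iota>\<in>idx n r. Poly_Mapping.single (E \<iota>) (a (fst \<iota>) (snd \<iota>) - a (fst \<iota>) (Suc (snd \<iota>))))"
  show keys: "Poly_Mapping.keys \<rho> \<subseteq> evars n r"
    unfolding \<rho>_def evars_def
    by (rule order_trans[OF keys_add]) (intro Un_mono keys_sum_single)
  have \<rho>Y: "Poly_Mapping.lookup \<rho> (Y i) = Poly_Mapping.lookup \<mu> (Y i)" if "i \<in> {1..n}" for i
    using that by (simp add: \<rho>_def lookup_add lookup_sum lookup_single when_def)
  have \<rho>E: "Poly_Mapping.lookup \<rho> (E (j, q)) = a j q - a j (Suc q)" if "(j, q) \<in> idx n r" for j q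
  proof -
    have "Poly_Mapping.lookup \<rho> (E (j, q)) =
        (\<Sum>\<iota>\<in>idx n r. if \<iota> = (j, q) then a (fst \<iota>) (snd \<iota>) - a (fst \<iota>) (Suc (snd \<iota>)) else 0)"
      by (simp add: \<rho>_def lookup_add lookup_sum lookup_single when_def)
    thus ?thesis using that by simp
  qed
  show "lead_monom r \<rho> = \<mu>"
  proof (rule poly_mapping_eqI)
    fix x
    consider i where "i \<in> {1..n}" "x = Y i" | j where "j \<in> {1..n}" "x \<in> svars r j"
      | "x \<notin> Y ` {1..n}" "\<And>j. j \<in> {1..n} \<Longrightarrow> x \<notin> svars r j" by blast
    thus "Poly_Mapping.lookup (lead_monom r \<rho>) x = Poly_Mapping.lookup \<mu> x"
    proof cases
      case 1
      thus ?thesis using lookup_lead_monom_Y[OF keys] \<rho>Y by simp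
    next
      case 2
      from 2(2) obtain p where p: "p \<in> {1..r j}" "x = svar r j p" by (rule svars_cases)
      have "Poly_Mapping.lookup (lead_monom r \<rho>) x = (\<Sum>q=p..r j. Poly_Mapping.lookup \<rho> (E (j, q)))"
        unfolding p(2) using keys 2(1) p(1) by (rule lookup_lead_monom_svar[of \<rho> n r j p])
      also have "\<dots> = (\<Sum>q=p..r j. a j q - a j (Suc q))"
        using 2(1) p(1) by (intro sum.cong refl \<rho>E) (simp add: idx_def)
      also have "\<dots> = (\<Sum>q=p..r j. a j q - a j (Suc q)) + a j (Suc (r j))"
        by (simp add: a_def)
      also have "\<dots> = a j p"
        using anti[of j] 2(1) p(1) by (intro sum_diff_telescope_nat) (auto simp: a_def)
      also have "\<dots> = Poly_Mapping.lookup \<mu> x" using p by (simp add: a_def)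
      finally show ?thesis .
    next
      case 3
      have "x \<notin> Poly_Mapping.keys \<mu>"
      proof
        assume "x \<in> Poly_Mapping.keys \<mu>"
        with \<mu> 3(1) have "x \<in> S ` idx n r" by blast
        then obtain j l where "x = S (j, l)" "j \<in> {1..n}" "l \<in> {1..r j}" by (auto simp: idx_def)
        with 3(2)[of j] show False by (simp add: svars_def)
      qed
      moreover have "x \<notin> svar r j ` {1..q}" if "j \<in> {1..n}" "q \<in> {1..r j}" for j q
      proof
        assume "x \<in> svar r j ` {1..q}"
        hence "x \<in> svar r j ` {1..r j}" using that(2) by auto
        with 3(2)[OF that(1)] show False by (simp only: svar_image)
      qed
      hence "(\<Sum>j=1..n. \<Sum>q=1..r j. if x \<in> svar r j ` {1..q} then Poly_Mapping.lookup \<rho> (E (j, q)) else 0) = 0"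
        by (intro sum.neutral ballI if_not_P)
      moreover have "(\<Sum>i=1..n. if x = Y i then Poly_Mapping.lookup \<rho> (Y i) else 0) = 0"
        using 3(1) by (intro sum.neutral ballI if_not_P) auto
      ultimately show ?thesis by (simp add: lookup_lead_monom[OF keys] in_keys_iff)
    qed
  qed
qed

text \<open>By symmetry the leading monomial of P has decreasing exponents in each block, hence is
  also the leading monomial of a product of y's and e's. Subtracting the right integer multiple of
  that product removes it.\<close>

theorem symmetric_in_elementary:
  assumes "indets P \<subseteq> Y ` {1..n} \<union> S ` idx n r" "block_symmetric n r P"
  obtains Q where "indets Q \<subseteq> evars n r" "expand_e r Q = P"
proof -
  define V where "V = Y ` {1..n} \<union> S ` idx n r"
  define d where "d = Max (insert 0 (tdeg ` Poly_Mapping.keys P))"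
  define K where "K = {m. Poly_Mapping.keys m \<subseteq> V \<and> tdeg m \<le> d}"
  \<comment> \<open>Subtraction may create new monomials, so the measure counts everything in
    \<open>K\<close> below some monomial of P instead of the monomials of P. It loses \<mu> and
    gains nothing.\<close>
  define down where "down P = {m \<in> K. \<exists>m'\<in>Poly_Mapping.keys (P :: pol). m \<le> m'}" for P
  have "finite K" unfolding K_def by (rule finite_monoms_bounded) (simp add: V_def)
  hence fin: "finite (down P)" for P by (simp add: down_def)
  have "Poly_Mapping.keys P \<subseteq> K"
    using assms(1) by (auto simp: K_def V_def d_def indets_def intro!: Max_ge)
  hence "\<exists>Q. indets Q \<subseteq> evars n r \<and> expand_e r Q = P" using assms(2)
  proof (induction "card (down P)" arbitrary: P rule: less_induct)
    case less
    show ?case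
    proof (cases "P = 0")
      case True
      thus ?thesis by (intro exI[of _ 0]) (simp add: expand_e_alt)
    next
      case False
      define \<mu> where "\<mu> = Max (Poly_Mapping.keys P)"
      have \<mu>: "\<mu> \<in> Poly_Mapping.keys P" "\<And>m. m \<in> Poly_Mapping.keys P \<Longrightarrow> m \<le> \<mu>"
        using False by (auto simp: \<mu>_def)
      have \<mu>K: "Poly_Mapping.keys \<mu> \<subseteq> V" "tdeg \<mu> \<le> d" using \<mu>(1) less.prems(1) by (auto simp: K_def)
      obtain \<rho> where \<rho>: "Poly_Mapping.keys \<rho> \<subseteq> evars n r" "lead_monom r \<rho> = \<mu>"
        using \<mu>K(1) lead_antimono[OF less.prems(2) \<mu>] unfolding V_def by (rule ex_lead_monom[of \<mu> n r])
      define M where "M = Poly_Mapping.single \<rho> (Poly_Mapping.lookup P \<mu>)"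
      have M: "indets M \<subseteq> evars n r" using \<rho>(1) by (simp add: M_def indets_def)
      have expM: "expand_e r M = of_int (Poly_Mapping.lookup P \<mu>) * subst_monom (e_map r) \<rho>"
        by (simp add: M_def expand_e_alt)
      have monic: "monic_at (subst_monom (e_map r) \<rho>) \<mu>"
        using monic_at_subst_monom[OF \<rho>(1)] \<rho>(2) by simp
      define P' where "P' = P - expand_e r M"
      have keysM: "m \<in> K \<and> m \<le> \<mu>" if m: "m \<in> Poly_Mapping.keys (expand_e r M)" for m
      proof -
        have "m \<in> Poly_Mapping.keys (subst_monom (e_map r) \<rho>)"
          using m by (simp add: expM in_keys_iff lookup_of_int_mult)
        hence "m \<le> \<mu>" "tdeg m = tdeg \<mu>" using monic by (auto simp: monic_at_def)
        moreover have "indets (expand_e r M) \<subseteq> V"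
          unfolding expand_e_alt V_def by (intro indets_subst indets_e_map) (use M in blast)
        hence "Poly_Mapping.keys m \<subseteq> V" using m by (auto simp: indets_def)
        ultimately show ?thesis using \<mu>K by (simp add: K_def)
      qed
      have keysP': "m \<in> K \<and> m < \<mu>" if m: "m \<in> Poly_Mapping.keys P'" for m
      proof -
        have "m \<in> Poly_Mapping.keys P \<or> m \<in> Poly_Mapping.keys (expand_e r M)"
          using m by (auto simp: P'_def in_keys_iff lookup_minus)
        hence "m \<in> K \<and> m \<le> \<mu>" using keysM[of m] \<mu>(2)[of m] less.prems(1) by blast
        moreover have "Poly_Mapping.lookup P' \<mu> = 0"
          using monic by (simp add: P'_def lookup_minus expM lookup_of_int_mult monic_at_def)
        hence "m \<noteq> \<mu>" using m by (auto simp: in_keys_iff)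
        ultimately show ?thesis by auto
      qed
      have "down P' \<subset> down P"
      proof
        show "down P' \<subseteq> down P" 
          using \<mu>(1) by (auto simp: down_def intro!: bexI[of _ \<mu>] dest!: keysP')
        have "\<mu> \<in> down P" using \<mu> \<mu>K by (auto simp: down_def K_def)
        moreover have "\<mu> \<notin> down P'" using keysP' unfolding down_def by fastforce
        ultimately show "down P' \<noteq> down P" by blast
      qed
      hence "card (down P') < card (down P)" by (rule psubset_card_mono[OF fin])
      moreover have "Poly_Mapping.keys P' \<subseteq> K" using keysP' by blast
      moreover have "block_symmetric n r P'"
        unfolding P'_def by (intro block_symmetric_diff block_symmetric_expand_e less.prems M)
      ultimately obtain Q where "indets Q \<subseteq> evars n r" "expand_e r Q = P'"
        using less.hyps by blast
      with M show ?thesis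
        by (intro exI[of _ "Q + M"]) (simp add: indets_add P'_def expand_e_alt)
    qed
  qed
  with that show ?thesis by blast
qed

section \<open>Exchange relations\<close>

lemma pos_part_eq_nat: "[a]\<^sub>+ = int (nat a)"
  by (simp add: pos_part_def)

text \<open>Positive factors pass through the positive part, so the symmetrizer turns
  \<open>[- b i k]\<^sub>+\<close> into \<open>[b k i]\<^sub>+\<close>, and the two correction terms
  change places with a sign. Persistence of the symmetrizer is what gives b_kk = 0 at every
  vertex.\<close>

lemma skew_mutation:
  fixes b :: "nat \<Rightarrow> nat \<Rightarrow> int" and d :: "nat \<Rightarrow> int"
  assumes d: "d i > 0" "d j > 0" "d k > 0"
    and skew: "d i * b i j = - (d j * b j i)" "d i * b i k = - (d k * b k i)" "d j * b j k = - (d k * b k j)"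
  shows "d i * (b i j + c * (b i k * [b k j]\<^sub>+ + [- b i k]\<^sub>+ * b k j)) =
    - (d j * (b j i + c * (b j k * [b k i]\<^sub>+ + [- b j k]\<^sub>+ * b k i)))"
proof -
  have mult_pos_part: "x * [a]\<^sub>+ = [x * a]\<^sub>+" if "x > 0" for x a
    using that by (simp add: pos_part_def max_def mult_le_0_iff)
  have "d i * [- b i k]\<^sub>+ = d k * [b k i]\<^sub>+" "d j * [- b j k]\<^sub>+ = d k * [b k j]\<^sub>+"
    using skew d by (simp_all add: mult_pos_part)
  note eq = skew this
  have "d i * (b i j + c * (b i k * [b k j]\<^sub>+ + [- b i k]\<^sub>+ * b k j)) =
      d i * b i j + c * ((d i * b i k) * [b k j]\<^sub>+ + (d i * [- b i k]\<^sub>+) * b k j)"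
    by (simp add: algebra_simps)
  also have "\<dots> = - (d j * b j i + c * ((d j * b j k) * [b k i]\<^sub>+ + (d j * [- b j k]\<^sub>+) * b k i))"
    unfolding eq by (simp add: algebra_simps)
  also have "\<dots> = - (d j * (b j i + c * (b j k * [b k i]\<^sub>+ + [- b j k]\<^sub>+ * b k i)))"
    by (simp add: algebra_simps)
  finally show ?thesis .
qed

text \<open>As b_kk = 0, all exchange entries inside block k vanish and its mutations do not disturb
  one another: when direction (k, q) is reached, its columns and the \<open>F\<close> outside the
  block that enter the rule are still the original ones, up to entries of \<open>B\<close> that
  remain equal.\<close>

lemma mu_steps:
  fixes k n :: nat and r :: "nat \<Rightarrow> nat" and b :: "nat \<Rightarrow> nat \<Rightarrow> int"
  assumes k: "k \<in> {1..n}" and bkk: "b k k = 0"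
    and B: "\<And>\<iota> \<nu>. \<iota> \<in> D \<Longrightarrow> \<nu> \<in> D \<Longrightarrow> B \<iota> \<nu> = b (fst \<iota>) (fst \<nu>)"
    and D: "D = idx n r"
    and p: "p \<le> r k"
    and fold: "fold (\<lambda>l. mu D (k, l)) [1..<Suc p] (B, C, F) = (B', C', F')"
    and \<iota>: "\<iota> \<in> D" and \<nu>: "\<nu> \<in> D"
  shows "B' \<iota> \<nu> = (if fst \<iota> = k then if snd \<iota> \<le> p then - b k (fst \<nu>) else b k (fst \<nu>)
             else if fst \<nu> = k then if snd \<nu> \<le> p then - b (fst \<iota>) k else b (fst \<iota>) k
             else b (fst \<iota>) (fst \<nu>) + int p * (b (fst \<iota>) k * [b k (fst \<nu>)]\<^sub>+ + [- b (fst \<iota>) k]\<^sub>+ * b k (fst \<nu>))) \<and>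
    C' \<iota> \<nu> = (if fst \<nu> = k then if snd \<nu> \<le> p then - C \<iota> \<nu> else C \<iota> \<nu>
             else C \<iota> \<nu> + (\<Sum>q=1..p. C \<iota> (k, q) * [b k (fst \<nu>)]\<^sub>+ + [- C \<iota> (k, q)]\<^sub>+ * b k (fst \<nu>))) \<and>
    F' \<nu> = (if fst \<nu> = k \<and> snd \<nu> \<le> p then inverse (F \<nu>)
               * (\<Prod>\<iota>\<in>D. rvar (Yt \<iota>) powi [- C \<iota> \<nu>]\<^sub>+ * F \<iota> powi [- b (fst \<iota>) k]\<^sub>+)
               * (1 + (\<Prod>\<iota>\<in>D. rvar (Yt \<iota>) powi C \<iota> \<nu> * F \<iota> powi b (fst \<iota>) k))
             else F \<nu>)"
  using p fold \<iota> \<nu>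
proof (induction p arbitrary: B' C' F' \<iota> \<nu>)
  case 0
  from 0(2) have "B' = B" "C' = C" "F' = F" by simp_all
  \<comment> \<open>Second indices start at 1, so after no mutation the branches
    \<open>snd \<le> 0\<close> are void.\<close>
  moreover have "snd \<iota> > 0" "snd \<nu> > 0" using 0(3,4) by (auto simp: D idx_def)
  ultimately show ?case using B[OF 0(3,4)] by auto
next
  case (Suc p)
  obtain B1 C1 F1 where f1: "fold (\<lambda>l. mu D (k, l)) [1..<Suc p] (B, C, F) = (B1, C1, F1)"
    by (metis prod_cases3)
  let ?\<kappa> = "(k, Suc p)"
  have s: "(B', C', F') = mu D ?\<kappa> (B1, C1, F1)"
    using Suc.prems(2) f1 by simp
  have \<kappa>: "?\<kappa> \<in> D" using k Suc.prems(1) by (simp add: D idx_def)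
  have "p \<le> r k" using Suc.prems(1) by simp
  note IH = Suc.IH[OF this f1]
  have IHB: "B1 \<iota> \<nu> = (if fst \<iota> = k then if snd \<iota> \<le> p then - b k (fst \<nu>) else b k (fst \<nu>)
             else if fst \<nu> = k then if snd \<nu> \<le> p then - b (fst \<iota>) k else b (fst \<iota>) k
             else b (fst \<iota>) (fst \<nu>) + int p * (b (fst \<iota>) k * [b k (fst \<nu>)]\<^sub>+ + [- b (fst \<iota>) k]\<^sub>+ * b k (fst \<nu>)))"
    and IHC: "C1 \<iota> \<nu> = (if fst \<nu> = k then if snd \<nu> \<le> p then - C \<iota> \<nu> else C \<iota> \<nu>
             else C \<iota> \<nu> + (\<Sum>q=1..p. C \<iota> (k, q) * [b k (fst \<nu>)]\<^sub>+ + [- C \<iota> (k, q)]\<^sub>+ * b k (fst \<nu>)))"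
    and IHF: "F1 \<nu> = (if fst \<nu> = k \<and> snd \<nu> \<le> p then inverse (F \<nu>)
               * (\<Prod>\<iota>\<in>D. rvar (Yt \<iota>) powi [- C \<iota> \<nu>]\<^sub>+ * F \<iota> powi [- b (fst \<iota>) k]\<^sub>+)
               * (1 + (\<Prod>\<iota>\<in>D. rvar (Yt \<iota>) powi C \<iota> \<nu> * F \<iota> powi b (fst \<iota>) k))
             else F \<nu>)"
    if "\<iota> \<in> D" "\<nu> \<in> D" for \<iota> \<nu>
    using IH[OF that] by blast+
  have B\<kappa>: "B1 \<iota> ?\<kappa> = b (fst \<iota>) k" "B1 ?\<kappa> \<iota> = b k (fst \<iota>)" if "\<iota> \<in> D" for \<iota>
    using IHB[OF that \<kappa>] IHB[OF \<kappa> that] bkk by auto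
  have C\<kappa>: "C1 \<iota> ?\<kappa> = C \<iota> ?\<kappa>" if "\<iota> \<in> D" for \<iota>
    using IHC[OF that \<kappa>] by simp
  \<comment> \<open>Polynomials of block k that have already been mutated enter the exchange
    monomials with exponent b_kk = 0.\<close>
  have F\<kappa>: "F1 \<iota> powi c = F \<iota> powi c" if "\<iota> \<in> D" "fst \<iota> = k \<Longrightarrow> c = 0" for \<iota> c
    using IHF[OF that(1) that(1)] that(2) by auto
  have F1: "F1 ?\<kappa> = F ?\<kappa>" using IHF[OF \<kappa> \<kappa>] by simp
  have "(\<Prod>\<iota>\<in>D. rvar (Yt \<iota>) powi [- C1 \<iota> ?\<kappa>]\<^sub>+ * F1 \<iota> powi [- B1 \<iota> ?\<kappa>]\<^sub>+) =
      (\<Prod>\<iota>\<in>D. rvar (Yt \<iota>) powi [- C \<iota> ?\<kappa>]\<^sub>+ * F \<iota> powi [- b (fst \<iota>) k]\<^sub>+)"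
    by (intro prod.cong refl) (simp add: B\<kappa> C\<kappa> F\<kappa> bkk pos_part_def)
  moreover have "(\<Prod>\<iota>\<in>D. rvar (Yt \<iota>) powi C1 \<iota> ?\<kappa> * F1 \<iota> powi B1 \<iota> ?\<kappa>) =
      (\<Prod>\<iota>\<in>D. rvar (Yt \<iota>) powi C \<iota> ?\<kappa> * F \<iota> powi b (fst \<iota>) k)"
    by (intro prod.cong refl) (simp add: B\<kappa> C\<kappa> F\<kappa> bkk)
  ultimately have F': "F' \<nu> = (if \<nu> = ?\<kappa> then inverse (F \<nu>)
               * (\<Prod>\<iota>\<in>D. rvar (Yt \<iota>) powi [- C \<iota> \<nu>]\<^sub>+ * F \<iota> powi [- b (fst \<iota>) k]\<^sub>+)
               * (1 + (\<Prod>\<iota>\<in>D. rvar (Yt \<iota>) powi C \<iota> \<nu> * F \<iota> powi b (fst \<iota>) k))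
             else F1 \<nu>)"
    using s F1 by (simp add: mu_def)
  have B': "B' \<iota> \<nu> = (if \<iota> = ?\<kappa> \<or> \<nu> = ?\<kappa> then - B1 \<iota> \<nu>
             else B1 \<iota> \<nu> + b (fst \<iota>) k * [b k (fst \<nu>)]\<^sub>+ + [- b (fst \<iota>) k]\<^sub>+ * b k (fst \<nu>))"
    and C': "C' \<iota> \<nu> = (if \<nu> = ?\<kappa> then - C1 \<iota> \<nu>
             else C1 \<iota> \<nu> + C \<iota> ?\<kappa> * [b k (fst \<nu>)]\<^sub>+ + [- C \<iota> ?\<kappa>]\<^sub>+ * b k (fst \<nu>))"
    using s B\<kappa>[OF Suc.prems(3)] B\<kappa>[OF Suc.prems(4)] C\<kappa>[OF Suc.prems(3)] by (simp_all add: mu_def)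
  note IH' = IHB[OF Suc.prems(3,4)] IHC[OF Suc.prems(3,4)] IHF[OF Suc.prems(3,4)]
  have snd: "snd \<iota> \<le> Suc p \<longleftrightarrow> snd \<iota> \<le> p \<or> snd \<iota> = Suc p" for \<iota> :: "nat \<times> nat" by auto
  have "(\<iota> = ?\<kappa>) = (fst \<iota> = k \<and> snd \<iota> = Suc p)" for \<iota> by (cases \<iota>) auto
  note eqs = snd this bkk
  show ?case
  proof (intro conjI)
    show "B' \<iota> \<nu> = (if fst \<iota> = k then if snd \<iota> \<le> Suc p then - b k (fst \<nu>) else b k (fst \<nu>)
             else if fst \<nu> = k then if snd \<nu> \<le> Suc p then - b (fst \<iota>) k else b (fst \<iota>) k
             else b (fst \<iota>) (fst \<nu>) + int (Suc p) * (b (fst \<iota>) k * [b k (fst \<nu>)]\<^sub>+ + [- b (fst \<iota>) k]\<^sub>+ * b k (fst \<nu>)))"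
      unfolding B' IH'(1) eqs by (auto simp: bkk algebra_simps pos_part_def)
    show "C' \<iota> \<nu> = (if fst \<nu> = k then if snd \<nu> \<le> Suc p then - C \<iota> \<nu> else C \<iota> \<nu>
             else C \<iota> \<nu> + (\<Sum>q=1..Suc p. C \<iota> (k, q) * [b k (fst \<nu>)]\<^sub>+ + [- C \<iota> (k, q)]\<^sub>+ * b k (fst \<nu>)))"
      unfolding C' IH'(2) eqs by (auto simp: bkk algebra_simps pos_part_def)
  qed (unfold F' IH'(3) eqs, auto)
qed

lemma to_fract_power [simp]: "to_fract (x ^ m) = to_fract (x :: pol) ^ m"
  by (induction m) simp_all

lemma to_fract_prod [simp]: "to_fract (\<Prod>x\<in>A. f x) = (\<Prod>x\<in>A. to_fract (f x :: pol))"
  by (induction A rule: infinite_finite_induct) simp_all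

lemma Var_neq_0 [simp]: "Var x \<noteq> 0"
  by (metis indets_0 indets_Var insert_not_empty)

lemma powi_eq_quotient:
  fixes x :: "'a :: field"
  assumes "x \<noteq> 0"
  shows "x powi a = x ^ nat a / x ^ nat (- a)"
  by (cases "a \<ge> 0") (simp_all add: power_int_def assms field_simps)

text \<open>The prefactor of the mutation rule is the denominator of the exchange monomial.
  Multiplying the two leaves polynomials only.\<close>

lemma prod_powi_eq_quotient:
  fixes f :: "'i \<Rightarrow> pol" and b c :: "'i \<Rightarrow> int"
  assumes "finite I" "\<forall>i\<in>I. f i \<noteq> 0"
  shows "(\<Prod>i\<in>I. rvar (x i) powi [- c i]\<^sub>+ * to_fract (f i) powi [- b i]\<^sub>+) =
      to_fract (\<Prod>i\<in>I. Var (x i) ^ nat (- c i) * f i ^ nat (- b i))" (is ?thesis1)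
    and "(\<Prod>i\<in>I. rvar (x i) powi c i * to_fract (f i) powi b i) =
      to_fract (\<Prod>i\<in>I. Var (x i) ^ nat (c i) * f i ^ nat (b i)) /
      to_fract (\<Prod>i\<in>I. Var (x i) ^ nat (- c i) * f i ^ nat (- b i))" (is ?thesis2)
    and "(\<Prod>i\<in>I. Var (x i) ^ nat (c i) * f i ^ nat (b i)) \<noteq> 0" (is ?thesis3)
    and "(\<Prod>i\<in>I. Var (x i) ^ nat (- c i) * f i ^ nat (- b i)) \<noteq> 0" (is ?thesis4)
proof -
  show ?thesis1 by (simp only: pos_part_eq_nat power_int_of_nat to_fract_prod to_fract_mult to_fract_power)
  have "(\<Prod>i\<in>I. rvar (x i) powi c i * to_fract (f i) powi b i) =
      (\<Prod>i\<in>I. to_fract (Var (x i) ^ nat (c i) * f i ^ nat (b i)) /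
         to_fract (Var (x i) ^ nat (- c i) * f i ^ nat (- b i)))"
    using assms(2) by (intro prod.cong refl) (simp add: powi_eq_quotient)
  thus ?thesis2 by (simp add: prod_dividef)
  show ?thesis3 ?thesis4 using assms by (simp_all add: prod_zero_iff)
qed

lemma composite_step:
  fixes k n :: nat and r :: "nat \<Rightarrow> nat" and b :: "nat \<Rightarrow> nat \<Rightarrow> int" and F F' :: "nat \<times> nat \<Rightarrow> pol"
  assumes k: "k \<in> {1..n}" and bkk: "b k k = 0"
    and B: "\<forall>\<iota>\<in>idx n r. \<forall>\<nu>\<in>idx n r. B \<iota> \<nu> = b (fst \<iota>) (fst \<nu>)"
    and F: "\<forall>\<iota>\<in>idx n r. F \<iota> \<noteq> 0"
    and agree: "agree_on (idx n r) (Bm, Cm, \<lambda>\<iota>. to_fract (F' \<iota>))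
          (mu_block (idx n r) r k (B, C, \<lambda>\<iota>. to_fract (F \<iota>)))"
    and \<iota>: "\<iota> \<in> idx n r" and \<nu>: "\<nu> \<in> idx n r"
  shows "Bm \<iota> \<nu> = (if fst \<iota> = k \<or> fst \<nu> = k then - b (fst \<iota>) (fst \<nu>)
             else b (fst \<iota>) (fst \<nu>) + int (r k) * (b (fst \<iota>) k * [b k (fst \<nu>)]\<^sub>+ + [- b (fst \<iota>) k]\<^sub>+ * b k (fst \<nu>)))"
      (is ?thesis1)
    and "Cm \<iota> \<nu> = (if fst \<nu> = k then - C \<iota> \<nu>
             else C \<iota> \<nu> + (\<Sum>q=1..r k. C \<iota> (k, q) * [b k (fst \<nu>)]\<^sub>+ + [- C \<iota> (k, q)]\<^sub>+ * b k (fst \<nu>)))"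
      (is ?thesis2)
    and "fst \<nu> \<noteq> k \<Longrightarrow> F' \<nu> = F \<nu>"
    and "fst \<nu> = k \<Longrightarrow> F' \<nu> * F \<nu> =
           (\<Prod>\<iota>\<in>idx n r. Var (Yt \<iota>) ^ nat (- C \<iota> \<nu>) * F \<iota> ^ nat (- b (fst \<iota>) k)) +
           (\<Prod>\<iota>\<in>idx n r. Var (Yt \<iota>) ^ nat (C \<iota> \<nu>) * F \<iota> ^ nat (b (fst \<iota>) k))"
proof -
  have B': "B \<iota> \<nu> = b (fst \<iota>) (fst \<nu>)" if "\<iota> \<in> idx n r" "\<nu> \<in> idx n r" for \<iota> \<nu>
    using B that by blast
  define f where "f \<iota> = to_fract (F \<iota>)" for \<iota>
  obtain B1 C1 F1 where f1: "fold (\<lambda>l. mu (idx n r) (k, l)) [1..<Suc (r k)] (B, C, f) = (B1, C1, F1)"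
    by (metis prod_cases3)
  note steps = mu_steps[where n = n and r = r and b = b and k = k and p = "r k", OF k bkk B' refl order.refl f1 \<iota> \<nu>]
  have eq: "Bm \<iota> \<nu> = B1 \<iota> \<nu>" "Cm \<iota> \<nu> = C1 \<iota> \<nu>" "to_fract (F' \<nu>) = F1 \<nu>"
    using agree[folded f_def, unfolded mu_block_def f1] \<iota> \<nu> by (simp_all add: agree_on_def f_def)
  have snd: "fst \<iota> = k \<Longrightarrow> snd \<iota> \<le> r k" "fst \<nu> = k \<Longrightarrow> snd \<nu> \<le> r k"
    using \<iota> \<nu> by (auto simp: idx_def)
  show ?thesis1 using steps eq snd bkk by auto
  show ?thesis2 using steps eq snd by auto
  show "F' \<nu> = F \<nu>" if "fst \<nu> \<noteq> k"
    using steps eq that by (simp add: f_def)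
  assume \<nu>k: "fst \<nu> = k"
  define P where "P = (\<Prod>\<iota>\<in>idx n r. Var (Yt \<iota>) ^ nat (- C \<iota> \<nu>) * F \<iota> ^ nat (- b (fst \<iota>) k))"
  define Q where "Q = (\<Prod>\<iota>\<in>idx n r. Var (Yt \<iota>) ^ nat (C \<iota> \<nu>) * F \<iota> ^ nat (b (fst \<iota>) k))"
  note quot = prod_powi_eq_quotient[where I = "idx n r" and f = F and x = Yt and c = "\<lambda>\<iota>. C \<iota> \<nu>"
      and b = "\<lambda>\<iota>. b (fst \<iota>) k", OF finite_idx F, folded P_def Q_def]
  have "to_fract (F' \<nu>) = inverse (to_fract (F \<nu>)) * to_fract P * (1 + to_fract Q / to_fract P)"
    using steps eq(3) \<nu>k snd(2) quot(1,2) by (simp add: f_def)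
  moreover have "to_fract P \<noteq> 0" "to_fract (F \<nu>) \<noteq> 0"
    using quot(4) F \<nu> by simp_all
  ultimately have "to_fract (F' \<nu>) * to_fract (F \<nu>) = to_fract P + to_fract Q"
    by (simp add: distrib_left distrib_right mult.commute[of "inverse _"] mult.assoc)
  hence "to_fract (F' \<nu> * F \<nu>) = to_fract (P + Q)"
    by simp
  thus "F' \<nu> * F \<nu> = P + Q" by (simp only: to_fract_eq_iff)
qed

text \<open>\<open>A\<^sup>r \<zeta>(B/A)\<close> for \<open>\<zeta>(u) = \<zeta>\<^sub>0 + \<dots> + \<zeta>\<^sub>r u\<^sup>r\<close> if \<open>e = 1\<close>, and the same for the reciprocal polynomial otherwise.\<close>

definition homog :: "int \<Rightarrow> (nat \<Rightarrow> 'a) \<Rightarrow> nat \<Rightarrow> 'a \<Rightarrow> 'a \<Rightarrow> 'a :: comm_semiring_1" where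
  "homog e \<zeta> r A B = (\<Sum>m\<le>r. \<zeta> m * (if e = 1 then A ^ (r - m) * B ^ m else A ^ m * B ^ (r - m)))"

lemma subst_homog: "subst f (homog e \<zeta> r A B) = homog e (\<lambda>m. subst f (\<zeta> m)) r (subst f A) (subst f B)"
  by (cases "e = 1") (simp_all add: homog_def)

text \<open>The counterpart of the mutation rule for Z: reading the coefficients backwards is the
  sign change of \<open>e\<close>.\<close>

lemma homog_reciprocal:
  fixes u :: "'a :: field"
  assumes "u \<noteq> 0" "e = 1 \<or> e = - 1"
  shows "u ^ r * homog e \<zeta> r 1 (inverse u) = homog (- e) \<zeta> r 1 u"
proof -
  have "u ^ r * (inverse u) ^ m = u ^ (r - m)" "u ^ r * (inverse u) ^ (r - m) = u ^ m" if "m \<le> r" for m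
    using that assms(1) by (simp_all add: power_diff power_inverse field_simps)
  thus ?thesis using assms(2)
    by (auto simp: homog_def sum_distrib_left mult.left_commute[of "u ^ r"])
qed

lemma homog_dehomogenize:
  fixes A B :: "'a :: field"
  assumes "A \<noteq> 0"
  shows "A ^ r * homog e \<zeta> r 1 (B / A) = homog e \<zeta> r A B"
proof -
  have "A ^ r * (B / A) ^ m = A ^ (r - m) * B ^ m" "A ^ r * (B / A) ^ (r - m) = A ^ m * B ^ (r - m)" if "m \<le> r" for m
    using that assms by (simp_all add: power_diff power_divide field_simps)
  note * = this
  show ?thesis
    by (cases "e = 1") (simp_all add: homog_def sum_distrib_left mult.left_commute[of "A ^ r"] *)
qed

lemma to_fract_homog: "to_fract (homog e \<zeta> r A B) = homog e (\<lambda>m. to_fract (\<zeta> m :: pol)) r (to_fract A) (to_fract B)"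
  by (cases "e = 1") (simp_all add: homog_def)

section \<open>Linear factors, shifted exponents and symmetric exchange monomials\<close>

lemma elem_sym_0 [simp]: "elem_sym r (j, 0) = 1"
proof -
  have "{A. A \<subseteq> {1..r j} \<and> card A = 0} = {{}}"
    by (auto dest: finite_subset)
  thus ?thesis by (simp add: elem_sym_def)
qed

lemma elem_sym_top: "elem_sym r (j, r j) = (\<Prod>l=1..r j. Var (S (j, l)))"
proof -
  have "{A. A \<subseteq> {1..r j} \<and> card A = r j} = {{1..r j}}"
    using card_subset_eq[of "{1..r j}"] by auto
  thus ?thesis by (simp add: elem_sym_def)
qed

text \<open>Expand over the set X of those q whose factor contributes the summand with s_q, and
  group by the cardinality of X. For e = -1 that summand is the one with A, whence the exchanged
  exponents.\<close>

lemma prod_linear_factors: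
  assumes "e = 1 \<or> e = (- 1 :: int)"
  shows "(\<Prod>q=1..r k. A * (if - e = 1 then Var (S (k, q)) else 1) + B * (if e = 1 then Var (S (k, q)) else 1)) =
    homog e (\<lambda>m. elem_sym r (k, m)) (r k) A B"
proof -
  let ?I = "{1..r k}"
  have expand: "(\<Prod>q=1..r k. B * Var (S (k, q)) + A) = (\<Sum>m\<le>r k. elem_sym r (k, m) * (A ^ (r k - m) * B ^ m))" for A B
  proof -
    have "(\<Prod>q=1..r k. B * Var (S (k, q)) + A) =
        (\<Sum>X\<in>Pow ?I. (\<Prod>q\<in>X. B * Var (S (k, q))) * (\<Prod>q\<in>?I - X. A))"
      by (rule prod_add) simp
    also have "\<dots> = (\<Sum>X\<in>Pow ?I. (\<Prod>q\<in>X. Var (S (k, q))) * (A ^ (r k - card X) * B ^ card X))"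
    proof (intro sum.cong refl)
      fix X assume "X \<in> Pow ?I"
      hence "finite X" "card (?I - X) = r k - card X"
        by (auto simp: card_Diff_subset finite_subset)
      thus "(\<Prod>q\<in>X. B * Var (S (k, q))) * (\<Prod>q\<in>?I - X. A) =
          (\<Prod>q\<in>X. Var (S (k, q))) * (A ^ (r k - card X) * B ^ card X)"
        by (simp add: prod.distrib mult_ac)
    qed
    also have "\<dots> = (\<Sum>m\<le>r k. \<Sum>X\<in>{X\<in>Pow ?I. card X = m}. (\<Prod>q\<in>X. Var (S (k, q))) * (A ^ (r k - card X) * B ^ card X))"
    proof (rule sum.group[symmetric])
      show "card ` Pow ?I \<subseteq> {..r k}"
        using card_mono[of ?I] by auto
    qed auto
    also have "\<dots> = (\<Sum>m\<le>r k. elem_sym r (k, m) * (A ^ (r k - m) * B ^ m))"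
      by (simp add: elem_sym_def sum_distrib_right Pow_def)
    finally show ?thesis .
  qed
  from assms show ?thesis
  proof
    assume "e = 1"
    thus ?thesis using expand[of B A] by (simp add: homog_def add.commute)
  next
    assume "e = - 1"
    thus ?thesis using expand[of A B] by (simp add: homog_def mult.commute)
  qed
qed

text \<open>x and x + e are consecutive integers, hence never of strictly opposite sign, so
  truncation at 0 commutes with the sum.\<close>

lemma sum_nat_shifted:
  fixes x e :: int
  assumes e: "e = 1 \<or> e = - 1" and l: "l \<in> {1..r}"
  shows "(\<Sum>q=1..r. nat (x + (if q = l then e else 0))) = nat (int r * x + e)"
proof -
  have "(\<Sum>q=1..r. nat (x + (if q = l then e else 0))) = nat (x + e) + (\<Sum>q\<in>{1..r} - {l}. nat (x + (if q = l then e else 0)))"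
    using l by (subst sum.remove[of _ l]) auto
  also have "(\<Sum>q\<in>{1..r} - {l}. nat (x + (if q = l then e else 0))) = (\<Sum>q\<in>{1..r} - {l}. nat x)"
    by (intro sum.cong) auto
  also have "\<dots> = (r - 1) * nat x" using l by simp
  also have "nat (x + e) + (r - 1) * nat x = nat (int r * x + e)"
  proof -
    have r: "int (r - 1) = int r - 1" using l by auto
    consider "x = 0" | "x \<ge> 1" | "x \<le> - 1" by linarith
    thus ?thesis
    proof cases
      case 2
      have "int (nat (x + e) + (r - 1) * nat x) = (x + e) + (int r - 1) * x"
        using 2 e by (auto simp: r[unfolded One_nat_def])
      also have "\<dots> = int r * x + e" by (simp add: algebra_simps)
      finally show ?thesis by linarith
    next
      case 3
      have "int r * x \<le> int r * (- 1)" using 3 by (intro mult_left_mono) auto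
      hence "int r * x + e \<le> 0" using e l by auto
      moreover have "x + e \<le> 0" using 3 e by auto
      ultimately show ?thesis using 3 by simp
    qed simp
  qed
  finally show ?thesis .
qed

text \<open>In terms of 0-1 brackets, nat (x + e) = nat x + [e = 1] - [e x < 0]. Multiplication by
  s_q to the last bracket removes the subtraction and leaves a symmetric product times at most one
  s_q.\<close>

lemma prod_shifted_power:
  fixes s :: "nat \<Rightarrow> 'a :: comm_semiring_1" and x e :: int
  assumes e: "e = 1 \<or> e = - 1" and q: "q \<in> {1..r}"
  shows "s q ^ (if e * x < 0 then 1 else 0) * (\<Prod>l=1..r. s l ^ nat (x + (if l = q then e else 0))) =
    (\<Prod>l=1..r. s l) ^ nat x * (if e = 1 then s q else 1)"
proof -
  define R where "R = (\<Prod>l\<in>{1..r} - {q}. s l) ^ nat x"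
  have "(\<Prod>l=1..r. s l ^ nat (x + (if l = q then e else 0))) =
      s q ^ nat (x + e) * (\<Prod>l\<in>{1..r} - {q}. s l ^ nat (x + (if l = q then e else 0)))"
    using q by (subst prod.remove[of _ q]) auto
  also have "(\<Prod>l\<in>{1..r} - {q}. s l ^ nat (x + (if l = q then e else 0))) = (\<Prod>l\<in>{1..r} - {q}. s l ^ nat x)"
    by (intro prod.cong) auto
  finally have 1: "(\<Prod>l=1..r. s l ^ nat (x + (if l = q then e else 0))) = s q ^ nat (x + e) * R"
    by (simp add: R_def prod_power_distrib)
  have "(\<Prod>l=1..r. s l) = s q * (\<Prod>l\<in>{1..r} - {q}. s l)"
    using q by (subst prod.remove[of _ q]) auto
  hence 2: "(\<Prod>l=1..r. s l) ^ nat x = s q ^ nat x * R" by (simp add: R_def power_mult_distrib)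
  have "(if e * x < 0 then 1 else 0) + nat (x + e) = nat x + (if e = 1 then 1 else 0)"
    using e by auto
  hence "s q ^ (if e * x < 0 then 1 else 0) * s q ^ nat (x + e) = s q ^ nat x * (if e = 1 then s q else 1)"
    unfolding power_add[symmetric] by (simp add: power_add)
  hence "s q ^ (if e * x < 0 then 1 else 0) * (s q ^ nat (x + e) * R) = s q ^ nat x * (if e = 1 then s q else 1) * R"
    by (simp only: mult.assoc[symmetric])
  thus ?thesis unfolding 1 2 by (simp only: mult_ac)
qed

lemma prod_idx: "(\<Prod>\<iota>\<in>idx n r. f \<iota>) = (\<Prod>i=1..n. \<Prod>l=1..r i. f (i, l))"
  by (simp add: idx_Sigma prod.Sigma split_def)

text \<open>All variables of block i share y_i, whose exponents add up to the positive part of the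
  generalized \<open>C\<close>-entry. The exponents of s are constant on each block except at (k,
  q), where the correcting power intervenes.\<close>

lemma exchange_monomial:
  fixes \<alpha> w :: "nat \<Rightarrow> int" and e :: int and \<Phi> :: "nat \<times> nat \<Rightarrow> pol"
  assumes e: "e = 1 \<or> e = - 1" and k: "k \<in> {1..n}" and q: "q \<in> {1..r k}"
  defines "c \<iota> \<equiv> \<alpha> (fst \<iota>) + (if \<iota> = (k, q) then e else 0)"
  shows "Var (S (k, q)) ^ (if e * \<alpha> k < 0 then 1 else 0) *
      (\<Prod>\<iota>\<in>idx n r. sy \<iota> ^ nat (c \<iota>) * \<Phi> \<iota> ^ nat (w (fst \<iota>))) =
    (\<Prod>i=1..n. elem_sym r (i, r i) ^ nat (\<alpha> i) * Var (Y i) ^ nat (int (r i) * \<alpha> i + (if i = k then e else 0)) *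
       (\<Prod>l=1..r i. \<Phi> (i, l)) ^ nat (w i)) * (if e = 1 then Var (S (k, q)) else 1)"
proof -
  define s where "s i = (\<Prod>l=1..r i. Var (S (i, l)) ^ nat (c (i, l)))" for i
  have Yexp: "(\<Sum>l=1..r i. nat (c (i, l))) = nat (int (r i) * \<alpha> i + (if i = k then e else 0))" for i
  proof (cases "i = k")
    case True
    have "(\<Sum>l=1..r k. nat (c (k, l))) = (\<Sum>l=1..r k. nat (\<alpha> k + (if l = q then e else 0)))"
      by (simp add: c_def)
    thus ?thesis using sum_nat_shifted[OF e q] True by simp
  next
    case False
    thus ?thesis by (simp add: c_def nat_mult_distrib)
  qed
  have "(\<Prod>l=1..r i. sy (i, l) ^ nat (c (i, l)) * \<Phi> (i, l) ^ nat (w i)) =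
      s i * (Var (Y i) ^ nat (int (r i) * \<alpha> i + (if i = k then e else 0)) * (\<Prod>l=1..r i. \<Phi> (i, l)) ^ nat (w i))" for i
    unfolding Yexp[symmetric] power_sum sy_def s_def
    by (simp add: power_mult_distrib prod.distrib prod_power_distrib mult.assoc)
  hence split: "(\<Prod>\<iota>\<in>idx n r. sy \<iota> ^ nat (c \<iota>) * \<Phi> \<iota> ^ nat (w (fst \<iota>))) =
    (\<Prod>i=1..n. s i) * (\<Prod>i=1..n. Var (Y i) ^ nat (int (r i) * \<alpha> i + (if i = k then e else 0)) * (\<Prod>l=1..r i. \<Phi> (i, l)) ^ nat (w i))"
    unfolding prod_idx fst_conv by (simp only: prod.distrib[of s, symmetric])
  have sk: "Var (S (k, q)) ^ (if e * \<alpha> k < 0 then 1 else 0) * s k =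
      elem_sym r (k, r k) ^ nat (\<alpha> k) * (if e = 1 then Var (S (k, q)) else 1)"
    unfolding elem_sym_top s_def
    using prod_shifted_power[OF e q, of "\<lambda>l. Var (S (k, l))" "\<alpha> k"] by (simp add: c_def)
  have s: "s i = elem_sym r (i, r i) ^ nat (\<alpha> i)" if "i \<noteq> k" for i
    using that by (simp add: s_def c_def elem_sym_top prod_power_distrib)
  have "Var (S (k, q)) ^ (if e * \<alpha> k < 0 then 1 else 0) * (\<Prod>i=1..n. s i) =
      (Var (S (k, q)) ^ (if e * \<alpha> k < 0 then 1 else 0) * s k) * (\<Prod>i\<in>{1..n} - {k}. s i)"
    using k by (subst prod.remove[of _ k]) (auto simp: mult.assoc)
  also have "\<dots> = (elem_sym r (k, r k) ^ nat (\<alpha> k) * (\<Prod>i\<in>{1..n} - {k}. elem_sym r (i, r i) ^ nat (\<alpha> i))) *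
      (if e = 1 then Var (S (k, q)) else 1)"
    unfolding sk by (subst prod.cong[OF refl s]) (simp_all only: Diff_iff singleton_iff simp_thms mult_ac)
  also have "elem_sym r (k, r k) ^ nat (\<alpha> k) * (\<Prod>i\<in>{1..n} - {k}. elem_sym r (i, r i) ^ nat (\<alpha> i)) =
      (\<Prod>i=1..n. elem_sym r (i, r i) ^ nat (\<alpha> i))"
    using k by (subst prod.remove[of _ k]) auto
  finally have fin: "Var (S (k, q)) ^ (if e * \<alpha> k < 0 then 1 else 0) * (\<Prod>i=1..n. s i) =
      (\<Prod>i=1..n. elem_sym r (i, r i) ^ nat (\<alpha> i)) * (if e = 1 then Var (S (k, q)) else 1)" .
  define R where "R = (\<Prod>i=1..n. Var (Y i) ^ nat (int (r i) * \<alpha> i + (if i = k then e else 0)) * (\<Prod>l=1..r i. \<Phi> (i, l)) ^ nat (w i))"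
  have "(\<Prod>i=1..n. elem_sym r (i, r i) ^ nat (\<alpha> i) * Var (Y i) ^ nat (int (r i) * \<alpha> i + (if i = k then e else 0)) *
      (\<Prod>l=1..r i. \<Phi> (i, l)) ^ nat (w i)) = (\<Prod>i=1..n. elem_sym r (i, r i) ^ nat (\<alpha> i)) * R"
    by (simp only: R_def mult.assoc prod.distrib)
  moreover have "Var (S (k, q)) ^ (if e * \<alpha> k < 0 then 1 else 0) * ((\<Prod>i=1..n. s i) * R) =
      (\<Prod>i=1..n. elem_sym r (i, r i) ^ nat (\<alpha> i)) * R * (if e = 1 then Var (S (k, q)) else 1)"
    unfolding mult.assoc[symmetric] fin by (simp only: mult_ac)
  ultimately show ?thesis unfolding split R_def[symmetric] by (simp only:)
qed

section \<open>Block products\<close>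

lemma eval_Yt_mult: "eval_Yt (p * q) w = eval_Yt p w * eval_Yt q w"
  by (simp add: eval_Yt_def)

definition block_F :: "(nat \<Rightarrow> nat) \<Rightarrow> (nat \<times> nat \<Rightarrow> pol) \<Rightarrow> nat \<Rightarrow> pol" where
  "block_F r F i = (\<Prod>l=1..r i. eval_Yt (F (i, l)) sy)"

text \<open>The interface to a block mutation, with \<open>w\<close> and \<alpha> standing for
  column k: positivity, equivariance and specialization all propagate through these
  relations.\<close>

definition composite_exchange ::
  "nat \<Rightarrow> (nat \<Rightarrow> nat) \<Rightarrow> nat \<Rightarrow> (nat \<Rightarrow> int) \<Rightarrow> (nat \<Rightarrow> int) \<Rightarrow> int \<Rightarrow> (nat \<times> nat \<Rightarrow> pol) \<Rightarrow> (nat \<times> nat \<Rightarrow> pol) \<Rightarrow> bool" where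
  "composite_exchange n r k w \<alpha> e F F' \<longleftrightarrow>
    (\<forall>\<nu>\<in>idx n r. fst \<nu> \<noteq> k \<longrightarrow> F' \<nu> = F \<nu>) \<and>
    (\<forall>q\<in>{1..r k}. F' (k, q) * F (k, q) =
      (\<Prod>\<iota>\<in>idx n r. Var (Yt \<iota>) ^ nat (- (\<alpha> (fst \<iota>) + (if \<iota> = (k, q) then e else 0))) * F \<iota> ^ nat (- w (fst \<iota>))) +
      (\<Prod>\<iota>\<in>idx n r. Var (Yt \<iota>) ^ nat (\<alpha> (fst \<iota>) + (if \<iota> = (k, q) then e else 0)) * F \<iota> ^ nat (w (fst \<iota>))))"

lemma block_F_exchange:
  assumes e: "e = 1 \<or> e = - 1" and k: "k \<in> {1..n}"
    and ex: "composite_exchange n r k w \<alpha> e F F'"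
  shows "elem_sym r (k, r k) ^ (if e * \<alpha> k < 0 then 1 else 0) * (block_F r F' k * block_F r F k) =
    homog e (\<lambda>m. elem_sym r (k, m)) (r k)
      (\<Prod>i=1..n. elem_sym r (i, r i) ^ nat (- \<alpha> i) * Var (Y i) ^ nat (- (int (r i) * \<alpha> i + (if i = k then e else 0))) *
         block_F r F i ^ nat (- w i))
      (\<Prod>i=1..n. elem_sym r (i, r i) ^ nat (\<alpha> i) * Var (Y i) ^ nat (int (r i) * \<alpha> i + (if i = k then e else 0)) *
         block_F r F i ^ nat (w i))"
    (is "_ = homog e _ _ ?A ?B")
proof -
  define h :: nat where "h = (if e * \<alpha> k < 0 then 1 else 0)"
  define \<Phi> where "\<Phi> \<iota> = eval_Yt (F \<iota>) sy" for \<iota>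
  have factor: "Var (S (k, q)) ^ h * (eval_Yt (F' (k, q)) sy * eval_Yt (F (k, q)) sy) =
      ?A * (if - e = 1 then Var (S (k, q)) else 1) + ?B * (if e = 1 then Var (S (k, q)) else 1)"
    if q: "q \<in> {1..r k}" for q
  proof -
    \<comment> \<open>Negating \<alpha> and e together turns one exchange monomial into the other
      and preserves the sign of e \<alpha>_k, so a single power h corrects both.\<close>
    have neg: "- \<alpha> (fst \<iota>) + (if \<iota> = (k, q) then - e else 0) = - (\<alpha> (fst \<iota>) + (if \<iota> = (k, q) then e else 0))" for \<iota>
      by simp
    have neg': "int (r i) * - \<alpha> i + (if i = k then - e else 0) = - (int (r i) * \<alpha> i + (if i = k then e else 0))" for i
      by simp
    have "Var (S (k, q)) ^ h * (\<Prod>\<iota>\<in>idx n r. sy \<iota> ^ nat (- (\<alpha> (fst \<iota>) + (if \<iota> = (k, q) then e else 0))) * \<Phi> \<iota> ^ nat (- w (fst \<iota>))) =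
        ?A * (if - e = 1 then Var (S (k, q)) else 1)"
      using exchange_monomial[of "- e" k n q r "\<lambda>i. - \<alpha> i" \<Phi> "\<lambda>i. - w i", unfolded neg neg'] e k q
      by (simp only: minus_minus minus_mult_minus h_def \<Phi>_def block_F_def) auto
    moreover have "Var (S (k, q)) ^ h * (\<Prod>\<iota>\<in>idx n r. sy \<iota> ^ nat (\<alpha> (fst \<iota>) + (if \<iota> = (k, q) then e else 0)) * \<Phi> \<iota> ^ nat (w (fst \<iota>))) =
        ?B * (if e = 1 then Var (S (k, q)) else 1)"
      using exchange_monomial[of e k n q r \<alpha> \<Phi> w, OF e k q] by (simp only: h_def \<Phi>_def block_F_def)
    moreover have "eval_Yt (F' (k, q)) sy * eval_Yt (F (k, q)) sy =
      (\<Prod>\<iota>\<in>idx n r. sy \<iota> ^ nat (- (\<alpha> (fst \<iota>) + (if \<iota> = (k, q) then e else 0))) * \<Phi> \<iota> ^ nat (- w (fst \<iota>))) +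
      (\<Prod>\<iota>\<in>idx n r. sy \<iota> ^ nat (\<alpha> (fst \<iota>) + (if \<iota> = (k, q) then e else 0)) * \<Phi> \<iota> ^ nat (w (fst \<iota>)))"
    proof -
      have "F' (k, q) * F (k, q) =
      (\<Prod>\<iota>\<in>idx n r. Var (Yt \<iota>) ^ nat (- (\<alpha> (fst \<iota>) + (if \<iota> = (k, q) then e else 0))) * F \<iota> ^ nat (- w (fst \<iota>))) +
      (\<Prod>\<iota>\<in>idx n r. Var (Yt \<iota>) ^ nat (\<alpha> (fst \<iota>) + (if \<iota> = (k, q) then e else 0)) * F \<iota> ^ nat (w (fst \<iota>)))"
        using ex q unfolding composite_exchange_def by blast
      thus ?thesis unfolding eval_Yt_mult[symmetric] \<Phi>_def
        by (simp only: eval_Yt_def subst_add subst_prod subst_mult subst_power subst_Var fvar.case)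
    qed
    ultimately show ?thesis by (simp only: distrib_left)
  qed
  have "elem_sym r (k, r k) ^ h * (block_F r F' k * block_F r F k) =
      (\<Prod>q=1..r k. Var (S (k, q)) ^ h * (eval_Yt (F' (k, q)) sy * eval_Yt (F (k, q)) sy))"
    by (simp only: elem_sym_top block_F_def prod.distrib prod_power_distrib)
  also have "\<dots> = (\<Prod>q=1..r k. ?A * (if - e = 1 then Var (S (k, q)) else 1) + ?B * (if e = 1 then Var (S (k, q)) else 1))"
    by (intro prod.cong refl factor)
  also have "\<dots> = homog e (\<lambda>m. elem_sym r (k, m)) (r k) ?A ?B"
    by (rule prod_linear_factors[OF e])
  finally show ?thesis unfolding h_def .
qed

text \<open>Knowing Z away from 0 suffices, because it is evaluated at a quotient of nonzero
  polynomials. The r-th power of the denominator then homogenizes it.\<close>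

lemma generalized_exchange:
  fixes C b :: "nat \<Rightarrow> int" and F :: "nat \<Rightarrow> pol"
  assumes F: "\<forall>j\<in>{1..n}. F j \<noteq> 0" and k: "k \<in> {1..n}"
    and Zp: "\<And>u. u \<noteq> 0 \<Longrightarrow> poly Zp u = homog e (\<lambda>m. to_fract (\<zeta> m)) r 1 u"
    and F': "to_fract F' = inverse (to_fract (F k))
          * (\<Prod>j=1..n. rvar (Y j) powi [- C j]\<^sub>+ * to_fract (F j) powi [- b j]\<^sub>+) ^ r
          * poly Zp (\<Prod>j=1..n. rvar (Y j) powi C j * to_fract (F j) powi b j)"
  shows "F' * F k = homog e \<zeta> r (\<Prod>j=1..n. Var (Y j) ^ nat (- C j) * F j ^ nat (- b j))
      (\<Prod>j=1..n. Var (Y j) ^ nat (C j) * F j ^ nat (b j))"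
proof -
  define A where "A = (\<Prod>j=1..n. Var (Y j) ^ nat (- C j) * F j ^ nat (- b j))"
  define B where "B = (\<Prod>j=1..n. Var (Y j) ^ nat (C j) * F j ^ nat (b j))"
  note quot = prod_powi_eq_quotient[where I = "{1..n}" and f = F and x = Y and c = C and b = b,
      OF finite_atLeastAtMost F, folded A_def B_def]
  have "to_fract F' = inverse (to_fract (F k)) * to_fract A ^ r * poly Zp (to_fract B / to_fract A)"
    unfolding F' quot(1,2) ..
  also have "poly Zp (to_fract B / to_fract A) = homog e (\<lambda>m. to_fract (\<zeta> m)) r 1 (to_fract B / to_fract A)"
    using quot(3,4) by (intro Zp) simp
  also have "inverse (to_fract (F k)) * to_fract A ^ r * \<dots> =
      inverse (to_fract (F k)) * to_fract (homog e \<zeta> r A B)"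
    unfolding mult.assoc to_fract_homog using quot(4) by (subst homog_dehomogenize) simp_all
  finally have "to_fract (F' * F k) = to_fract (homog e \<zeta> r A B)"
    using F k by simp
  thus ?thesis by (simp only: to_fract_eq_iff A_def B_def)
qed

section \<open>Positivity at one\<close>

text \<open>A certificate of nonvanishing that passes through sums, products and exact quotients.
  Positivity of coefficients would not: (1 + x^3) / (1 + x) = 1 - x + x^2.\<close>

definition pos_at_1 :: "pol \<Rightarrow> bool" where
  "pos_at_1 p \<longleftrightarrow> (\<exists>c>0. subst (\<lambda>_. 1) p = of_int c)"

lemma pos_at_1_1 [simp]: "pos_at_1 1"
  unfolding pos_at_1_def by (intro exI[of _ 1]) simp

lemma pos_at_1_Var [simp]: "pos_at_1 (Var x)"
  unfolding pos_at_1_def by (intro exI[of _ 1]) simp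

lemma pos_at_1_add: "pos_at_1 p \<Longrightarrow> pos_at_1 q \<Longrightarrow> pos_at_1 (p + q)"
  unfolding pos_at_1_def by (metis add_pos_pos of_int_add subst_add)

lemma pos_at_1_mult: "pos_at_1 p \<Longrightarrow> pos_at_1 q \<Longrightarrow> pos_at_1 (p * q)"
  unfolding pos_at_1_def by (metis mult_pos_pos of_int_mult subst_mult)

lemma pos_at_1_power: "pos_at_1 p \<Longrightarrow> pos_at_1 (p ^ m)"
  by (induction m) (simp_all add: pos_at_1_mult)

lemma pos_at_1_prod: "(\<And>x. x \<in> A \<Longrightarrow> pos_at_1 (f x)) \<Longrightarrow> pos_at_1 (\<Prod>x\<in>A. f x)"
  by (induction A rule: infinite_finite_induct) (simp_all add: pos_at_1_mult)

lemma pos_at_1_neq_0: "pos_at_1 p \<Longrightarrow> p \<noteq> 0"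
  by (auto simp: pos_at_1_def)

lemma pos_at_1_factor:
  assumes "pos_at_1 (p * q)" "pos_at_1 q"
  shows "pos_at_1 p"
proof -
  obtain c d where cd: "c > 0" "d > 0" "subst (\<lambda>_. 1) (p * q) = of_int c" "subst (\<lambda>_. 1) q = of_int d"
    using assms by (auto simp: pos_at_1_def)
  obtain a where a: "subst (\<lambda>_. 1) p = of_int a" using subst_one_eq_of_int by blast
  have "(of_int (a * d) :: pol) = of_int c" using cd a by simp
  hence "a * d = c" by (simp only: of_int_eq_iff)
  hence "a > 0" using cd by (metis zero_less_mult_pos2)
  thus ?thesis using a by (auto simp: pos_at_1_def)
qed

lemma pos_at_1_exchange:
  assumes ex: "composite_exchange n r k w \<alpha> e F F'" and k: "k \<in> {1..n}"
    and F: "\<And>\<iota>. \<iota> \<in> idx n r \<Longrightarrow> pos_at_1 (F \<iota>)" and \<nu>: "\<nu> \<in> idx n r"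
  shows "pos_at_1 (F' \<nu>)"
proof (cases "fst \<nu> = k")
  case False
  thus ?thesis using ex F[OF \<nu>] \<nu> by (simp add: composite_exchange_def)
next
  case True
  then obtain q where q: "\<nu> = (k, q)" "q \<in> {1..r k}" using \<nu> by (cases \<nu>) (auto simp: idx_def)
  have "F' \<nu> * F \<nu> =
      (\<Prod>\<iota>\<in>idx n r. Var (Yt \<iota>) ^ nat (- (\<alpha> (fst \<iota>) + (if \<iota> = (k, q) then e else 0))) * F \<iota> ^ nat (- w (fst \<iota>))) +
      (\<Prod>\<iota>\<in>idx n r. Var (Yt \<iota>) ^ nat (\<alpha> (fst \<iota>) + (if \<iota> = (k, q) then e else 0)) * F \<iota> ^ nat (w (fst \<iota>)))"
    using ex q unfolding composite_exchange_def by blast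
  also have "pos_at_1 \<dots>"
    by (intro pos_at_1_add pos_at_1_prod pos_at_1_mult pos_at_1_power pos_at_1_Var F)
  finally show ?thesis using F[OF \<nu>] by (rule pos_at_1_factor)
qed

section \<open>Equivariance under permutations within a block\<close>

definition rename_Yt :: "(nat \<times> nat \<Rightarrow> nat \<times> nat) \<Rightarrow> fvar \<Rightarrow> fvar" where
  "rename_Yt \<sigma> x = (case x of Yt \<iota> \<Rightarrow> Yt (\<sigma> \<iota>) | _ \<Rightarrow> x)"

text \<open>If the swap moves \<iota>, this relates two polynomials of a block; if it fixes \<iota>,
  it says that \<open>F \<iota>\<close> is invariant under the swap of variables.\<close>

definition equivariant :: "nat \<Rightarrow> (nat \<Rightarrow> nat) \<Rightarrow> (nat \<times> nat \<Rightarrow> pol) \<Rightarrow> bool" where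
  "equivariant n r F \<longleftrightarrow> (\<forall>j\<in>{1..n}. \<forall>l\<in>{1..r j}. \<forall>m\<in>{1..r j}. \<forall>\<iota>\<in>idx n r.
     F (swap j l m \<iota>) = subst (\<lambda>x. Var (rename_Yt (swap j l m) x)) (F \<iota>))"

lemma fst_swap [simp]: "fst (swap j l m \<iota>) = fst \<iota>"
  by (auto simp: Transposition.transpose_def)

lemma swap_in_idx:
  assumes "j \<in> {1..n}" "l \<in> {1..r j}" "m \<in> {1..r j}"
  shows "swap j l m \<iota> \<in> idx n r \<longleftrightarrow> \<iota> \<in> idx n r"
  using assms by (auto simp: Transposition.transpose_def idx_def)

lemma bij_betw_swap_idx:
  assumes "j \<in> {1..n}" "l \<in> {1..r j}" "m \<in> {1..r j}"
  shows "bij_betw (swap j l m) (idx n r) (idx n r)"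
  by (rule bij_betw_byWitness[where f' = "swap j l m"])
     (use swap_in_idx[of j n l r m] assms in auto)

lemma swap_eq_iff: "swap j l m \<iota> = swap j l m \<nu> \<longleftrightarrow> \<iota> = \<nu>"
  by (metis transpose_involutory)

text \<open>The exponents depend only on blocks, apart from the extra e at \<nu>, which moves along
  with the swap. Reindexing the products gives equivariance of F' F, and the factor F is
  cancelled.\<close>

lemma equivariant_exchange:
  assumes ex: "composite_exchange n r k w \<alpha> e F F'" and k: "k \<in> {1..n}"
    and F: "\<And>\<iota>. \<iota> \<in> idx n r \<Longrightarrow> F \<iota> \<noteq> 0"
    and eqv: "equivariant n r F"
  shows "equivariant n r F'"
  unfolding equivariant_def
proof (intro ballI)
  fix j l m \<iota> assume jlm: "j \<in> {1..n}" "l \<in> {1..r j}" "m \<in> {1..r j}" and \<iota>: "\<iota> \<in> idx n r"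
  define \<tau> where "\<tau> = swap j l m"
  define \<rho> where "\<rho> = subst (\<lambda>x. Var (rename_Yt \<tau> x))"
  have \<tau>: "\<tau> \<iota> \<in> idx n r \<longleftrightarrow> \<iota> \<in> idx n r" "fst (\<tau> \<iota>) = fst \<iota>" "\<tau> \<iota> = \<tau> \<nu> \<longleftrightarrow> \<iota> = \<nu>" for \<iota> \<nu>
    unfolding \<tau>_def by (simp_all add: swap_in_idx[of j n l r m, OF jlm] swap_eq_iff)
  have F\<tau>: "F (\<tau> \<iota>) = \<rho> (F \<iota>)" if "\<iota> \<in> idx n r" for \<iota>
    using eqv jlm that unfolding equivariant_def \<tau>_def \<rho>_def by blast
  have \<rho>Yt: "\<rho> (Var (Yt \<iota>)) = Var (Yt (\<tau> \<iota>))" for \<iota>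
    by (simp add: \<rho>_def rename_Yt_def)
  show "F' (swap j l m \<iota>) = subst (\<lambda>x. Var (rename_Yt (swap j l m) x)) (F' \<iota>)"
    unfolding \<tau>_def[symmetric] \<rho>_def[symmetric]
  proof (cases "fst \<iota> = k")
    case False
    thus "F' (\<tau> \<iota>) = \<rho> (F' \<iota>)"
      using ex F\<tau>[OF \<iota>] \<iota> \<tau> by (simp add: composite_exchange_def)
  next
    case True
    define M where "M \<nu> s = (\<Prod>\<iota>\<in>idx n r. Var (Yt \<iota>) ^ nat (s * (\<alpha> (fst \<iota>) + (if \<iota> = \<nu> then e else 0))) * F \<iota> ^ nat (s * w (fst \<iota>)))"
      for \<nu> and s :: int
    have ex': "F' \<nu> * F \<nu> = M \<nu> (- 1) + M \<nu> 1" if \<nu>: "\<nu> \<in> idx n r" "fst \<nu> = k" for \<nu>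
    proof -
      obtain q where q: "\<nu> = (k, q)" "q \<in> {1..r k}" using \<nu> by (cases \<nu>) (auto simp: idx_def)
      show ?thesis using ex q unfolding composite_exchange_def M_def q by simp
    qed
    have M: "M (\<tau> \<iota>) s = \<rho> (M \<iota> s)" for s
    proof -
      have "M (\<tau> \<iota>) s = (\<Prod>\<iota>'\<in>idx n r. Var (Yt (\<tau> \<iota>')) ^ nat (s * (\<alpha> (fst (\<tau> \<iota>')) + (if \<tau> \<iota>' = \<tau> \<iota> then e else 0))) *
          F (\<tau> \<iota>') ^ nat (s * w (fst (\<tau> \<iota>'))))"
        unfolding M_def using bij_betw_swap_idx[of j n l r m, folded \<tau>_def] jlm
        by (intro prod.reindex_bij_betw[symmetric]) simp
      also have "\<dots> = (\<Prod>\<iota>'\<in>idx n r. \<rho> (Var (Yt \<iota>')) ^ nat (s * (\<alpha> (fst \<iota>') + (if \<iota>' = \<iota> then e else 0))) *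
          \<rho> (F \<iota>') ^ nat (s * w (fst \<iota>')))"
        by (intro prod.cong refl) (simp add: \<tau> F\<tau> \<rho>Yt)
      also have "\<dots> = \<rho> (M \<iota> s)"
        by (simp only: M_def \<rho>_def subst_prod subst_mult subst_power)
      finally show ?thesis .
    qed
    have "F' (\<tau> \<iota>) * F (\<tau> \<iota>) = \<rho> (F' \<iota> * F \<iota>)"
      using ex'[of "\<tau> \<iota>"] ex'[of \<iota>] \<tau> \<iota> True M by (simp add: \<rho>_def)
    also have "\<dots> = \<rho> (F' \<iota>) * F (\<tau> \<iota>)"
      using F\<tau>[OF \<iota>] by (simp add: \<rho>_def)
    finally show "F' (\<tau> \<iota>) = \<rho> (F' \<iota>)"
      using F[of "\<tau> \<iota>"] \<tau> \<iota> by simp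
  qed
qed

text \<open>For \<iota> = (i, l0) and the swap with (i, m) this matches the m-th factors of the two
  products in the theorem.\<close>

lemma eval_Yt_swap:
  assumes "equivariant n r F" "j \<in> {1..n}" "l \<in> {1..r j}" "m \<in> {1..r j}" "\<iota> \<in> idx n r"
  shows "eval_Yt (F (swap j l m \<iota>)) sy = eval_Yt (F \<iota>) (permute_tuple sy (swap j l m))"
proof -
  have "F (swap j l m \<iota>) = subst (\<lambda>x. Var (rename_Yt (swap j l m) x)) (F \<iota>)"
    using assms by (simp add: equivariant_def)
  thus ?thesis unfolding eval_Yt_def
    by (auto simp: subst_subst rename_Yt_def permute_tuple_def split: fvar.splits intro!: arg_cong2[where f = subst])
qed

text \<open>The entries of \<open>sy\<close> in a block share their y, so swapping two s-variables
  is swapping two entries of the tuple. By equivariance this permutes the factors if j = i and fixes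
  each of them otherwise.\<close>

lemma block_symmetric_block_F:
  assumes eqv: "equivariant n r F" and ind: "\<And>\<iota>. \<iota> \<in> idx n r \<Longrightarrow> indets (F \<iota>) \<subseteq> Yt ` idx n r"
    and i: "i \<in> {1..n}"
  shows "block_symmetric n r (block_F r F i)"
  unfolding block_symmetric_def
proof (intro ballI)
  fix j l m assume jlm: "j \<in> {1..n}" "l \<in> {1..r j}" "m \<in> {1..r j}"
  define \<tau> where "\<tau> = swap j l m"
  have "subst (\<lambda>x. Var (rename_S \<tau> x)) (eval_Yt (F \<iota>) sy) = eval_Yt (F (\<tau> \<iota>)) sy"
    if \<iota>: "\<iota> \<in> idx n r" for \<iota>
  proof -
    have "subst (\<lambda>x. Var (rename_S \<tau> x)) (eval_Yt (F \<iota>) sy) = eval_Yt (F \<iota>) (permute_tuple sy \<tau>)"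
      unfolding eval_Yt_def subst_subst
    proof (rule subst_cong)
      fix x assume "x \<in> indets (F \<iota>)"
      then obtain a b where "x = Yt (a, b)" using ind[OF \<iota>] by auto
      moreover have "fst (\<tau> (a, b)) = a" by (simp add: \<tau>_def)
      ultimately show "subst (\<lambda>x. Var (rename_S \<tau> x)) (case x of Yt \<iota> \<Rightarrow> sy \<iota> | _ \<Rightarrow> Var x) =
          (case x of Yt \<iota> \<Rightarrow> permute_tuple sy \<tau> \<iota> | _ \<Rightarrow> Var x)"
        by (cases "\<tau> (a, b)") (simp add: sy_def permute_tuple_def rename_S_def)
    qed
    also have "\<dots> = eval_Yt (F (\<tau> \<iota>)) sy"
      unfolding \<tau>_def by (rule eval_Yt_swap[symmetric]) (use eqv jlm \<iota> in auto)
    finally show ?thesis .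
  qed
  hence "subst (\<lambda>x. Var (rename_S \<tau> x)) (block_F r F i) = (\<Prod>q=1..r i. eval_Yt (F (\<tau> (i, q))) sy)"
    using i by (simp add: block_F_def idx_def)
  also have "\<dots> = (\<Prod>q=1..r i. eval_Yt (F (i, q)) sy)"
  proof (cases "i = j")
    case True
    have "\<tau> (i, q) = (i, transpose l m q)" for q
      unfolding \<tau>_def True by (auto simp: Transposition.transpose_def)
    moreover have "bij_betw (transpose l m) {1..r i} {1..r i}"
      by (rule bij_betw_byWitness[where f' = "transpose l m"])
         (use jlm True in \<open>auto simp: Transposition.transpose_def\<close>)
    ultimately show ?thesis
      using prod.reindex_bij_betw[of "transpose l m" "{1..r i}" "{1..r i}" "\<lambda>q. eval_Yt (F (i, q)) sy"] by simp
  next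
    case False
    hence "\<tau> (i, q) = (i, q)" for q by (simp add: \<tau>_def Transposition.transpose_def)
    thus ?thesis by simp
  qed
  finally show "subst (\<lambda>x. Var (rename_S (swap j l m) x)) (block_F r F i) = block_F r F i"
    by (simp add: \<tau>_def block_F_def)
qed

lemma indets_block_F:
  assumes ind: "\<And>\<iota>. \<iota> \<in> idx n r \<Longrightarrow> indets (F \<iota>) \<subseteq> Yt ` idx n r" and i: "i \<in> {1..n}"
  shows "indets (block_F r F i) \<subseteq> Y ` {1..n} \<union> S ` idx n r"
  unfolding block_F_def eval_Yt_def
proof (intro indets_prod indets_subst)
  fix l x assume "l \<in> {1..r i}" "x \<in> indets (F (i, l))"
  with ind[of "(i, l)"] i obtain a b where "x = Yt (a, b)" "(a, b) \<in> idx n r" by (auto simp: idx_def)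
  moreover from this have "indets (Var (S (a, b)) * Var (Y a)) \<subseteq> Y ` {1..n} \<union> S ` idx n r"
    by (intro indets_mult) (auto simp: idx_def)
  ultimately show "indets (case x of Yt \<iota> \<Rightarrow> sy \<iota> | _ \<Rightarrow> Var x) \<subseteq> Y ` {1..n} \<union> S ` idx n r"
    by (simp add: sy_def)
qed

section \<open>Specialization at \<open>e = z\<close>\<close>

definition z_map :: "(nat \<Rightarrow> nat) \<Rightarrow> fvar \<Rightarrow> pol" where
  "z_map r = (\<lambda>x. case x of E (j, m) \<Rightarrow> if m = r j then 1 else Var (Z (j, m)) | _ \<Rightarrow> Var x)"

lemma z_map_E: "z_map r (E (i, r i)) = 1"
  by (simp add: z_map_def)

lemma z_map_Y: "z_map r (Y i) = Var (Y i)"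
  by (simp add: z_map_def)

lemma e_map_E: "e_map r (E \<iota>) = elem_sym r \<iota>"
  by (simp add: e_map_def)

lemma e_map_Y: "e_map r (Y i) = Var (Y i)"
  by (simp add: e_map_def)

text \<open>The coefficients of the initial polynomial of k, which are also the values of e_m at e =
  z.\<close>

definition z_coeff :: "(nat \<Rightarrow> nat) \<Rightarrow> nat \<Rightarrow> nat \<Rightarrow> pol" where
  "z_coeff r k m = (if m = 0 \<or> m = r k then 1 else Var (Z (k, m)))"

lemma at_e_eq_z_expand_e:
  assumes "indets Q \<subseteq> evars n r"
  shows "at_e_eq_z n r (expand_e r Q) = subst (z_map r) Q"
  unfolding at_e_eq_z_def z_map_def in_e_eqI[OF assms refl] ..

lemma at_e_eq_z_1: "at_e_eq_z n r 1 = 1"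
  using at_e_eq_z_expand_e[of 1 n r] by (simp add: expand_e_alt)

lemma block_F_in_elementary:
  assumes "equivariant n r F" "\<And>\<iota>. \<iota> \<in> idx n r \<Longrightarrow> indets (F \<iota>) \<subseteq> Yt ` idx n r" "i \<in> {1..n}"
  shows "\<exists>Q. indets Q \<subseteq> evars n r \<and> expand_e r Q = block_F r F i"
proof (rule symmetric_in_elementary)
  show "indets (block_F r F i) \<subseteq> Y ` {1..n} \<union> S ` idx n r"
    using assms(2,3) by (rule indets_block_F)
  show "block_symmetric n r (block_F r F i)"
    using assms by (rule block_symmetric_block_F)
qed blast

text \<open>Setting e = z makes no sense on polynomials in s. The relation is therefore first lifted
  to y and e by injectivity of \<open>expand_e\<close>; there the specialization is a ring
  homomorphism sending the correcting power of e_r to 1.\<close>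

lemma at_e_eq_z_exchange:
  assumes e: "e = 1 \<or> e = - 1" and k: "k \<in> {1..n}" and r: "\<And>i. i \<in> {1..n} \<Longrightarrow> r i \<ge> 1"
    and ex: "composite_exchange n r k w \<alpha> e F F'"
    and F: "equivariant n r F" "\<And>\<iota>. \<iota> \<in> idx n r \<Longrightarrow> indets (F \<iota>) \<subseteq> Yt ` idx n r"
    and F': "equivariant n r F'" "\<And>\<iota>. \<iota> \<in> idx n r \<Longrightarrow> indets (F' \<iota>) \<subseteq> Yt ` idx n r"
  shows "at_e_eq_z n r (block_F r F' k) * at_e_eq_z n r (block_F r F k) =
    homog e (z_coeff r k) (r k)
      (\<Prod>i=1..n. Var (Y i) ^ nat (- (int (r i) * \<alpha> i + (if i = k then e else 0))) *
         at_e_eq_z n r (block_F r F i) ^ nat (- w i))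
      (\<Prod>i=1..n. Var (Y i) ^ nat (int (r i) * \<alpha> i + (if i = k then e else 0)) *
         at_e_eq_z n r (block_F r F i) ^ nat (w i))"
proof -
  define h :: nat where "h = (if e * \<alpha> k < 0 then 1 else 0)"
  have "\<forall>i\<in>{1..n}. \<exists>Q. indets Q \<subseteq> evars n r \<and> expand_e r Q = block_F r F i"
    using block_F_in_elementary[OF F] by (intro ballI)
  from bchoice[OF this] obtain Q where Q: "\<And>i. i \<in> {1..n} \<Longrightarrow> indets (Q i) \<subseteq> evars n r"
    "\<And>i. i \<in> {1..n} \<Longrightarrow> expand_e r (Q i) = block_F r F i" by blast
  obtain Q' where Q': "indets Q' \<subseteq> evars n r" "expand_e r Q' = block_F r F' k"
    using block_F_in_elementary[OF F' k] by auto
  \<comment> \<open>The variables E (k, m) of \<open>evars\<close> start at m = 1; e_0 is the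
    constant 1.\<close>
  define \<epsilon> where "\<epsilon> m = (if m = 0 then 1 else Var (E (k, m)))" for m
  define A where "A = (\<Prod>i=1..n. Var (E (i, r i)) ^ nat (- \<alpha> i) *
      Var (Y i) ^ nat (- (int (r i) * \<alpha> i + (if i = k then e else 0))) * Q i ^ nat (- w i))"
  define B where "B = (\<Prod>i=1..n. Var (E (i, r i)) ^ nat (\<alpha> i) *
      Var (Y i) ^ nat (int (r i) * \<alpha> i + (if i = k then e else 0)) * Q i ^ nat (w i))"
  have Ei: "indets (Var (E (i, r i))) \<subseteq> evars n r" "indets (Var (Y i)) \<subseteq> evars n r" if "i \<in> {1..n}" for i
    using r[OF that] that by (auto simp: evars_def idx_def)
  have \<epsilon>: "indets (\<epsilon> m) \<subseteq> evars n r" if "m \<le> r k" for m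
    using that k by (auto simp: \<epsilon>_def evars_def idx_def)
  have AB: "indets A \<subseteq> evars n r" "indets B \<subseteq> evars n r"
    unfolding A_def B_def by (intro indets_prod indets_mult indets_power Ei Q(1), assumption+)+
  have A: "expand_e r A = (\<Prod>i=1..n. elem_sym r (i, r i) ^ nat (- \<alpha> i) *
      Var (Y i) ^ nat (- (int (r i) * \<alpha> i + (if i = k then e else 0))) * block_F r F i ^ nat (- w i))"
    unfolding A_def expand_e_alt subst_prod subst_mult subst_power subst_Var
    by (rule prod.cong[OF refl]) (simp only: Q(2)[unfolded expand_e_alt] e_map_E e_map_Y)
  have B: "expand_e r B = (\<Prod>i=1..n. elem_sym r (i, r i) ^ nat (\<alpha> i) *
      Var (Y i) ^ nat (int (r i) * \<alpha> i + (if i = k then e else 0)) * block_F r F i ^ nat (w i))"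
    unfolding B_def expand_e_alt subst_prod subst_mult subst_power subst_Var
    by (rule prod.cong[OF refl]) (simp only: Q(2)[unfolded expand_e_alt] e_map_E e_map_Y)
  have \<epsilon>e: "expand_e r (\<epsilon> m) = elem_sym r (k, m)" for m
    by (simp add: expand_e_alt \<epsilon>_def e_map_def)
  have "expand_e r (Var (E (k, r k)) ^ h * (Q' * Q k)) =
      elem_sym r (k, r k) ^ h * (block_F r F' k * block_F r F k)"
    unfolding Q(2)[OF k, symmetric] Q'(2)[symmetric]
    by (simp only: expand_e_alt subst_mult subst_power subst_Var e_map_E)
  also have "\<dots> = homog e (\<lambda>m. expand_e r (\<epsilon> m)) (r k) (expand_e r A) (expand_e r B)"
    unfolding A B \<epsilon>e h_def by (rule block_F_exchange[OF e k ex])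
  also have "\<dots> = expand_e r (homog e \<epsilon> (r k) A B)"
    by (simp only: expand_e_alt subst_homog)
  finally have eq: "expand_e r (Var (E (k, r k)) ^ h * (Q' * Q k)) = expand_e r (homog e \<epsilon> (r k) A B)" .
  have ind: "indets (Var (E (k, r k)) ^ h * (Q' * Q k)) \<subseteq> evars n r" "indets (homog e \<epsilon> (r k) A B) \<subseteq> evars n r"
  proof -
    show "indets (Var (E (k, r k)) ^ h * (Q' * Q k)) \<subseteq> evars n r"
      using k by (intro indets_mult indets_power Ei Q Q')
    show "indets (homog e \<epsilon> (r k) A B) \<subseteq> evars n r"
      unfolding homog_def
    proof (intro indets_sum indets_mult)
      fix m assume "m \<in> {..r k}"
      thus "indets (\<epsilon> m) \<subseteq> evars n r" by (intro \<epsilon>) simp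
      show "indets (if e = 1 then A ^ (r k - m) * B ^ m else A ^ m * B ^ (r k - m)) \<subseteq> evars n r"
        using AB by (cases "e = 1") (simp_all add: indets_mult indets_power)
    qed
  qed
  have specialized: "subst (z_map r) (Var (E (k, r k)) ^ h * (Q' * Q k)) = subst (z_map r) (homog e \<epsilon> (r k) A B)"
    using expand_e_inj[OF ind eq] by (rule arg_cong)
  have \<epsilon>z: "subst (z_map r) (\<epsilon> m) = z_coeff r k m" for m
    by (simp add: \<epsilon>_def z_map_def z_coeff_def)
  have R: "subst (z_map r) (Q i) = at_e_eq_z n r (block_F r F i)" if "i \<in> {1..n}" for i
    using at_e_eq_z_expand_e[OF Q(1)[OF that]] Q(2)[OF that] by simp
  have R': "subst (z_map r) Q' = at_e_eq_z n r (block_F r F' k)"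
    using at_e_eq_z_expand_e[OF Q'(1)] Q'(2) by simp
  have A: "subst (z_map r) A = (\<Prod>i=1..n. Var (Y i) ^ nat (- (int (r i) * \<alpha> i + (if i = k then e else 0))) *
         at_e_eq_z n r (block_F r F i) ^ nat (- w i))"
    unfolding A_def subst_prod subst_mult subst_power subst_Var
    by (rule prod.cong[OF refl]) (simp only: R z_map_E z_map_Y power_one mult_1_left)
  have B: "subst (z_map r) B = (\<Prod>i=1..n. Var (Y i) ^ nat (int (r i) * \<alpha> i + (if i = k then e else 0)) *
         at_e_eq_z n r (block_F r F i) ^ nat (w i))"
    unfolding B_def subst_prod subst_mult subst_power subst_Var
    by (rule prod.cong[OF refl]) (simp only: R z_map_E z_map_Y power_one mult_1_left)
  have "at_e_eq_z n r (block_F r F' k) * at_e_eq_z n r (block_F r F k) =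
      subst (z_map r) (Var (E (k, r k)) ^ h * (Q' * Q k))"
    by (simp only: subst_mult subst_power subst_Var z_map_E power_one mult_1_left R[OF k] R')
  also have "\<dots> = subst (z_map r) (homog e \<epsilon> (r k) A B)" by (rule specialized)
  finally show ?thesis unfolding subst_homog \<epsilon>z A B .
qed

text \<open>Evaluation at y = s = 1 factors through the specialization, so a vanishing specialized
  product would vanish at ones before specialization, against positivity.\<close>

lemma at_e_eq_z_block_F_neq_0:
  assumes "equivariant n r F" "\<And>\<iota>. \<iota> \<in> idx n r \<Longrightarrow> indets (F \<iota>) \<subseteq> Yt ` idx n r" "i \<in> {1..n}"
    and pos: "\<And>\<iota>. \<iota> \<in> idx n r \<Longrightarrow> pos_at_1 (F \<iota>)"
  shows "at_e_eq_z n r (block_F r F i) \<noteq> 0"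
proof
  assume zero: "at_e_eq_z n r (block_F r F i) = 0"
  obtain Q where Q: "indets Q \<subseteq> evars n r" "expand_e r Q = block_F r F i"
    using block_F_in_elementary[OF assms(1-3)] by auto
  \<comment> \<open>At s = 1 the polynomial e_m takes the value \<open>r j choose m\<close>. For m =
    \<open>r j\<close> this is 1, in agreement with \<open>z_map\<close>.\<close>
  define g :: "fvar \<Rightarrow> pol" where "g x = (case x of Z (j, m) \<Rightarrow> of_nat (r j choose m) | _ \<Rightarrow> 1)" for x
  have "subst g (subst (z_map r) Q) = subst (\<lambda>_. 1) (expand_e r Q)"
    unfolding expand_e_alt subst_subst
  proof (rule subst_cong)
    fix x assume "x \<in> indets Q"
    hence "x \<in> evars n r" using Q(1) by blast
    then consider i where "x = Y i" | j m where "x = E (j, m)" by (auto simp: evars_def)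
    thus "subst g (z_map r x) = subst (\<lambda>_. 1) (e_map r x)"
    proof cases
      case 2
      have "subst (\<lambda>_. 1) (elem_sym r (j, m)) = of_nat (r j choose m)"
        using n_subsets[of "{1..r j}" m] by (simp add: elem_sym_def)
      thus ?thesis by (simp add: 2 z_map_def e_map_def g_def)
    qed (simp add: z_map_def e_map_def g_def)
  qed
  moreover have "subst (z_map r) Q = 0"
    using zero at_e_eq_z_expand_e[OF Q(1)] Q(2) by simp
  ultimately have "subst (\<lambda>_. 1) (block_F r F i) = 0" using Q(2) by simp
  moreover have "pos_at_1 (block_F r F i)"
    unfolding block_F_def
  proof (rule pos_at_1_prod)
    fix l assume "l \<in> {1..r i}"
    hence "pos_at_1 (F (i, l))" using assms(3) by (intro pos) (simp add: idx_def)
    moreover have "subst (\<lambda>_. 1) (eval_Yt (F (i, l)) sy) = subst (\<lambda>_. 1) (F (i, l))"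
      unfolding eval_Yt_def subst_subst
      by (rule subst_cong) (simp add: sy_def split: fvar.splits prod.splits)
    ultimately show "pos_at_1 (eval_Yt (F (i, l)) sy)" by (simp add: pos_at_1_def)
  qed
  ultimately show False by (simp add: pos_at_1_def)
qed

section \<open>Comparison of the two patterns\<close>

text \<open>The composite \<open>C\<close>-matrix has the entries \<open>\<alpha>\<^sub>i\<^sub>j + e\<^sub>i \<delta>\<close> with \<open>e\<^sub>i = 1\<close> or \<open>e\<^sub>i = - 1\<close>.  The
  entries in one diagonal block of a column are therefore consecutive integers and
  have a common weak sign, so sign-coherence is not needed.\<close>

definition linked ::
  "nat \<Rightarrow> (nat \<Rightarrow> nat) \<Rightarrow> (nat \<Rightarrow> int) \<Rightarrow> (nat \<Rightarrow> nat \<Rightarrow> int) \<Rightarrow> (nat \<Rightarrow> int) \<Rightarrow>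
   (nat \<Rightarrow> nat \<Rightarrow> int) \<Rightarrow> (nat \<Rightarrow> nat \<Rightarrow> int) \<Rightarrow> (nat \<Rightarrow> pol fract poly) \<Rightarrow> (nat \<Rightarrow> pol) \<Rightarrow>
   (nat \<times> nat \<Rightarrow> nat \<times> nat \<Rightarrow> int) \<Rightarrow> (nat \<times> nat \<Rightarrow> nat \<times> nat \<Rightarrow> int) \<Rightarrow> (nat \<times> nat \<Rightarrow> pol) \<Rightarrow> bool" where
  "linked n r d \<alpha> e Bg Cg Zg Fg Bc Cc Fc \<longleftrightarrow>
     (\<forall>i\<in>{1..n}. \<forall>j\<in>{1..n}. d i * Bg i j = - (d j * Bg j i))
   \<and> (\<forall>\<iota>\<in>idx n r. \<forall>\<nu>\<in>idx n r. Bc \<iota> \<nu> = Bg (fst \<iota>) (fst \<nu>))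
   \<and> (\<forall>i\<in>{1..n}. e i = 1 \<or> e i = - 1)
   \<and> (\<forall>i\<in>{1..n}. \<forall>j\<in>{1..n}. Cg i j = int (r i) * \<alpha> i j + (if i = j then e j else 0))
   \<and> (\<forall>\<iota>\<in>idx n r. \<forall>\<nu>\<in>idx n r. Cc \<iota> \<nu> = \<alpha> (fst \<iota>) (fst \<nu>) + (if \<iota> = \<nu> then e (fst \<nu>) else 0))
   \<and> (\<forall>i\<in>{1..n}. \<forall>u. u \<noteq> 0 \<longrightarrow> poly (Zg i) u = homog (e i) (\<lambda>m. to_fract (z_coeff r i m)) (r i) 1 u)
   \<and> (\<forall>\<iota>\<in>idx n r. indets (Fc \<iota>) \<subseteq> Yt ` idx n r)
   \<and> (\<forall>\<iota>\<in>idx n r. pos_at_1 (Fc \<iota>))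
   \<and> equivariant n r Fc
   \<and> (\<forall>i\<in>{1..n}. Fg i = at_e_eq_z n r (block_F r Fc i))"

text \<open>For a row (k, l), the entries in the columns of block k are consecutive integers. Both
  they and their negative parts therefore sum to those of the single generalized entry r \<gamma> +
  e.\<close>

lemma sum_block_mutation:
  fixes \<gamma> e b b' :: int
  assumes "e = 1 \<or> e = - 1" "l \<in> {1..r}"
  shows "(\<Sum>q=1..r. (\<gamma> + (if q = l then e else 0)) * b' + [- (\<gamma> + (if q = l then e else 0))]\<^sub>+ * b) =
    (int r * \<gamma> + e) * b' + [- (int r * \<gamma> + e)]\<^sub>+ * b"
proof -
  have e': "- e = 1 \<or> - e = - 1" using assms(1) by auto
  have "(\<Sum>q=1..r. \<gamma> + (if q = l then e else 0)) = int r * \<gamma> + e"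
    using assms(2) by (simp add: sum.distrib)
  moreover have "(\<Sum>q=1..r. [- (\<gamma> + (if q = l then e else 0))]\<^sub>+) = [- (int r * \<gamma> + e)]\<^sub>+"
  proof -
    have "[- (\<gamma> + (if q = l then e else 0))]\<^sub>+ = int (nat (- \<gamma> + (if q = l then - e else 0)))" for q
      by (cases "q = l") (simp_all add: pos_part_eq_nat)
    hence "(\<Sum>q=1..r. [- (\<gamma> + (if q = l then e else 0))]\<^sub>+) = int (\<Sum>q=1..r. nat (- \<gamma> + (if q = l then - e else 0)))"
      by (simp only: of_nat_sum)
    also have "\<dots> = int (nat (int r * - \<gamma> + - e))"
      by (simp only: sum_nat_shifted[OF e' assms(2)])
    also have "\<dots> = [- (int r * \<gamma> + e)]\<^sub>+"
      unfolding pos_part_eq_nat by (rule arg_cong[where f = "\<lambda>x. int (nat x)"]) simp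
    finally show ?thesis .
  qed
  ultimately show ?thesis
    by (simp only: sum.distrib sum_distrib_right[symmetric])
qed

lemma linked_step:
  assumes k: "k \<in> {1..n}" and r: "\<And>i. i \<in> {1..n} \<Longrightarrow> r i \<ge> 1" and d: "\<And>i. i \<in> {1..n} \<Longrightarrow> d i > 0"
    and linked: "linked n r d \<alpha> e Bg Cg Zg Fg Bc Cc Fc"
    and Bg': "\<And>i j. i \<in> {1..n} \<Longrightarrow> j \<in> {1..n} \<Longrightarrow> Bg' i j =
        (if i = k \<or> j = k then - Bg i j
         else Bg i j + int (r k) * (Bg i k * [Bg k j]\<^sub>+ + [- Bg i k]\<^sub>+ * Bg k j))"
    and Cg': "\<And>i j. i \<in> {1..n} \<Longrightarrow> j \<in> {1..n} \<Longrightarrow> Cg' i j =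
        (if j = k then - Cg i j
         else Cg i j + int (r k) * (Cg i k * [Bg k j]\<^sub>+ + [- Cg i k]\<^sub>+ * Bg k j))"
    and Zg': "\<And>u. u \<noteq> 0 \<Longrightarrow> poly (Zg' k) u = u ^ r k * poly (Zg k) (inverse u)"
      "\<And>i. i \<in> {1..n} \<Longrightarrow> i \<noteq> k \<Longrightarrow> Zg' i = Zg i"
    and Fg': "\<And>i. i \<in> {1..n} \<Longrightarrow> i \<noteq> k \<Longrightarrow> Fg' i = Fg i"
      "to_fract (Fg' k) = inverse (to_fract (Fg k))
          * (\<Prod>j=1..n. rvar (Y j) powi [- Cg j k]\<^sub>+ * to_fract (Fg j) powi [- Bg j k]\<^sub>+) ^ r k
          * poly (Zg k) (\<Prod>j=1..n. rvar (Y j) powi Cg j k * to_fract (Fg j) powi Bg j k)"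
    and agree: "agree_on (idx n r) (Bc', Cc', \<lambda>\<iota>. to_fract (Fc' \<iota>))
          (mu_block (idx n r) r k (Bc, Cc, \<lambda>\<iota>. to_fract (Fc \<iota>)))"
    and ind': "\<And>\<iota>. \<iota> \<in> idx n r \<Longrightarrow> indets (Fc' \<iota>) \<subseteq> Yt ` idx n r"
  shows "\<exists>\<alpha>' e'. linked n r d \<alpha>' e' Bg' Cg' Zg' Fg' Bc' Cc' Fc'"
proof -
  have skew: "\<And>i j. i \<in> {1..n} \<Longrightarrow> j \<in> {1..n} \<Longrightarrow> d i * Bg i j = - (d j * Bg j i)"
    and Bc: "\<And>\<iota> \<nu>. \<iota> \<in> idx n r \<Longrightarrow> \<nu> \<in> idx n r \<Longrightarrow> Bc \<iota> \<nu> = Bg (fst \<iota>) (fst \<nu>)"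
    and e: "\<And>i. i \<in> {1..n} \<Longrightarrow> e i = 1 \<or> e i = - 1"
    and Cg: "\<And>i j. i \<in> {1..n} \<Longrightarrow> j \<in> {1..n} \<Longrightarrow> Cg i j = int (r i) * \<alpha> i j + (if i = j then e j else 0)"
    and Cc: "\<And>\<iota> \<nu>. \<iota> \<in> idx n r \<Longrightarrow> \<nu> \<in> idx n r \<Longrightarrow> Cc \<iota> \<nu> = \<alpha> (fst \<iota>) (fst \<nu>) + (if \<iota> = \<nu> then e (fst \<nu>) else 0)"
    and Zg: "\<And>i u. i \<in> {1..n} \<Longrightarrow> u \<noteq> 0 \<Longrightarrow> poly (Zg i) u = homog (e i) (\<lambda>m. to_fract (z_coeff r i m)) (r i) 1 u"
    and ind: "\<And>\<iota>. \<iota> \<in> idx n r \<Longrightarrow> indets (Fc \<iota>) \<subseteq> Yt ` idx n r"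
    and pos: "\<And>\<iota>. \<iota> \<in> idx n r \<Longrightarrow> pos_at_1 (Fc \<iota>)"
    and eqv: "equivariant n r Fc"
    and Fg: "\<And>i. i \<in> {1..n} \<Longrightarrow> Fg i = at_e_eq_z n r (block_F r Fc i)"
    using linked unfolding linked_def by blast+
  have fst: "fst \<iota> \<in> {1..n}" if "\<iota> \<in> idx n r" for \<iota>
    using that by (auto simp: idx_def)
  have bkk: "Bg k k = 0"
    using skew[OF k k] d[OF k] by auto
  have Fc_neq_0: "Fc \<iota> \<noteq> 0" if "\<iota> \<in> idx n r" for \<iota>
    using pos[OF that] by (rule pos_at_1_neq_0)
  hence Fc_neq_0': "\<forall>\<iota>\<in>idx n r. Fc \<iota> \<noteq> 0" by blast
  have Bc': "\<forall>\<iota>\<in>idx n r. \<forall>\<nu>\<in>idx n r. Bc \<iota> \<nu> = Bg (fst \<iota>) (fst \<nu>)" using Bc by blast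
  note step = composite_step[of k n Bg r Bc Fc Bc' Cc' Fc' Cc, OF k bkk Bc' Fc_neq_0' agree]
  \<comment> \<open>For i \<noteq> k the columns of block k contribute equally, whence the factor
    r_k. For i = k their contributions add up to that of the single entry \<open>Cg k k\<close>, by
    \<open>sum_block_mutation\<close>.\<close>
  define \<alpha>' where "\<alpha>' i j = (if j = k then - \<alpha> i j
      else \<alpha> i j + (if i = k then Cg k k * [Bg k j]\<^sub>+ + [- Cg k k]\<^sub>+ * Bg k j
        else int (r k) * (\<alpha> i k * [Bg k j]\<^sub>+ + [- \<alpha> i k]\<^sub>+ * Bg k j)))" for i j
  define e' where "e' i = (if i = k then - e i else e i)" for i
  have ex: "composite_exchange n r k (\<lambda>i. Bg i k) (\<lambda>i. \<alpha> i k) (e k) Fc Fc'"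
    unfolding composite_exchange_def
  proof (intro conjI ballI impI)
    fix \<nu> assume "\<nu> \<in> idx n r" "fst \<nu> \<noteq> k"
    thus "Fc' \<nu> = Fc \<nu>" by (intro step(3)[of \<nu> \<nu>])
  next
    fix q assume "q \<in> {1..r k}"
    hence \<nu>: "(k, q) \<in> idx n r" using k by (simp add: idx_def)
    have "Cc \<iota> (k, q) = \<alpha> (fst \<iota>) k + (if \<iota> = (k, q) then e k else 0)" if "\<iota> \<in> idx n r" for \<iota>
      using Cc[OF that \<nu>] by simp
    thus "Fc' (k, q) * Fc (k, q) =
      (\<Prod>\<iota>\<in>idx n r. Var (Yt \<iota>) ^ nat (- (\<alpha> (fst \<iota>) k + (if \<iota> = (k, q) then e k else 0))) * Fc \<iota> ^ nat (- Bg (fst \<iota>) k)) +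
      (\<Prod>\<iota>\<in>idx n r. Var (Yt \<iota>) ^ nat (\<alpha> (fst \<iota>) k + (if \<iota> = (k, q) then e k else 0)) * Fc \<iota> ^ nat (Bg (fst \<iota>) k))"
      using step(4)[OF \<nu> \<nu>] by simp
  qed
  have eqv': "equivariant n r Fc'"
    using ex k Fc_neq_0 eqv by (rule equivariant_exchange)
  have Fg_neq_0: "\<forall>i\<in>{1..n}. Fg i \<noteq> 0"
    using at_e_eq_z_block_F_neq_0[of n r Fc] eqv ind pos Fg by simp
  have "linked n r d \<alpha>' e' Bg' Cg' Zg' Fg' Bc' Cc' Fc'"
    unfolding linked_def
  proof (intro conjI ballI allI impI)
    fix i j assume ij: "i \<in> {1..n}" "j \<in> {1..n}"
    show "d i * Bg' i j = - (d j * Bg' j i)"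
      using skew[OF ij] skew_mutation[of d i j k Bg "int (r k)", OF d[OF ij(1)] d[OF ij(2)] d[OF k]
          skew[OF ij] skew[OF ij(1) k] skew[OF ij(2) k]]
      unfolding Bg'[OF ij] Bg'[OF ij(2,1)] by auto
    show "Cg' i j = int (r i) * \<alpha>' i j + (if i = j then e' j else 0)"
    proof (cases "j = k")
      case True
      thus ?thesis using Cg[OF ij] Cg'[OF ij] by (simp add: \<alpha>'_def e'_def)
    next
      case jk: False
      show ?thesis
      proof (cases "i = k")
        case True
        thus ?thesis using Cg[OF ij] Cg'[OF ij] jk by (simp add: \<alpha>'_def e'_def distrib_left)
      next
        case False
        have "[- (int (r i) * \<alpha> i k)]\<^sub>+ = int (r i) * [- \<alpha> i k]\<^sub>+"
          by (simp add: pos_part_def max_def mult_le_0_iff zero_le_mult_iff)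
        thus ?thesis using Cg[OF ij] Cg[OF ij(1) k] Cg'[OF ij] jk False
          by (simp add: \<alpha>'_def e'_def algebra_simps)
      qed
    qed
  next
    fix \<iota> \<nu> assume \<iota>\<nu>: "\<iota> \<in> idx n r" "\<nu> \<in> idx n r"
    show "Bc' \<iota> \<nu> = Bg' (fst \<iota>) (fst \<nu>)"
      using step(1)[OF \<iota>\<nu>] fst[OF \<iota>\<nu>(1)] fst[OF \<iota>\<nu>(2)] by (simp add: Bg')
    show "Cc' \<iota> \<nu> = \<alpha>' (fst \<iota>) (fst \<nu>) + (if \<iota> = \<nu> then e' (fst \<nu>) else 0)"
    proof (cases "fst \<nu> = k")
      case True
      thus ?thesis using step(2)[OF \<iota>\<nu>] Cc[OF \<iota>\<nu>] by (simp add: \<alpha>'_def e'_def)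
    next
      case False
      obtain i l where \<iota>: "\<iota> = (i, l)" "i \<in> {1..n}" "l \<in> {1..r i}" using \<iota>\<nu>(1) by (auto simp: idx_def)
      have "Cc \<iota> (k, q) = \<alpha> i k + (if \<iota> = (k, q) then e k else 0)" if "q \<in> {1..r k}" for q
        using Cc[OF \<iota>\<nu>(1), of "(k, q)"] that k \<iota> by (simp add: idx_def)
      hence "(\<Sum>q=1..r k. Cc \<iota> (k, q) * [Bg k (fst \<nu>)]\<^sub>+ + [- Cc \<iota> (k, q)]\<^sub>+ * Bg k (fst \<nu>)) =
          (\<Sum>q=1..r k. (\<alpha> i k + (if \<iota> = (k, q) then e k else 0)) * [Bg k (fst \<nu>)]\<^sub>+ +
             [- (\<alpha> i k + (if \<iota> = (k, q) then e k else 0))]\<^sub>+ * Bg k (fst \<nu>))"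
        by (intro sum.cong refl) simp
      also have "\<dots> = (if i = k then Cg k k * [Bg k (fst \<nu>)]\<^sub>+ + [- Cg k k]\<^sub>+ * Bg k (fst \<nu>)
        else int (r k) * (\<alpha> i k * [Bg k (fst \<nu>)]\<^sub>+ + [- \<alpha> i k]\<^sub>+ * Bg k (fst \<nu>)))"
      proof (cases "i = k")
        case True
        have "(\<iota> = (k, q)) = (q = l)" for q using \<iota> True by auto
        thus ?thesis
          using sum_block_mutation[of "e k" l "r k" "\<alpha> k k"] e[OF k] \<iota> True Cg[OF k k] by simp
      qed (simp add: \<iota>)
      finally show ?thesis using step(2)[OF \<iota>\<nu>] Cc[OF \<iota>\<nu>] False \<iota> by (simp add: \<alpha>'_def e'_def)
    qed
  next
    fix i assume i: "i \<in> {1..n}"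
    show "e' i = 1 \<or> e' i = - 1" using e[OF i] by (auto simp: e'_def)
    show "Fg' i = at_e_eq_z n r (block_F r Fc' i)"
    proof (cases "i = k")
      case False
      have "Fc' (i, l) = Fc (i, l)" if "l \<in> {1..r i}" for l
        using ex that i False by (simp add: composite_exchange_def idx_def)
      hence "block_F r Fc' i = block_F r Fc i" by (simp add: block_F_def)
      thus ?thesis using Fg'(1)[OF i False] Fg[OF i] by simp
    next
      case True
      have "Fg' k * Fg k = homog (e k) (z_coeff r k) (r k)
          (\<Prod>j=1..n. Var (Y j) ^ nat (- Cg j k) * Fg j ^ nat (- Bg j k))
          (\<Prod>j=1..n. Var (Y j) ^ nat (Cg j k) * Fg j ^ nat (Bg j k))"
        using Fg_neq_0 k Zg[OF k] Fg'(2) by (rule generalized_exchange)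
      also have "\<dots> = homog (e k) (z_coeff r k) (r k)
          (\<Prod>j=1..n. Var (Y j) ^ nat (- (int (r j) * \<alpha> j k + (if j = k then e k else 0))) *
             at_e_eq_z n r (block_F r Fc j) ^ nat (- Bg j k))
          (\<Prod>j=1..n. Var (Y j) ^ nat (int (r j) * \<alpha> j k + (if j = k then e k else 0)) *
             at_e_eq_z n r (block_F r Fc j) ^ nat (Bg j k))"
        by (intro arg_cong2[where f = "homog (e k) (z_coeff r k) (r k)"] prod.cong refl)
           (simp_all add: Cg[OF _ k] Fg)
      also have "\<dots> = at_e_eq_z n r (block_F r Fc' k) * at_e_eq_z n r (block_F r Fc k)"
        by (rule at_e_eq_z_exchange[symmetric]) (rule e[OF k] k ex eqv eqv' | erule r ind ind')+
      finally have "Fg' k * Fg k = at_e_eq_z n r (block_F r Fc' k) * Fg k"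
        using Fg[OF k] by simp
      \<comment> \<open>Both sides solve the same exchange relation, so they agree after cancelling
        \<open>Fg k\<close>; this is where positivity enters.\<close>
      moreover have "Fg k \<noteq> 0" using Fg_neq_0 k by blast
      ultimately show ?thesis using True by simp
    qed
    fix u :: "pol fract" assume u: "u \<noteq> 0"
    show "poly (Zg' i) u = homog (e' i) (\<lambda>m. to_fract (z_coeff r i m)) (r i) 1 u"
    proof (cases "i = k")
      case True
      thus ?thesis using Zg'(1)[OF u] Zg[OF k, of "inverse u"] homog_reciprocal[OF u e[OF k]] u
        by (simp add: e'_def)
    qed (use Zg'(2)[OF i] Zg[OF i u] in \<open>simp add: e'_def\<close>)
  next
    fix \<iota> assume \<iota>: "\<iota> \<in> idx n r"
    show "indets (Fc' \<iota>) \<subseteq> Yt ` idx n r" by (rule ind'[OF \<iota>])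
    show "pos_at_1 (Fc' \<iota>)" using ex k pos \<iota> by (rule pos_at_1_exchange)
  qed (rule eqv')
  thus ?thesis by blast
qed

lemma linked_initial:
  assumes r: "\<And>i. i \<in> {1..n} \<Longrightarrow> r i \<ge> 1"
    and skew: "\<And>i j. i \<in> {1..n} \<Longrightarrow> j \<in> {1..n} \<Longrightarrow> d i * Bg i j = - (d j * Bg j i)"
    and Cg: "\<And>i j. i \<in> {1..n} \<Longrightarrow> j \<in> {1..n} \<Longrightarrow> Cg i j = (if i = j then 1 else 0)"
    and Zg: "\<And>i. i \<in> {1..n} \<Longrightarrow> Zg i = 1 + (\<Sum>l=1..r i - 1. monom (rvar (Z (i, l))) l) + monom 1 (r i)"
    and Fg: "\<And>i. i \<in> {1..n} \<Longrightarrow> Fg i = 1"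
    and Bc: "\<And>\<iota> \<nu>. \<iota> \<in> idx n r \<Longrightarrow> \<nu> \<in> idx n r \<Longrightarrow> Bc \<iota> \<nu> = Bg (fst \<iota>) (fst \<nu>)"
    and Cc: "\<And>\<iota> \<nu>. \<iota> \<in> idx n r \<Longrightarrow> \<nu> \<in> idx n r \<Longrightarrow> Cc \<iota> \<nu> = (if \<iota> = \<nu> then 1 else 0)"
    and Fc: "\<And>\<iota>. \<iota> \<in> idx n r \<Longrightarrow> Fc \<iota> = 1"
  shows "linked n r d (\<lambda>_ _. 0) (\<lambda>_. 1) Bg Cg Zg Fg Bc Cc Fc"
  unfolding linked_def
proof (intro conjI ballI allI impI)
  fix i u assume i: "i \<in> {1..n}"
  have split: "{..r i} = insert 0 (insert (r i) {1..r i - 1})" using r[OF i] by auto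
  have "(\<Sum>m\<le>r i. to_fract (z_coeff r i m) * u ^ m) = 1 + (\<Sum>m=1..r i - 1. to_fract (z_coeff r i m) * u ^ m) + u ^ r i"
    unfolding split using r[OF i] by (simp add: z_coeff_def)
  also have "(\<Sum>m=1..r i - 1. to_fract (z_coeff r i m) * u ^ m) = (\<Sum>m=1..r i - 1. rvar (Z (i, m)) * u ^ m)"
    using r[OF i] by (intro sum.cong refl) (auto simp: z_coeff_def)
  finally show "poly (Zg i) u = homog 1 (\<lambda>m. to_fract (z_coeff r i m)) (r i) 1 u"
    by (simp add: Zg[OF i] homog_def poly_sum poly_monom)
next
  fix i assume i: "i \<in> {1..n}"
  have "block_F r Fc i = 1"
    using i Fc by (simp add: block_F_def idx_def eval_Yt_def)
  thus "Fg i = at_e_eq_z n r (block_F r Fc i)" by (simp add: Fg[OF i] at_e_eq_z_1)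
next
  show "equivariant n r Fc"
    unfolding equivariant_def
  proof (intro ballI)
    fix j l m \<iota> assume "j \<in> {1..n}" "l \<in> {1..r j}" "m \<in> {1..r j}" and \<iota>: "\<iota> \<in> idx n r"
    hence "swap j l m \<iota> \<in> idx n r" using swap_in_idx[of j n l r m \<iota>] by blast
    thus "Fc (swap j l m \<iota>) = subst (\<lambda>x. Var (rename_Yt (swap j l m) x)) (Fc \<iota>)"
      using Fc \<iota> by simp
  qed
qed ((rule skew; assumption) | simp add: Cg Bc Cc Fc)+

lemma labelled_regular_tree_induct:
  assumes tree: "labelled_regular_tree n V adj" and "t0 \<in> V" "t \<in> V" and base: "P t0"
    and step: "\<And>k t t'. adj k t t' \<Longrightarrow> P t \<Longrightarrow> P t'"
  shows "P t"
proof -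
  have "P (last ts)" if "successively (\<lambda>u v. \<exists>k. adj k u v) ts" "ts \<noteq> []" "P (hd ts)" for ts
    using that
  proof (induction ts)
    case (Cons u ts)
    thus ?case by (cases ts) (auto dest: step)
  qed simp
  moreover obtain ts where "simple_path adj t0 t ts"
    using tree assms(2,3) unfolding labelled_regular_tree_def by blast
  ultimately show ?thesis using base by (auto simp: simple_path_def)
qed

theorem proposition6p4:
  fixes n :: nat and r :: "nat \<Rightarrow> nat"
    and V :: "'v set" and adj :: "nat \<Rightarrow> 'v \<Rightarrow> 'v \<Rightarrow> bool" and t0 :: 'v
    and B0 :: "nat \<Rightarrow> nat \<Rightarrow> int"
    and Bg Cg :: "'v \<Rightarrow> nat \<Rightarrow> nat \<Rightarrow> int"
    and Zg :: "'v \<Rightarrow> nat \<Rightarrow> pol fract poly"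
    and Fg :: "'v \<Rightarrow> nat \<Rightarrow> pol"
    and Bc Cc :: "'v \<Rightarrow> nat \<times> nat \<Rightarrow> nat \<times> nat \<Rightarrow> int"
    and Fc :: "'v \<Rightarrow> nat \<times> nat \<Rightarrow> pol"
  assumes "n \<ge> 1"
    and "\<forall>i\<in>{1..n}. r i \<ge> 1"
    and "labelled_regular_tree n V adj"
    and "t0 \<in> V"
    and "skew_symmetrizable n B0"
    and "gen_B_pattern n r adj t0 B0 Bg"
    and "gen_C_pattern n r adj t0 Bg Cg"
    and "gen_Z_pattern n r adj t0 Zg"
    and "gen_F_pattern n r V adj t0 Bg Cg Zg Fg"
    and "composite_pattern n r V adj t0 B0 Bc Cc Fc"
  shows "\<forall>i\<in>{1..n}. \<forall>t\<in>V. \<forall>l0\<in>{1..r i}.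
      Fg t i = at_e_eq_z n r (\<Prod>l=1..r i. eval_Yt (Fc t (i, l)) sy)
    \<and> at_e_eq_z n r (\<Prod>l=1..r i. eval_Yt (Fc t (i, l)) sy) =
      at_e_eq_z n r (\<Prod>m=1..r i. eval_Yt (Fc t (i, l0))
        (permute_tuple sy (Transposition.transpose (i, l0) (i, m))))"
proof -
  have r: "r i \<ge> 1" if "i \<in> {1..n}" for i using assms(2) that by blast
  obtain d :: "nat \<Rightarrow> int" where d: "\<And>i. i \<in> {1..n} \<Longrightarrow> d i > 0"
    and skew: "\<And>i j. i \<in> {1..n} \<Longrightarrow> j \<in> {1..n} \<Longrightarrow> d i * B0 i j = - (d j * B0 j i)"
    using assms(5) unfolding skew_symmetrizable_def by blast
  have B0: "Bg t0 i j = B0 i j" if "i \<in> {1..n}" "j \<in> {1..n}" for i j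
    using assms(6) that unfolding gen_B_pattern_def by blast
  define Inv where "Inv t \<longleftrightarrow> (\<exists>\<alpha> e. linked n r d \<alpha> e (Bg t) (Cg t) (Zg t) (Fg t) (Bc t) (Cc t) (Fc t))" for t
  have "Inv t" if "t \<in> V" for t
    using assms(3,4) that
  proof (rule labelled_regular_tree_induct)
    have init: "agree_on (idx n r) (Bc t0, Cc t0, \<lambda>\<iota>. to_fract (Fc t0 \<iota>))
       (\<lambda>\<iota> \<nu>. B0 (fst \<iota>) (fst \<nu>), \<lambda>\<iota> \<nu>. if \<iota> = \<nu> then 1 else 0, \<lambda>\<iota>. 1)"
      using assms(10) unfolding composite_pattern_def by blast
    have "linked n r d (\<lambda>_ _. 0) (\<lambda>_. 1) (Bg t0) (Cg t0) (Zg t0) (Fg t0) (Bc t0) (Cc t0) (Fc t0)"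
    proof (rule linked_initial)
      fix \<iota> \<nu> assume \<iota>\<nu>: "\<iota> \<in> idx n r" "\<nu> \<in> idx n r"
      hence "fst \<iota> \<in> {1..n}" "fst \<nu> \<in> {1..n}" by (auto simp: idx_def)
      thus "Bc t0 \<iota> \<nu> = Bg t0 (fst \<iota>) (fst \<nu>)"
        using init \<iota>\<nu> by (simp add: agree_on_def B0)
      show "Cc t0 \<iota> \<nu> = (if \<iota> = \<nu> then 1 else 0)"
        using init \<iota>\<nu> by (simp add: agree_on_def)
    next
      fix \<iota> assume "\<iota> \<in> idx n r"
      hence "to_fract (Fc t0 \<iota>) = to_fract 1" using init by (simp add: agree_on_def)
      thus "Fc t0 \<iota> = 1" by (simp only: to_fract_eq_iff)
    next
      fix i j assume ij: "i \<in> {1..n}" "j \<in> {1..n}"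
      show "d i * Bg t0 i j = - (d j * Bg t0 j i)"
        unfolding B0[OF ij] B0[OF ij(2,1)] by (rule skew[OF ij])
      show "Cg t0 i j = (if i = j then 1 else 0)"
        using assms(7) ij unfolding gen_C_pattern_def by blast
    next
      fix i assume i: "i \<in> {1..n}"
      show "r i \<ge> 1" by (rule r[OF i])
      show "Zg t0 i = 1 + (\<Sum>l=1..r i - 1. monom (rvar (Z (i, l))) l) + monom 1 (r i)"
        using assms(8) i unfolding gen_Z_pattern_def by blast
      show "Fg t0 i = 1"
        using assms(9) i unfolding gen_F_pattern_def by blast
    qed
    thus "Inv t0" unfolding Inv_def by blast
  next
    fix k t t' assume adj: "adj k t t'" and "Inv t"
    then obtain \<alpha> e where linked: "linked n r d \<alpha> e (Bg t) (Cg t) (Zg t) (Fg t) (Bc t) (Cc t) (Fc t)"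
      unfolding Inv_def by blast
    have k: "k \<in> {1..n}" and t': "t' \<in> V"
      using assms(3) adj unfolding labelled_regular_tree_def by blast+
    have "\<exists>\<alpha>' e'. linked n r d \<alpha>' e' (Bg t') (Cg t') (Zg t') (Fg t') (Bc t') (Cc t') (Fc t')"
    proof (rule linked_step[OF k r d linked])
      fix i j assume ij: "i \<in> {1..n}" "j \<in> {1..n}"
      show "Bg t' i j = (if i = k \<or> j = k then - Bg t i j
         else Bg t i j + int (r k) * (Bg t i k * [Bg t k j]\<^sub>+ + [- Bg t i k]\<^sub>+ * Bg t k j))"
        using assms(6) adj ij unfolding gen_B_pattern_def by blast
      show "Cg t' i j = (if j = k then - Cg t i j
         else Cg t i j + int (r k) * (Cg t i k * [Bg t k j]\<^sub>+ + [- Cg t i k]\<^sub>+ * Bg t k j))"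
        using assms(7) adj ij unfolding gen_C_pattern_def by blast
    next
      fix u :: "pol fract" assume "u \<noteq> 0"
      thus "poly (Zg t' k) u = u ^ r k * poly (Zg t k) (inverse u)"
        using assms(8) adj unfolding gen_Z_pattern_def by blast
    next
      fix i assume i: "i \<in> {1..n}" "i \<noteq> k"
      show "Zg t' i = Zg t i"
        using assms(8) adj i unfolding gen_Z_pattern_def by blast
      show "Fg t' i = Fg t i"
        using assms(9) adj i unfolding gen_F_pattern_def by blast
    next
      show "to_fract (Fg t' k) = inverse (to_fract (Fg t k))
          * (\<Prod>j=1..n. rvar (Y j) powi [- Cg t j k]\<^sub>+ * to_fract (Fg t j) powi [- Bg t j k]\<^sub>+) ^ r k
          * poly (Zg t k) (\<Prod>j=1..n. rvar (Y j) powi Cg t j k * to_fract (Fg t j) powi Bg t j k)"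
        using assms(9) adj unfolding gen_F_pattern_def by blast
      show "agree_on (idx n r) (Bc t', Cc t', \<lambda>\<iota>. to_fract (Fc t' \<iota>))
          (mu_block (idx n r) r k (Bc t, Cc t, \<lambda>\<iota>. to_fract (Fc t \<iota>)))"
        using assms(10) adj unfolding composite_pattern_def by blast
    next
      fix \<iota> assume "\<iota> \<in> idx n r"
      thus "indets (Fc t' \<iota>) \<subseteq> Yt ` idx n r"
        using assms(10) t' unfolding composite_pattern_def by blast
    qed
    thus "Inv t'" unfolding Inv_def .
  qed
  note inv = this
  show ?thesis
  proof (intro ballI conjI)
    fix i t l0 assume i: "i \<in> {1..n}" and t: "t \<in> V" and l0: "l0 \<in> {1..r i}"
    have eqv: "equivariant n r (Fc t)" and Fg: "Fg t i = at_e_eq_z n r (block_F r (Fc t) i)"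
      using inv[OF t] i unfolding Inv_def linked_def by blast+
    show "Fg t i = at_e_eq_z n r (\<Prod>l=1..r i. eval_Yt (Fc t (i, l)) sy)"
      using Fg by (simp only: block_F_def)
    \<comment> \<open>The factors of the two products agree one by one, so the second equality holds
      already before the specialization.\<close>
    have "eval_Yt (Fc t (i, m)) sy = eval_Yt (Fc t (i, l0)) (permute_tuple sy (swap i l0 m))"
      if m: "m \<in> {1..r i}" for m
      using eval_Yt_swap[OF eqv i l0 m, of "(i, l0)"] i l0 by (simp add: idx_def)
    thus "at_e_eq_z n r (\<Prod>l=1..r i. eval_Yt (Fc t (i, l)) sy) =
      at_e_eq_z n r (\<Prod>m=1..r i. eval_Yt (Fc t (i, l0)) (permute_tuple sy (swap i l0 m)))"
      by (intro arg_cong[where f = "at_e_eq_z n r"] prod.cong refl)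
  qed
qed

end
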